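(* Let $Z:\mathfrak{H}^0\to\mathbb{R}$ be a $\mathbb{Q}$-linear map which satisfies the double shuffle relation, the duality relation, and the regularization theorem $Z_{\sqcup\!\sqcup}(\mathbf{k};T)=\rho_Z\bigl(Z_*(\mathbf{k};T)\bigr)$ for every index $\mathbf{k}$ (equivalently, given the double shuffle relation, the integral-series identity $Z(\mu(\mathbf{k},\mathbf{l}))=Z(\mathbf{k}\circledast\mathbf{l}^\star)$ for all non-empty indices $\mathbf{k},\mathbf{l}$). Then $Z$ satisfies Kawashima's relation: for all non-empty indices $\mathbf{k},\mathbf{l}$ and every integer $m\ge1$, \[\sum_{\substack{p,q\ge1\\ p+q=m}}Z\bigl((\underbrace{1,\dots,1}_p)\circledast(\mathbf{k}^\vee)^\star\bigr)\,Z\bigl((\underbrace{1,\dots,1}_q)\circledast(\mathbf{l}^\vee)^\star\bigr)=-Z\bigl((\underbrace{1,\dots,1}_m)\circledast((\mathbf{k}\mathbin{\bar{*}}\mathbf{l})^\vee)^\star\bigr).\]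
   Context: Let $\mathfrak{H}=\mathbb{Q}\langle e_0,e_1\rangle$, $\mathfrak{H}^1=\mathbb{Q}+e_1\mathfrak{H}$, $\mathfrak{H}^0=\mathbb{Q}+e_1\mathfrak{H}e_0$, $e_k=e_1e_0^{k-1}$. Indices (finite possibly empty sequences $(k_1,\dots,k_r)$ of positive integers; admissible if empty or $k_r\ge2$) are identified with words $e_{k_1}\cdots e_{k_r}$ (empty $\leftrightarrow1$); maps are extended $\mathbb{Q}$-linearly. Shuffle $\sqcup\!\sqcup$: bilinear, $1\sqcup\!\sqcup w=w\sqcup\!\sqcup1=w$, $av\sqcup\!\sqcup bw=a(v\sqcup\!\sqcup bw)+b(av\sqcup\!\sqcup w)$ ($a,b\in\{e_0,e_1\}$). Harmonic $*$ on $\mathfrak{H}^1$: $1*w=w*1=w$, $e_kv*e_lw=e_k(v*e_lw)+e_l(e_kv*w)+e_{k+l}(v*w)$. Star-harmonic $\bar{*}$ on $\mathfrak{H}^1$: $1\mathbin{\bar*}w=w\mathbin{\bar*}1=w$, $e_kv\mathbin{\bar*}e_lw=e_k(v\mathbin{\bar*}e_lw)+e_l(e_kv\mathbin{\bar*}w)-e_{k+l}(v\mathbin{\bar*}w)$. Double shuffle relation: $Z(v\sqcup\!\sqcup w)=Z(v*w)=Z(v)Z(w)$ for all $v,w\in\mathfrak{H}^0$. Then $Z_{\sqcup\!\sqcup},Z_*:\mathfrak{H}^1\to\mathbb{R}[T]$ are the unique algebra homomorphisms for $\sqcup\!\sqcup$ resp. $*$ extending $Z$ with $e_1\mapsto T$.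 $A_Z(u)=\exp\bigl(\sum_{n\ge2}\frac{(-1)^n}{n}Z(e_n)u^n\bigr)$; $\rho_Z$ is the $\mathbb{R}$-linear map on $\mathbb{R}[T]$ with $\rho_Z(e^{Tu})=A_Z(u)e^{Tu}$ (coefficientwise in $u$). Duality relation: $Z(w)=Z(w^\dagger)$ for all $w\in\mathfrak{H}^0$, where $w\mapsto w^\dagger$ is the anti-automorphism of $\mathfrak{H}$ with $e_0^\dagger=e_1$, $e_1^\dagger=e_0$. $\circledast:e_1\mathfrak{H}\times e_1\mathfrak{H}\to e_1\mathfrak{H}e_0$ is bilinear with $ve_k\circledast we_l=(v*w)e_{k+l}$. For non-empty $\mathbf{k}=(k_1,\dots,k_r)$, $\mathbf{k}^\star$ is the sum of the $2^{r-1}$ indices $(k_1\bigcirc\cdots\bigcirc k_r)$, each $\bigcirc$ a comma or plus. Hoffman dual: for an index $\mathbf{k}=(k_1,\dots,k_r)$ of weight $k$, $\mathbf{k}^\vee=(k'_1,\dots,k'_{r'})$ is the index of weight $k$ with $\{1,\dots,k-1\}=\{k_1,k_1+k_2,\dots,k_1+\dots+k_{r-1}\}\sqcup\{k'_1,k'_1+k'_2,\dots,k'_1+\dots+k'_{r'-1}\}$ (disjoint union); extended linearly to $\mathfrak{H}^1$. For the parenthetical equivalent hypothesis: a 2-poset is a finite poset with labels $\delta:X\to\{0,1\}$; $W(X)$ is the sum over all linear extensions $x_1,\dots,x_n$ of $e_{\delta(x_1)}\cdots e_{\delta(x_n)}$. For non-empty $\mathbf{k}=(k_1,\dots,k_r)$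 of weight $K$ and non-empty $\mathbf{l}=(l_1,\dots,l_s)$, $\mu(\mathbf{k},\mathbf{l})=W(Q)$ where $Q$ has elements $a_1,\dots,a_K$, $b_{j,i}$ ($1\le j\le s$, $1\le i\le l_j$), order generated by $a_1<\cdots<a_K<b_{s,1}$, $b_{j,1}<\cdots<b_{j,l_j}$, $b_{j-1,1}<b_{j,l_j}$ ($2\le j\le s$), labels $\delta(a_t)=1$ iff $t\in\{1,k_1+1,\dots,k_1+\dots+k_{r-1}+1\}$ (else 0), $\delta(b_{s,1})=0$, $\delta(b_{j,1})=1$ ($j<s$), $\delta(b_{j,i})=0$ ($i\ge2$). *)

theory Defs
  imports
    Complex_Main
    "HOL-Library.FuncSet"
    "HOL-Library.Poly_Mapping"
    "HOL-Computational_Algebra.Polynomial"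
    "HOL-Computational_Algebra.Formal_Power_Series"
begin

section \<open>The noncommutative polynomial algebra\<close>

text \<open>
  Words form the free monoid under concatenation. Writing it additively makes
  \<open>letter list \<Rightarrow>\<^sub>0 rat\<close>, with the convolution product of \<^theory>\<open>HOL-Library.Poly_Mapping\<close>,
  the free associative algebra over the rationals on two generators.
\<close>

instantiation list :: (type) monoid_add
begin

definition zero_list :: "'a list" where "zero_list = []"

definition plus_list :: "'a list \<Rightarrow> 'a list \<Rightarrow> 'a list" where "plus_list v w = v @ w"

instance
  by intro_classes (simp_all add: zero_list_def plus_list_def)

end

datatype letter = E0 | E1

type_synonym ncpoly = "letter list \<Rightarrow>\<^sub>0 rat"

definition word :: "letter list \<Rightarrow> ncpoly" where
  "word w = Poly_Mapping.single w 1"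

definition const :: "rat \<Rightarrow> ncpoly" where
  "const c = Poly_Mapping.single [] c"

definition linear_ext :: "(letter list \<Rightarrow> ncpoly) \<Rightarrow> ncpoly \<Rightarrow> ncpoly" where
  "linear_ext f x = (\<Sum>w\<in>Poly_Mapping.keys x. const (Poly_Mapping.lookup x w) * f w)"

definition bilinear_ext ::
    "(letter list \<Rightarrow> letter list \<Rightarrow> ncpoly) \<Rightarrow> ncpoly \<Rightarrow> ncpoly \<Rightarrow> ncpoly" where
  "bilinear_ext f x y = (\<Sum>v\<in>Poly_Mapping.keys x. \<Sum>w\<in>Poly_Mapping.keys y.
     const (Poly_Mapping.lookup x v * Poly_Mapping.lookup y w) * f v w)"

definition H1 :: "ncpoly set" where
  "H1 = {const c + word [E1] * h | c h. True}"

definition H0 :: "ncpoly set" where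
  "H0 = {const c + word [E1] * h * word [E0] | c h. True}"


section \<open>Indices\<close>

definition is_index :: "nat list \<Rightarrow> bool" where
  "is_index ks \<longleftrightarrow> (\<forall>k\<in>set ks. 1 \<le> k)"

definition index_word :: "nat list \<Rightarrow> letter list" where
  "index_word ks = concat (map (\<lambda>k. E1 # replicate (k - 1) E0) ks)"

text \<open>
  The inverse of \<open>index_word\<close>. Only its values on words that are empty or begin with \<open>E1\<close>
  matter; the first letter is therefore not inspected.
\<close>

function index_of :: "letter list \<Rightarrow> nat list" where
  "index_of [] = []"
| "index_of (a # w) =
     Suc (length (takeWhile (\<lambda>b. b = E0) w)) # index_of (dropWhile (\<lambda>b. b = E0) w)"
  by pat_completeness auto
termination
  by (relation "measure length") (auto simp: le_imp_less_Suc length_dropWhile_le)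

lemma index_word_hd: "index_word ks = [] \<or> hd (index_word ks) = E1"
  by (cases ks) (simp_all add: index_word_def)

lemma index_of_index_word:
  assumes "is_index ks"
  shows "index_of (index_word ks) = ks"
  using assms
proof (induction ks)
  case Nil
  then show ?case by (simp add: index_word_def)
next
  case (Cons k ks)
  define v where "v = index_word ks"
  have v: "v = [] \<or> hd v = E1"
    unfolding v_def by (rule index_word_hd)
  have kv: "index_word (k # ks) = E1 # replicate (k - 1) E0 @ v"
    by (simp add: index_word_def v_def)
  have t: "takeWhile (\<lambda>b. b = E0) v = []" "dropWhile (\<lambda>b. b = E0) v = v"
    using v by (cases v; auto)+
  have "index_of v = ks"
    using Cons by (simp add: v_def is_index_def)
  moreover have "1 \<le> k"
    using Cons.prems by (simp add: is_index_def)
  ultimately show ?case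
    by (simp add: kv t takeWhile_append dropWhile_append)
qed

lemma index_word_index_of:
  assumes "w = [] \<or> hd w = E1"
  shows "index_word (index_of w) = w \<and> is_index (index_of w)"
  using assms
proof (induction w rule: index_of.induct)
  case 1
  then show ?case by (simp add: index_word_def is_index_def)
next
  case (2 a w)
  let ?d = "dropWhile (\<lambda>b. b = E0) w" and ?t = "takeWhile (\<lambda>b. b = E0) w"
  have "?d = [] \<or> hd ?d = E1"
    using hd_dropWhile[of "\<lambda>b. b = E0" w] by (cases "hd ?d") auto
  then have IH: "index_word (index_of ?d) = ?d" "is_index (index_of ?d)"
    using "2.IH" by auto
  have "replicate (length ?t) E0 = ?t"
    by (rule replicate_length_same) (auto dest: set_takeWhileD)
  then show ?case
    using IH "2.prems" by (simp add: index_word_def is_index_def)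
qed

definition idx :: "nat list \<Rightarrow> ncpoly" where
  "idx ks = word (index_word ks)"


section \<open>Products\<close>

fun shuffle_words :: "letter list \<Rightarrow> letter list \<Rightarrow> ncpoly" where
  "shuffle_words [] w = word w"
| "shuffle_words v [] = word v"
| "shuffle_words (a # v) (b # w) =
     word [a] * shuffle_words v (b # w) + word [b] * shuffle_words (a # v) w"

definition shuffle :: "ncpoly \<Rightarrow> ncpoly \<Rightarrow> ncpoly" where
  "shuffle = bilinear_ext shuffle_words"

fun harmonic_indices :: "nat list \<Rightarrow> nat list \<Rightarrow> ncpoly" where
  "harmonic_indices [] ls = idx ls"
| "harmonic_indices ks [] = idx ks"
| "harmonic_indices (k # ks) (l # ls) =
     idx [k] * harmonic_indices ks (l # ls) + idx [l] * harmonic_indices (k # ks) ls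
     + idx [k + l] * harmonic_indices ks ls"

definition harmonic :: "ncpoly \<Rightarrow> ncpoly \<Rightarrow> ncpoly" where
  "harmonic = bilinear_ext (\<lambda>v w. harmonic_indices (index_of v) (index_of w))"

fun star_harmonic_indices :: "nat list \<Rightarrow> nat list \<Rightarrow> ncpoly" where
  "star_harmonic_indices [] ls = idx ls"
| "star_harmonic_indices ks [] = idx ks"
| "star_harmonic_indices (k # ks) (l # ls) =
     idx [k] * star_harmonic_indices ks (l # ls) + idx [l] * star_harmonic_indices (k # ks) ls
     - idx [k + l] * star_harmonic_indices ks ls"

definition star_harmonic :: "ncpoly \<Rightarrow> ncpoly \<Rightarrow> ncpoly" where
  "star_harmonic = bilinear_ext (\<lambda>v w. star_harmonic_indices (index_of v) (index_of w))"

definition circ_indices :: "nat list \<Rightarrow> nat list \<Rightarrow> ncpoly" where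
  "circ_indices ks ls =
     harmonic_indices (butlast ks) (butlast ls) * idx [last ks + last ls]"

text \<open>The product written as a circled asterisk; meaningful on \<open>e\<^sub>1\<HH> \<times> e\<^sub>1\<HH>\<close>.\<close>

definition circ_ast :: "ncpoly \<Rightarrow> ncpoly \<Rightarrow> ncpoly" where
  "circ_ast = bilinear_ext (\<lambda>v w. circ_indices (index_of v) (index_of w))"


section \<open>The maps star, Hoffman dual and dagger\<close>

text \<open>One entry for each way of replacing every comma by a comma or a plus.\<close>

fun merges :: "nat list \<Rightarrow> nat list list" where
  "merges [] = [[]]"
| "merges [k] = [[k]]"
| "merges (k # l # ks) = map ((#) k) (merges (l # ks)) @ merges ((k + l) # ks)"

definition star :: "ncpoly \<Rightarrow> ncpoly" where
  "star = linear_ext (\<lambda>w. \<Sum>ms\<leftarrow>merges (index_of w). idx ms)"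

definition partial_sums :: "nat list \<Rightarrow> nat set" where
  "partial_sums ks = {sum_list (take i ks) | i. 1 \<le> i \<and> i < length ks}"

definition hoffman_dual_index :: "nat list \<Rightarrow> nat list" where
  "hoffman_dual_index ks = (THE ls. is_index ls \<and> sum_list ls = sum_list ks
     \<and> partial_sums ks \<union> partial_sums ls = {1..<sum_list ks}
     \<and> partial_sums ks \<inter> partial_sums ls = {})"

definition hoffman_dual :: "ncpoly \<Rightarrow> ncpoly" where
  "hoffman_dual = linear_ext (\<lambda>w. idx (hoffman_dual_index (index_of w)))"

fun swap_letter :: "letter \<Rightarrow> letter" where
  "swap_letter E0 = E1"
| "swap_letter E1 = E0"

definition dagger :: "ncpoly \<Rightarrow> ncpoly" where
  "dagger = linear_ext (\<lambda>w. word (rev (map swap_letter w)))"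


section \<open>Relations\<close>

definition linear_on_H0 :: "(ncpoly \<Rightarrow> real) \<Rightarrow> bool" where
  "linear_on_H0 Z \<longleftrightarrow>
     (\<forall>x\<in>H0. \<forall>y\<in>H0. Z (x + y) = Z x + Z y) \<and>
     (\<forall>c. \<forall>x\<in>H0. Z (const c * x) = of_rat c * Z x)"

definition double_shuffle :: "(ncpoly \<Rightarrow> real) \<Rightarrow> bool" where
  "double_shuffle Z \<longleftrightarrow>
     (\<forall>v\<in>H0. \<forall>w\<in>H0. Z (shuffle v w) = Z (harmonic v w) \<and> Z (harmonic v w) = Z v * Z w)"

definition duality :: "(ncpoly \<Rightarrow> real) \<Rightarrow> bool" where
  "duality Z \<longleftrightarrow> (\<forall>w\<in>H0. Z w = Z (dagger w))"

definition is_regularized_hom ::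
    "(ncpoly \<Rightarrow> ncpoly \<Rightarrow> ncpoly) \<Rightarrow> (ncpoly \<Rightarrow> real) \<Rightarrow> (ncpoly \<Rightarrow> real poly) \<Rightarrow> bool" where
  "is_regularized_hom P Z \<phi> \<longleftrightarrow>
     \<phi> \<in> extensional H1 \<and>
     (\<forall>x\<in>H1. \<forall>y\<in>H1. \<phi> (x + y) = \<phi> x + \<phi> y) \<and>
     (\<forall>c. \<forall>x\<in>H1. \<phi> (const c * x) = smult (of_rat c) (\<phi> x)) \<and>
     \<phi> 1 = 1 \<and>
     (\<forall>x\<in>H1. \<forall>y\<in>H1. \<phi> (P x y) = \<phi> x * \<phi> y) \<and>
     (\<forall>x\<in>H0. \<phi> x = [:Z x:]) \<and>
     \<phi> (word [E1]) = [:0, 1:]"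

text \<open>
  The polynomial indeterminate is \<open>T\<close>. Such a homomorphism exists, and is unique, for both products
  when \<open>Z\<close> satisfies the double shuffle relation and \<open>Z 1 = 1\<close>; the values outside
  \<open>H1\<close> are fixed by extensionality.
\<close>

definition Z_shuffle :: "(ncpoly \<Rightarrow> real) \<Rightarrow> ncpoly \<Rightarrow> real poly" where
  "Z_shuffle Z = (THE \<phi>. is_regularized_hom shuffle Z \<phi>)"

definition Z_harmonic :: "(ncpoly \<Rightarrow> real) \<Rightarrow> ncpoly \<Rightarrow> real poly" where
  "Z_harmonic Z = (THE \<phi>. is_regularized_hom harmonic Z \<phi>)"

definition A_series :: "(ncpoly \<Rightarrow> real) \<Rightarrow> real fps" where
  "A_series Z =
     fps_exp 1 oo Abs_fps (\<lambda>n. if 2 \<le> n then (-1) ^ n / of_nat n * Z (idx [n]) else 0)"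

text \<open>The series \<open>e\<^sup>T\<^sup>u\<close> in the variable \<open>u\<close> over \<open>\<real>[T]\<close>.\<close>

definition exp_Tu :: "real poly fps" where
  "exp_Tu = Abs_fps (\<lambda>n. monom (1 / fact n) n)"

definition A_exp_Tu :: "(ncpoly \<Rightarrow> real) \<Rightarrow> real poly fps" where
  "A_exp_Tu Z = Abs_fps (\<lambda>n. [:fps_nth (A_series Z) n:]) * exp_Tu"

text \<open>As \<open>T\<^sup>n\<close> is \<open>n!\<close> times the coefficient of \<open>u\<^sup>n\<close> in \<open>e\<^sup>T\<^sup>u\<close>,
  the condition \<open>\<rho>(e\<^sup>T\<^sup>u) = A(u) e\<^sup>T\<^sup>u\<close> determines the linear map \<open>\<rho>\<close>:\<close>

definition rho :: "(ncpoly \<Rightarrow> real) \<Rightarrow> real poly \<Rightarrow> real poly" where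
  "rho Z p = (\<Sum>n\<le>degree p. smult (coeff p n * fact n) (fps_nth (A_exp_Tu Z) n))"

lemma rho_eq_sum:
  assumes "degree p \<le> N"
  shows "rho Z p = (\<Sum>n\<le>N. smult (coeff p n * fact n) (fps_nth (A_exp_Tu Z) n))"
  unfolding rho_def using assms
  by (intro sum.mono_neutral_left) (auto simp: coeff_eq_0)

lemma rho_add: "rho Z (p + q) = rho Z p + rho Z q"
proof -
  let ?N = "max (degree p) (degree q)"
  have "rho Z (p + q) = (\<Sum>n\<le>?N. smult (coeff (p + q) n * fact n) (fps_nth (A_exp_Tu Z) n))"
    by (rule rho_eq_sum) (rule degree_add_le_max)
  also have "\<dots> = (\<Sum>n\<le>?N. smult (coeff p n * fact n) (fps_nth (A_exp_Tu Z) n)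
      + smult (coeff q n * fact n) (fps_nth (A_exp_Tu Z) n))"
    by (simp only: coeff_add distrib_right smult_add_left)
  also have "\<dots> = rho Z p + rho Z q"
    by (simp only: sum.distrib rho_eq_sum[of p ?N Z, OF max.cobounded1]
        rho_eq_sum[of q ?N Z, OF max.cobounded2])
  finally show ?thesis .
qed

lemma rho_smult: "rho Z (smult c p) = smult c (rho Z p)"
proof -
  have "rho Z (smult c p) =
      (\<Sum>n\<le>degree p. smult (coeff (smult c p) n * fact n) (fps_nth (A_exp_Tu Z) n))"
    by (rule rho_eq_sum) (rule degree_smult_le)
  also have "\<dots> = (\<Sum>n\<le>degree p. smult c (smult (coeff p n * fact n) (fps_nth (A_exp_Tu Z) n)))"
    by (simp only: coeff_smult smult_smult mult.assoc)
  also have "\<dots> = smult c (rho Z p)"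
    unfolding rho_def
    by (rule poly_eqI) (simp add: coeff_sum sum_distrib_left mult.assoc)
  finally show ?thesis .
qed

lemma rho_exp_Tu: "rho Z (fps_nth exp_Tu n) = fps_nth (A_exp_Tu Z) n"
proof -
  have e: "fps_nth exp_Tu n = monom (1 / fact n) n"
    by (simp add: exp_Tu_def)
  have "rho Z (monom (1 / fact n) n) =
      (\<Sum>i\<le>n. smult (coeff (monom (1 / fact n) n) i * fact i) (fps_nth (A_exp_Tu Z) i))"
    by (rule rho_eq_sum) (rule degree_monom_le)
  also have "\<dots> = (\<Sum>i\<le>n. if i = n then fps_nth (A_exp_Tu Z) n else 0)"
    by (rule sum.cong) auto
  finally show ?thesis
    by (simp add: e)
qed

definition regularization :: "(ncpoly \<Rightarrow> real) \<Rightarrow> bool" where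
  "regularization Z \<longleftrightarrow>
     (\<forall>ks. is_index ks \<longrightarrow> Z_shuffle Z (idx ks) = rho Z (Z_harmonic Z (idx ks)))"


section \<open>2-posets and the integral-series identity\<close>

text \<open>A 2-poset is given by a finite carrier \<open>X\<close>, a reflexive order \<open>r\<close> and a labelling.\<close>

definition linear_extensions :: "'a set \<Rightarrow> 'a rel \<Rightarrow> 'a list set" where
  "linear_extensions X r = {xs. distinct xs \<and> set xs = X \<and>
     (\<forall>i j. i < length xs \<and> j < length xs \<and> (xs ! i, xs ! j) \<in> r \<longrightarrow> i \<le> j)}"

definition W :: "'a set \<Rightarrow> 'a rel \<Rightarrow> ('a \<Rightarrow> letter) \<Rightarrow> ncpoly" where
  "W X r \<delta> = (\<Sum>xs\<in>linear_extensions X r. word (map \<delta> xs))"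

datatype node = NodeA nat | NodeB nat nat

definition mu_carrier :: "nat list \<Rightarrow> nat list \<Rightarrow> node set" where
  "mu_carrier ks ls =
     {NodeA t | t. 1 \<le> t \<and> t \<le> sum_list ks} \<union>
     {NodeB j i | j i. 1 \<le> j \<and> j \<le> length ls \<and> 1 \<le> i \<and> i \<le> ls ! (j - 1)}"

definition mu_generators :: "nat list \<Rightarrow> nat list \<Rightarrow> node rel" where
  "mu_generators ks ls =
     {(NodeA t, NodeA (t + 1)) | t. 1 \<le> t \<and> t < sum_list ks} \<union>
     {(NodeA (sum_list ks), NodeB (length ls) 1)} \<union>
     {(NodeB j i, NodeB j (i + 1)) | j i.
        1 \<le> j \<and> j \<le> length ls \<and> 1 \<le> i \<and> i < ls ! (j - 1)} \<union>
     {(NodeB (j - 1) 1, NodeB j (ls ! (j - 1))) | j. 2 \<le> j \<and> j \<le> length ls}"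

fun mu_label :: "nat list \<Rightarrow> nat list \<Rightarrow> node \<Rightarrow> letter" where
  "mu_label ks ls (NodeA t) =
     (if t \<in> {sum_list (take i ks) + 1 | i. i < length ks} then E1 else E0)"
| "mu_label ks ls (NodeB j i) = (if i = 1 \<and> j < length ls then E1 else E0)"

definition mu :: "nat list \<Rightarrow> nat list \<Rightarrow> ncpoly" where
  "mu ks ls = W (mu_carrier ks ls) ((mu_generators ks ls)\<^sup>*) (mu_label ks ls)"

definition integral_series_identity :: "(ncpoly \<Rightarrow> real) \<Rightarrow> bool" where
  "integral_series_identity Z \<longleftrightarrow>
     (\<forall>ks ls. is_index ks \<and> ks \<noteq> [] \<and> is_index ls \<and> ls \<noteq> [] \<longrightarrow>
        Z (mu ks ls) = Z (circ_ast (idx ks) (star (idx ls))))"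

end

theory Submission
  imports Defs
begin

text \<open>
  Regularization: evaluate \<open>Z\<^sub>*\<close> and the shuffle regularization at a real number \<open>T = t\<close>.
  The map \<open>\<rho>\<close> is the differential operator \<open>A(d/dT)\<close>, and \<open>d/dT\<close> removes a trailing entry \<open>1\<close>
  from an index; hence the regularization theorem says that the shuffle regularization is the
  convolution, with respect to deconcatenation of indices, of the harmonic one with a functional \<open>\<kappa>\<close>
  supported on the indices \<open>(1, \<dots>, 1)\<close>. Cutting the sums and the zigzag posets at the relations
  between consecutive entries of \<open>l\<close> writes both sides of the integral-series identity as a
  convolution \<open>\<alpha> \<sigma>\<close>, where \<open>\<sigma>\<close> is the convolution inverse of the sign twist of the regularization.
  Passing from the harmonic to the shuffle regularization replaces \<open>\<alpha>\<close> by \<open>\<alpha> \<kappa>\<close> and \<open>\<sigma>\<close> by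
  \<open>\<kappa>\<^sup>-\<^sup>1 \<sigma>\<close> (up to signs), so the two sides agree. Conversely the identity for
  \<open>l = (1, \<dots>, 1)\<close> determines the shuffle regularization, the indices \<open>(1, \<dots>, 1)\<close> themselves being
  handled by Newton's identities.

  Kawashima's relation: the integral-series identity turns the values in question into zigzags whose
  duals are the zigzags of \<open>k\<close> with a chain of letters \<open>e\<^sub>0\<close> above one node. Cutting these expresses
  the generating function as the convolution of a shifted regularization (the exponential of the derivation
  \<open>e\<^sub>k \<mapsto> k e\<^sub>k\<^sub>+\<^sub>1\<close>) with \<open>\<sigma>\<close>. By the above, it may be computed with the harmonic regularization, for
  which both factors are characters of the star-harmonic product.
\<close>

section \<open>Linear functionals on noncommutative polynomials\<close>

text \<open>All computations are dual: an element enters only through its values \<open>ev f\<close>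
  under functionals \<open>f\<close>, so that products of words become operations on functions of
  lists (\<open>qsh\<close>, \<open>zig\<close>, \<open>star_sum\<close>) and the deconcatenation
  coproduct becomes the sum \<open>dec\<close>. The cut is an inclusion-exclusion: imposing a
  relation between two nodes and imposing the opposite one add up to imposing none, and without the
  relation the poset falls apart and the character factors. For harmonic products, the recursion at
  the last entry plays this role. What removes \<open>\<kappa>\<close> from Kawashima's relation is
  that the derivation evaluates a functional only at indices with a raised entry, where
  \<open>\<kappa>\<close> vanishes. It therefore acts on the other factor of the convolution alone,
  and \<open>\<kappa>\<close> meets its inverse.\<close>

definition ev :: "(letter list \<Rightarrow> real) \<Rightarrow> ncpoly \<Rightarrow> real" where
  "ev f x = (\<Sum>w\<in>Poly_Mapping.keys x. of_rat (Poly_Mapping.lookup x w) * f w)"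

lemma ev_superset:
  assumes "finite S" "Poly_Mapping.keys x \<subseteq> S"
  shows "ev f x = (\<Sum>w\<in>S. of_rat (Poly_Mapping.lookup x w) * f w)"
  unfolding ev_def using assms
  by (intro sum.mono_neutral_left) (auto simp: in_keys_iff)

lemma ev_zero [simp]: "ev f 0 = 0"
  by (simp add: ev_def)

lemma ev_add [simp]: "ev f (x + y) = ev f x + ev f y"
proof -
  let ?S = "Poly_Mapping.keys x \<union> Poly_Mapping.keys y"
  have "ev f (x + y) = (\<Sum>w\<in>?S. of_rat (Poly_Mapping.lookup (x + y) w) * f w)"
    by (rule ev_superset) (simp_all add: Poly_Mapping.keys_add)
  then show ?thesis
    by (simp add: ev_superset[of ?S] lookup_add of_rat_add distrib_right sum.distrib)
qed

lemma ev_uminus [simp]: "ev f (- x) = - ev f x"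
  by (simp add: ev_def of_rat_minus sum_negf)

lemma ev_diff [simp]: "ev f (x - y) = ev f x - ev f y"
  using ev_add[of f x "- y"] by simp

lemma ev_sum: "ev f (sum g A) = (\<Sum>i\<in>A. ev f (g i))"
  by (induction A rule: infinite_finite_induct) auto

lemma ev_sum_list: "ev f (sum_list xs) = (\<Sum>x\<leftarrow>xs. ev f x)"
  by (induction xs) auto

lemma ev_single: "ev f (Poly_Mapping.single w c) = of_rat c * f w"
  by (simp add: ev_def)

lemma ev_word [simp]: "ev f (word w) = f w"
  by (simp add: ev_single word_def)

lemma sum_single_keys: "x = (\<Sum>w\<in>Poly_Mapping.keys x. Poly_Mapping.single w (Poly_Mapping.lookup x w))"
  by (rule poly_mapping_eqI)
     (auto simp: lookup_sum lookup_single when_def in_keys_iff)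

lemma ev_mult_single:
  "ev f (Poly_Mapping.single u c * x) = of_rat c * ev (\<lambda>w. f (u @ w)) x"
proof -
  have "Poly_Mapping.single u c * x =
      (\<Sum>w\<in>Poly_Mapping.keys x. Poly_Mapping.single (u @ w) (c * Poly_Mapping.lookup x w))"
    by (subst (1) sum_single_keys[of x]) (simp add: sum_distrib_left mult_single plus_list_def)
  then show ?thesis
    by (simp add: ev_sum ev_single of_rat_mult sum_distrib_left ev_def[of _ x] mult.assoc)
qed

lemma ev_const_mult [simp]: "ev f (const c * x) = of_rat c * ev f x"
  by (simp add: const_def ev_mult_single)

lemma ev_word_mult [simp]: "ev f (word u * x) = ev (\<lambda>w. f (u @ w)) x"
  by (simp add: word_def ev_mult_single)

lemma ev_mult_word [simp]: "ev f (x * word u) = ev (\<lambda>w. f (w @ u)) x"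
proof -
  have "x * word u =
      (\<Sum>w\<in>Poly_Mapping.keys x. Poly_Mapping.single (w @ u) (Poly_Mapping.lookup x w))"
    unfolding word_def
    by (subst (1) sum_single_keys[of x]) (simp add: sum_distrib_right mult_single plus_list_def)
  then show ?thesis
    by (simp add: ev_sum ev_single ev_def[of _ x])
qed

lemma ev_fun_zero [simp]: "ev (\<lambda>w. 0) x = 0"
  by (simp add: ev_def)

lemma ev_fun_mult: "ev (\<lambda>w. c * f w) x = c * ev f x"
  by (simp add: ev_def sum_distrib_left mult.left_commute)

lemma ev_fun_mult_right: "ev (\<lambda>w. f w * c) x = ev f x * c"
  by (simp add: ev_def sum_distrib_right mult.assoc)

lemma ev_cong: "(\<And>w. w \<in> Poly_Mapping.keys x \<Longrightarrow> f w = g w) \<Longrightarrow> ev f x = ev g x"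
  by (simp add: ev_def)

lemma ev_linear_ext: "ev f (linear_ext h x) = ev (\<lambda>w. ev f (h w)) x"
  by (simp add: linear_ext_def ev_sum ev_def[of "\<lambda>w. ev f (h w)"])

lemma ev_bilinear_ext: "ev f (bilinear_ext h x y) = ev (\<lambda>v. ev (\<lambda>w. ev f (h v w)) y) x"
  by (simp add: bilinear_ext_def ev_sum of_rat_mult ev_def[of "\<lambda>w. ev f (h v w)" for v]
      ev_def[of "\<lambda>v. \<Sum>w\<in>Poly_Mapping.keys y. h' v w" for h'] sum_distrib_left mult.assoc)

lemma lookup_eq_ev: "of_rat (Poly_Mapping.lookup x w) = ev (\<lambda>v. if v = w then 1 else 0) x"
  by (simp add: ev_def in_keys_iff if_distrib[of "\<lambda>t. _ * t"] sum.delta cong: if_cong)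

text \<open>Indicator functions of single words detect the support. The criterion is used to prove
  membership in \<open>H0\<close> and \<open>H1\<close> for elements of which only the values under
  \<open>ev\<close> are computed.\<close>

lemma keys_subset_iff_ev:
  "Poly_Mapping.keys x \<subseteq> A \<longleftrightarrow> (\<forall>f. (\<forall>w\<in>A. f w = 0) \<longrightarrow> ev f x = 0)"
proof
  assume "Poly_Mapping.keys x \<subseteq> A"
  then show "\<forall>f. (\<forall>w\<in>A. f w = 0) \<longrightarrow> ev f x = 0"
    by (auto simp: ev_def intro!: sum.neutral)
next
  assume *: "\<forall>f. (\<forall>w\<in>A. f w = 0) \<longrightarrow> ev f x = 0"
  show "Poly_Mapping.keys x \<subseteq> A"
  proof
    fix w assume w: "w \<in> Poly_Mapping.keys x"
    show "w \<in> A"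
    proof (rule ccontr)
      assume "w \<notin> A"
      then have "ev (\<lambda>v. if v = w then 1 else 0) x = 0"
        by (intro *[rule_format]) auto
      then show False
        using w by (simp flip: lookup_eq_ev add: in_keys_iff)
    qed
  qed
qed

section \<open>Words spanning \<open>H0\<close> and \<open>H1\<close>\<close>

definition admissible_word :: "letter list \<Rightarrow> bool" where
  "admissible_word w \<longleftrightarrow> w = [] \<or> hd w = E1 \<and> last w = E0"

definition H1_word :: "letter list \<Rightarrow> bool" where
  "H1_word w \<longleftrightarrow> w = [] \<or> hd w = E1"

lemma H1_iff: "x \<in> H1 \<longleftrightarrow> Poly_Mapping.keys x \<subseteq> Collect H1_word"
proof
  assume "x \<in> H1"
  then obtain c h where "x = const c + word [E1] * h"
    by (auto simp: H1_def)
  then show "Poly_Mapping.keys x \<subseteq> Collect H1_word"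
    by (auto simp: keys_subset_iff_ev const_def ev_single H1_word_def)
next
  assume k: "Poly_Mapping.keys x \<subseteq> Collect H1_word"
  define h where "h = (\<Sum>w\<in>Poly_Mapping.keys x - {[]}. Poly_Mapping.single (tl w) (Poly_Mapping.lookup x w))"
  have s: "Poly_Mapping.single w r = word [E1] * Poly_Mapping.single (tl w) r"
    if "w \<in> Poly_Mapping.keys x - {[]}" for w r
    using that k by (cases w) (auto simp: word_def mult_single plus_list_def H1_word_def)
  have "x = (\<Sum>w\<in>Poly_Mapping.keys x \<union> {[]}. Poly_Mapping.single w (Poly_Mapping.lookup x w))"
    by (subst sum_single_keys) (intro sum.mono_neutral_left, auto simp: in_keys_iff)
  also have "\<dots> = const (Poly_Mapping.lookup x []) + word [E1] * h"
    by (subst sum.remove[of _ "[]"]) (auto simp: const_def h_def sum_distrib_left s intro!: sum.cong)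
  finally show "x \<in> H1"
    by (auto simp: H1_def)
qed

lemma H0_iff: "x \<in> H0 \<longleftrightarrow> Poly_Mapping.keys x \<subseteq> Collect admissible_word"
proof
  assume "x \<in> H0"
  then obtain c h where "x = const c + word [E1] * h * word [E0]"
    by (auto simp: H0_def)
  then show "Poly_Mapping.keys x \<subseteq> Collect admissible_word"
    by (auto simp: keys_subset_iff_ev const_def ev_single admissible_word_def mult.assoc)
next
  assume k: "Poly_Mapping.keys x \<subseteq> Collect admissible_word"
  define h where "h = (\<Sum>w\<in>Poly_Mapping.keys x - {[]}.
    Poly_Mapping.single (butlast (tl w)) (Poly_Mapping.lookup x w))"
  have s: "Poly_Mapping.single w r = word [E1] * Poly_Mapping.single (butlast (tl w)) r * word [E0]"
    if "w \<in> Poly_Mapping.keys x - {[]}" for w r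
  proof -
    have "admissible_word w" "w \<noteq> []"
      using that k by auto
    then have "w = [E1] @ butlast (tl w) @ [E0]"
      by (cases w; cases "tl w" rule: rev_cases) (auto simp: admissible_word_def)
    then show ?thesis
      by (simp add: word_def mult_single plus_list_def)
  qed
  have "x = (\<Sum>w\<in>Poly_Mapping.keys x \<union> {[]}. Poly_Mapping.single w (Poly_Mapping.lookup x w))"
    by (subst sum_single_keys) (intro sum.mono_neutral_left, auto simp: in_keys_iff)
  also have "\<dots> = const (Poly_Mapping.lookup x []) + word [E1] * h * word [E0]"
    by (subst sum.remove[of _ "[]"])
       (auto simp: const_def h_def sum_distrib_left sum_distrib_right s intro!: sum.cong)
  finally show "x \<in> H0"
    by (auto simp: H0_def)
qed

lemma word_in_H0 [simp]: "word w \<in> H0 \<longleftrightarrow> admissible_word w"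
  by (simp add: H0_iff word_def)

lemma word_in_H1 [simp]: "word w \<in> H1 \<longleftrightarrow> H1_word w"
  by (simp add: H1_iff word_def)

section \<open>Deconcatenation and quasi-shuffles of functionals\<close>

text \<open>The deconcatenation coproduct of \<open>w\<close>, paired with \<open>H\<close>;
  \<open>dec_eq_sum\<close> gives the explicit sum over cut positions. The recursion moves the
  removed letters into the functional, so that inductions on \<open>w\<close> generalize over
  \<open>H\<close>.\<close>

fun dec :: "('a list \<Rightarrow> 'a list \<Rightarrow> 'r::comm_ring_1) \<Rightarrow> 'a list \<Rightarrow> 'r" where
  "dec H [] = H [] []"
| "dec H (a # w) = H [] (a # w) + dec (\<lambda>x y. H (a # x) y) w"

lemma dec_cong: "(\<And>x y. w = x @ y \<Longrightarrow> H x y = H' x y) \<Longrightarrow> dec H w = dec H' w"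
proof (induction w arbitrary: H H')
  case (Cons a w)
  have "dec (\<lambda>x y. H (a # x) y) w = dec (\<lambda>x y. H' (a # x) y) w"
    by (rule Cons.IH) (rule Cons.prems, simp)
  moreover have "H [] (a # w) = H' [] (a # w)"
    by (rule Cons.prems) simp
  ultimately show ?case
    by simp
qed simp

lemma dec_add: "dec (\<lambda>x y. H x y + H' x y) w = dec H w + dec H' w"
  by (induction w arbitrary: H H') (auto simp: algebra_simps)

lemma dec_mult: "dec (\<lambda>x y. c * H x y) w = c * dec H w"
  by (induction w arbitrary: H) (auto simp: algebra_simps)

lemma dec_mult_right: "dec (\<lambda>x y. H x y * c) w = dec H w * c"
  by (induction w arbitrary: H) (auto simp: algebra_simps)

lemma dec_zero [simp]: "dec (\<lambda>x y. 0) w = 0"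
  by (induction w) auto

lemma dec_minus: "dec (\<lambda>x y. - H x y) w = - dec H w"
  by (induction w arbitrary: H) auto

lemma dec_swap:
  "dec (\<lambda>x y. dec (\<lambda>x' y'. H x y x' y') v) w = dec (\<lambda>x' y'. dec (\<lambda>x y. H x y x' y') w) v"
  by (induction w arbitrary: H) (auto simp: dec_add)

text \<open>Coassociativity: both sides sum over the ways to cut \<open>w\<close> into three
  pieces.\<close>

lemma dec_assoc:
  "dec (\<lambda>x y. dec (\<lambda>x1 x2. H x1 x2 y) x) w = dec (\<lambda>x y. dec (\<lambda>y1 y2. H x y1 y2) y) w"
  by (induction w arbitrary: H) (auto simp: dec_add)

lemma dec_append_Cons:
  "dec H (p @ y # s) = dec (\<lambda>p1 p2. H p1 (p2 @ y # s)) p + dec (\<lambda>s1 s2. H (p @ y # s1) s2) s"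
  by (induction p arbitrary: H) auto

lemma dec_snoc: "dec H (w @ [a]) = dec (\<lambda>x y. H x (y @ [a])) w + H (w @ [a]) []"
  by (induction w arbitrary: H) auto

lemma dec_rev: "dec H (rev w) = dec (\<lambda>x y. H (rev y) (rev x)) w"
  by (induction w arbitrary: H) (auto simp: dec_snoc)

lemma dec_map: "dec H (map h w) = dec (\<lambda>x y. H (map h x) (map h y)) w"
  by (induction w arbitrary: H) auto

abbreviation conv ::
    "('a list \<Rightarrow> 'r::comm_ring_1) \<Rightarrow> ('a list \<Rightarrow> 'r) \<Rightarrow> 'a list \<Rightarrow> 'r" where
  "conv f h w \<equiv> dec (\<lambda>x y. f x * h y) w"

lemma conv_assoc: "conv (conv f g) h w = conv f (conv g h) w"
proof -
  have "conv (conv f g) h w = dec (\<lambda>x y. dec (\<lambda>x1 x2. f x1 * g x2 * h y) x) w"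
    by (simp only: dec_mult_right)
  also have "\<dots> = dec (\<lambda>x y. dec (\<lambda>y1 y2. f x * (g y1 * h y2)) y) w"
    by (simp only: dec_assoc mult.assoc)
  finally show ?thesis
    by (simp only: dec_mult)
qed

text \<open>The summand with empty first part is \<open>g w\<close> itself and all others involve
  \<open>g\<close> at proper suffixes, so induction on the length applies. Working relative to a
  suffix-closed \<open>P\<close> permits the use on the indices (1, ..., 1) alone.\<close>

lemma conv_left_cancel:
  assumes suffix: "\<And>x y. P (x @ y) \<Longrightarrow> P y"
    and unit: "f [] = 1"
    and eq: "\<And>w. P w \<Longrightarrow> conv f g w = conv f h w"
    and "P w"
  shows "g w = h w"
  using \<open>P w\<close>
proof (induction w rule: length_induct)
  case (1 w)
  show ?case
  proof (cases w)
    case Nil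
    then show ?thesis using eq[OF 1(2)] unit by simp
  next
    case (Cons a v)
    have "conv (\<lambda>x. f (a # x)) g v = conv (\<lambda>x. f (a # x)) h v"
    proof (rule dec_cong)
      fix x y assume v: "v = x @ y"
      have "P y"
        using suffix[of "a # x" y] 1(2) v Cons by simp
      then show "f (a # x) * g y = f (a # x) * h y"
        using 1(1) v Cons by simp
    qed
    then show ?thesis
      using eq[OF 1(2)] unit Cons by simp
  qed
qed

lemma conv_right_cancel:
  assumes prefix: "\<And>x y. P (x @ y) \<Longrightarrow> P x"
    and unit: "f [] = 1"
    and eq: "\<And>w. P w \<Longrightarrow> conv g f w = conv h f w"
    and "P w"
  shows "g w = h w"
proof -
  have rv: "conv (\<lambda>x. f (rev x)) (\<lambda>x. k (rev x)) w = conv k f (rev w)" for k and w :: "'a list"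
    by (simp add: dec_rev mult.commute)
  have "g (rev (rev w)) = h (rev (rev w))"
  proof (rule conv_left_cancel[of "\<lambda>w. P (rev w)" "\<lambda>x. f (rev x)" "\<lambda>x. g (rev x)" "\<lambda>x. h (rev x)"])
    show "conv (\<lambda>x. f (rev x)) (\<lambda>x. g (rev x)) w = conv (\<lambda>x. f (rev x)) (\<lambda>x. h (rev x)) w"
      if "P (rev w)" for w
      unfolding rv by (rule eq[OF that])
  qed (use prefix unit \<open>P w\<close> in auto)
  then show ?thesis by simp
qed

text \<open>The functional \<open>f\<close> evaluated on the quasi-shuffle of two words: the parameter \<open>c\<close> is the
  coefficient of the merged terms, whose letters are combined by \<open>g\<close>.\<close>

fun qsh :: "'r::comm_ring_1 \<Rightarrow> ('a \<Rightarrow> 'a \<Rightarrow> 'a) \<Rightarrow> ('a list \<Rightarrow> 'r) \<Rightarrow> 'a list \<Rightarrow> 'a list \<Rightarrow> 'r" where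
  "qsh c g f [] v = f v"
| "qsh c g f (a # u) [] = f (a # u)"
| "qsh c g f (a # u) (b # v) =
     qsh c g (\<lambda>x. f (a # x)) u (b # v) + qsh c g (\<lambda>x. f (b # x)) (a # u) v
     + c * qsh c g (\<lambda>x. f (g a b # x)) u v"

lemma qsh_Nil2 [simp]: "qsh c g f u [] = f u"
  by (cases u) auto

lemma qsh_Nil_eq [simp]: "qsh c g f [] = f"
  by (rule ext) simp

lemma qsh_add: "qsh c g (\<lambda>x. f x + h x) u v = qsh c g f u v + qsh c g h u v"
proof (induction c g f u v arbitrary: h rule: qsh.induct)
  case (3 c g f a u b v)
  show ?case
    by (simp only: qsh.simps 3) (simp add: algebra_simps)
qed auto

lemma qsh_mult: "qsh c g (\<lambda>x. k * f x) u v = k * qsh c g f u v"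
  by (induction c g f u v rule: qsh.induct) (auto simp: algebra_simps)

lemma qsh_mult_right: "qsh c g (\<lambda>x. f x * k) u v = qsh c g f u v * k"
  using qsh_mult[of c g k f u v] by (simp add: mult.commute)

lemma qsh_zero [simp]: "qsh c g (\<lambda>x. 0) u v = 0"
  using qsh_mult[of c g 0 "\<lambda>x. 0" u v] by simp

lemma qsh_minus: "qsh c g (\<lambda>x. - f x) u v = - qsh c g f u v"
  using qsh_mult[of c g "- 1" f u v] by simp

lemma qsh_dec:
  "qsh c g (\<lambda>x. dec (\<lambda>y z. F x y z) w) u v = dec (\<lambda>y z. qsh c g (\<lambda>x. F x y z) u v) w"
  by (induction w arbitrary: F) (auto simp: qsh_add)

text \<open>Contains every word at which \<open>qsh c g f u v\<close> evaluates \<open>f\<close>.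
  For \<open>c = 0\<close> the merged words are left out, since their coefficient vanishes.\<close>

fun qsh_words :: "'r::comm_ring_1 \<Rightarrow> ('a \<Rightarrow> 'a \<Rightarrow> 'a) \<Rightarrow> 'a list \<Rightarrow> 'a list \<Rightarrow> 'a list set" where
  "qsh_words c g [] v = {v}"
| "qsh_words c g (a # u) [] = {a # u}"
| "qsh_words c g (a # u) (b # v) =
     (#) a ` qsh_words c g u (b # v) \<union> (#) b ` qsh_words c g (a # u) v \<union> (if c = 0 then {} else (#) (g a b) ` qsh_words c g u v)"

lemma qsh_cong:
  "(\<And>x. x \<in> qsh_words c g u v \<Longrightarrow> f x = h x) \<Longrightarrow> qsh c g f u v = qsh c g h u v"
proof (induction c g f u v arbitrary: h rule: qsh.induct)
  case (3 c g f a u b v)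
  show ?case
    using 3(1)[of "\<lambda>x. h (a # x)"] 3(2)[of "\<lambda>x. h (b # x)"] 3(3)[of "\<lambda>x. h (g a b # x)"] 3(4)
    by (cases "c = 0") simp_all
qed auto

lemma qsh_words_nonempty: "x \<in> qsh_words c g u v \<Longrightarrow> x = [] \<longleftrightarrow> u = [] \<and> v = []"
  by (induction c g u v arbitrary: x rule: qsh_words.induct) (auto split: if_splits)

lemma qsh_commute:
  assumes "\<And>a b. g a b = g b a"
  shows "qsh c g f u v = qsh c g f v u"
  using assms
proof (induction c g f u v rule: qsh.induct)
  case (3 c g f a u b v)
  have "qsh c g (\<lambda>x. f (g a b # x)) u v = qsh c g (\<lambda>x. f (g b a # x)) v u"
    using 3(3,4) by simp
  then show ?case
    using 3(1,2,4) by simp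
qed auto

lemma qsh_assoc:
  assumes g: "\<And>a b d. g (g a b) d = g a (g b d)"
  shows "qsh c g (\<lambda>x. qsh c g f x w) u v = qsh c g (\<lambda>x. qsh c g f u x) v w"
proof (induction "length u + length v + length w" arbitrary: u v w f rule: less_induct)
  case less
  show ?case
  proof (cases u)
    case Nil
    then show ?thesis by simp
  next
    case u: (Cons a u')
    show ?thesis
    proof (cases v)
      case Nil
      then show ?thesis by (simp add: u)
    next
      case v: (Cons b v')
      show ?thesis
      proof (cases w)
        case Nil
        then show ?thesis by simp
      next
        case w: (Cons d w')
        have IH: "qsh c g (\<lambda>x. qsh c g f x w2) u2 v2 = qsh c g (\<lambda>x. qsh c g f u2 x) v2 w2"
          if "length u2 + length v2 + length w2 < length u + length v + length w" for u2 v2 w2 f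
          using less that by blast
        \<comment> \<open>The facts 1 to 7 belong to the non-empty subsets of the first letters
          \<open>a\<close>, \<open>b\<close>, \<open>d\<close>: the letters of the subset are merged
          into the first letter of the result.\<close>
        have 1: "qsh c g (\<lambda>x. qsh c g (\<lambda>y. f (a # y)) x w) u' v
            = qsh c g (\<lambda>x. qsh c g (\<lambda>y. f (a # y)) u' x) v w"
          by (rule IH) (simp add: u)
        have 2: "qsh c g (\<lambda>x. qsh c g (\<lambda>y. f (b # y)) x w) u v'
            = qsh c g (\<lambda>x. qsh c g (\<lambda>y. f (b # y)) u x) v' w"
          by (rule IH) (simp add: v)
        have 3: "qsh c g (\<lambda>x. qsh c g (\<lambda>y. f (g a b # y)) x w) u' v'
            = qsh c g (\<lambda>x. qsh c g (\<lambda>y. f (g a b # y)) u' x) v' w"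
          by (rule IH) (simp add: u v)
        have 4: "qsh c g (\<lambda>x. qsh c g (\<lambda>y. f (d # y)) x w') u v
            = qsh c g (\<lambda>x. qsh c g (\<lambda>y. f (d # y)) u x) v w'"
          by (rule IH) (simp add: w)
        have 5: "qsh c g (\<lambda>x. qsh c g (\<lambda>y. f (g a d # y)) x w') u' v
            = qsh c g (\<lambda>x. qsh c g (\<lambda>y. f (g a d # y)) u' x) v w'"
          by (rule IH) (simp add: u w)
        have 6: "qsh c g (\<lambda>x. qsh c g (\<lambda>y. f (g b d # y)) x w') u v'
            = qsh c g (\<lambda>x. qsh c g (\<lambda>y. f (g b d # y)) u x) v' w'"
          by (rule IH) (simp add: v w)
        have 7: "qsh c g (\<lambda>x. qsh c g (\<lambda>y. f (g a (g b d) # y)) x w') u' v'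
            = qsh c g (\<lambda>x. qsh c g (\<lambda>y. f (g a (g b d) # y)) u' x) v' w'"
          by (rule IH) (simp add: u v w)
        show ?thesis
          using 1 2 3 4 5 6 7
          by (simp add: u v w g qsh_add qsh_mult algebra_simps)
      qed
    qed
  qed
qed

lemma qsh_singleton_snoc:
  "qsh c g f [a] (v @ [b]) = f (v @ [b, a]) + qsh c g (\<lambda>x. f (x @ [b])) [a] v + c * f (v @ [g a b])"
  by (induction v arbitrary: f) (auto simp: algebra_simps)

lemma qsh_snoc_singleton:
  "qsh c g f (u @ [a]) [b] = qsh c g (\<lambda>x. f (x @ [a])) u [b] + f (u @ [a, b]) + c * f (u @ [g a b])"
  by (induction u arbitrary: f) (auto simp: algebra_simps)

text \<open>The recursion at the last letters instead of the first ones. Invariance under reversal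
  (\<open>qsh_rev\<close>) and the harmonic cut \<open>circ_star_Cons\<close> rest on it.\<close>

lemma qsh_snoc_snoc:
  "qsh c g f (u @ [a]) (v @ [b]) =
    qsh c g (\<lambda>x. f (x @ [a])) u (v @ [b]) + qsh c g (\<lambda>x. f (x @ [b])) (u @ [a]) v
    + c * qsh c g (\<lambda>x. f (x @ [g a b])) u v"
proof (induction c g f u v rule: qsh.induct)
  case (1 c g f v)
  then show ?case by (simp add: qsh_singleton_snoc)
next
  case (2 c g f a u)
  then show ?case using qsh_snoc_singleton[of c g f "a # u"] by simp
next
  case (3 c g f a u b v)
  then show ?case by (simp add: algebra_simps)
qed

lemma qsh_rev: "qsh c g (\<lambda>x. f (rev x)) u v = qsh c g f (rev u) (rev v)"
proof (induction "length u + length v" arbitrary: u v f rule: less_induct)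
  case less
  show ?case
  proof (cases "u = [] \<or> v = []")
    case True
    then show ?thesis by auto
  next
    case False
    then obtain a u' b v' where uv: "u = a # u'" "v = b # v'"
      by (meson list.exhaust)
    have IH: "qsh c g (\<lambda>x. f (rev x)) u2 v2 = qsh c g f (rev u2) (rev v2)"
      if "length u2 + length v2 < length u + length v" for f u2 v2
      using less that by blast
    have "qsh c g (\<lambda>x. f (rev x @ [a])) u' v = qsh c g (\<lambda>x. f (x @ [a])) (rev u') (rev v)"
      "qsh c g (\<lambda>x. f (rev x @ [b])) u v' = qsh c g (\<lambda>x. f (x @ [b])) (rev u) (rev v')"
      "qsh c g (\<lambda>x. f (rev x @ [g a b])) u' v' = qsh c g (\<lambda>x. f (x @ [g a b])) (rev u') (rev v')"
      using IH[of u' v "\<lambda>x. f (x @ [a])"] IH[of u v' "\<lambda>x. f (x @ [b])"]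
        IH[of u' v' "\<lambda>x. f (x @ [g a b])"]
      by (simp_all add: uv)
    then show ?thesis
      by (simp add: uv qsh_snoc_snoc)
  qed
qed

text \<open>Deconcatenation is multiplicative: cutting a product amounts to cutting both factors and
  multiplying the left parts and the right parts separately. Through \<open>qsh_conv\<close> this
  makes a convolution of characters a character.\<close>

lemma qsh_of_dec:
  "qsh c g (dec H) u v =
   dec (\<lambda>u1 u2. dec (\<lambda>v1 v2. qsh c g (\<lambda>x. qsh c g (\<lambda>y. H x y) u2 v2) u1 v1) v) u"
proof (induction "length u + length v" arbitrary: u v H rule: less_induct)
  case less
  show ?case
  proof (cases u)
    case Nil
    then show ?thesis by simp
  next
    case u: (Cons a u')
    show ?thesis
    proof (cases v)
      case Nil
      then show ?thesis by (simp add: u)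
    next
      case v: (Cons b v')
      have IH: "qsh c g (dec H) u2 v2 =
          dec (\<lambda>u1 u2. dec (\<lambda>v1 v2. qsh c g (\<lambda>x. qsh c g (\<lambda>y. H x y) u2 v2) u1 v1) v2) u2"
        if "length u2 + length v2 < length u + length v" for H u2 v2
        using less that by blast
      have 1: "qsh c g (dec (\<lambda>x y. H (a # x) y)) u' v = dec (\<lambda>u1 u2. dec (\<lambda>v1 v2.
          qsh c g (\<lambda>x. qsh c g (\<lambda>y. H (a # x) y) u2 v2) u1 v1) v) u'"
        by (rule IH) (simp add: u)
      have 2: "qsh c g (dec (\<lambda>x y. H (b # x) y)) u v' = dec (\<lambda>u1 u2. dec (\<lambda>v1 v2.
          qsh c g (\<lambda>x. qsh c g (\<lambda>y. H (b # x) y) u2 v2) u1 v1) v') u"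
        by (rule IH) (simp add: v)
      have 3: "qsh c g (dec (\<lambda>x y. H (g a b # x) y)) u' v' = dec (\<lambda>u1 u2. dec (\<lambda>v1 v2.
          qsh c g (\<lambda>x. qsh c g (\<lambda>y. H (g a b # x) y) u2 v2) u1 v1) v') u'"
        by (rule IH) (simp add: u v)
      show ?thesis
        using 1 2 3
        by (simp add: u v qsh_add dec_add dec_mult algebra_simps)
    qed
  qed
qed

lemma qsh_conv:
  "qsh c g (conv f h) u v = dec (\<lambda>u1 u2. dec (\<lambda>v1 v2. qsh c g f u1 v1 * qsh c g h u2 v2) v) u"
  by (subst qsh_of_dec) (simp add: qsh_mult qsh_mult_right)

text \<open>In a shuffle with \<open>p @ x # s\<close>, the letter \<open>x\<close> cuts the other word into two parts.\<close>

lemma shuffle_split: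
  "qsh 0 g f u (p @ x # s) =
   dec (\<lambda>u1 u2. qsh 0 g (\<lambda>p'. qsh 0 g (\<lambda>s'. f (p' @ x # s')) u2 s) u1 p) u"
proof (induction "length u + length p" arbitrary: u p f rule: less_induct)
  case less
  show ?case
  proof (cases u)
    case Nil
    then show ?thesis by simp
  next
    case u: (Cons a u')
    have 1: "qsh 0 g (\<lambda>x. f (a # x)) u' (p @ x # s) =
       dec (\<lambda>u1 u2. qsh 0 g (\<lambda>p'. qsh 0 g (\<lambda>s'. f (a # p' @ x # s')) u2 s) u1 p) u'"
      by (rule less) (simp add: u)
    show ?thesis
    proof (cases p)
      case Nil
      then show ?thesis using 1 by (simp add: u)
    next
      case p: (Cons b p')
      have 2: "qsh 0 g (\<lambda>x. f (b # x)) u (p' @ x # s) =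
         dec (\<lambda>u1 u2. qsh 0 g (\<lambda>p'. qsh 0 g (\<lambda>s'. f (b # p' @ x # s')) u2 s) u1 p') u"
        by (rule less) (simp add: p)
      show ?thesis
        using 1 2 by (simp add: u p dec_add algebra_simps)
    qed
  qed
qed

section \<open>Linear extensions of zigzags\<close>

text \<open>
  A state \<open>p @ x # s\<close> is a linear extension of an initial segment of a zigzag whose last node is
  \<open>x\<close>. A step \<open>E0\<close> goes up to a node labelled \<open>E0\<close>, which is inserted after \<open>x\<close>;
  a step \<open>E1\<close> goes down to a node labelled \<open>E1\<close>, inserted before \<open>x\<close>.
\<close>

fun zig :: "(letter list \<Rightarrow> 'r::comm_ring_1) \<Rightarrow> letter list \<Rightarrow> letter \<Rightarrow> letter list \<Rightarrow> letter list \<Rightarrow> 'r"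
  where
  "zig f p x s [] = f (p @ x # s)"
| "zig f p x s (E0 # w) = dec (\<lambda>s1 s2. zig f (p @ x # s1) E0 s2 w) s"
| "zig f p x s (E1 # w) = dec (\<lambda>p1 p2. zig f p1 E1 (p2 @ x # s) w) p"

text \<open>\<open>P\<close> is an invariant of the states: the two middle assumptions say that it
  survives the insertion of a node by either kind of step. It will be "begins with
  \<open>E1\<close>", possibly joined with "ends with \<open>E0\<close>".\<close>

lemma zig_cong:
  assumes "P (p @ x # s)"
    and "\<And>p x s1 s2. P (p @ x # s1 @ s2) \<Longrightarrow> P (p @ x # s1 @ E0 # s2)"
    and "\<And>p1 p2 x s. P (p1 @ p2 @ x # s) \<Longrightarrow> P (p1 @ E1 # p2 @ x # s)"
    and "\<And>v. P v \<Longrightarrow> f v = h v"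
  shows "zig f p x s w = zig h p x s w"
  using assms(1)
proof (induction w arbitrary: p x s)
  case Nil
  then show ?case using assms(4) by simp
next
  case (Cons a w)
  show ?case
  proof (cases a)
    case E0
    have "zig f (p @ x # s1) E0 s2 w = zig h (p @ x # s1) E0 s2 w" if "s = s1 @ s2" for s1 s2
      using Cons.IH[of "p @ x # s1" E0 s2] assms(2)[of p x s1 s2] Cons.prems that by simp
    then show ?thesis
      by (auto simp: E0 intro: dec_cong)
  next
    case E1
    have "zig f p1 E1 (p2 @ x # s) w = zig h p1 E1 (p2 @ x # s) w" if "p = p1 @ p2" for p1 p2
      using Cons.IH[of p1 E1 "p2 @ x # s"] assms(3)[of p1 p2 x s] Cons.prems that by simp
    then show ?thesis
      by (auto simp: E1 intro: dec_cong)
  qed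
qed

lemma zig_add: "zig (\<lambda>v. f v + h v) p x s w = zig f p x s w + zig h p x s w"
  by (induction f p x s w rule: zig.induct) (auto simp: dec_add)

lemma zig_mult: "zig (\<lambda>v. c * f v) p x s w = c * zig f p x s w"
  by (induction f p x s w rule: zig.induct) (auto simp: dec_mult)

lemma zig_dec: "zig (\<lambda>v. dec (\<lambda>y z. F v y z) u) p x s w = dec (\<lambda>y z. zig (\<lambda>v. F v y z) p x s w) u"
  by (induction u arbitrary: F) (auto simp: zig_add)

lemma zig_qsh: "zig (\<lambda>v. qsh c g (\<lambda>y. F v y) u1 u2) p x s w = qsh c g (\<lambda>y. zig (\<lambda>v. F v y) p x s w) u1 u2"
proof (induction c g "\<lambda>y::'b list. zig (\<lambda>v. F v y) p x s w" u1 u2 arbitrary: F rule: qsh.induct)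
  case (3 c g a u b v)
  show ?case
    using 3(1)[of "\<lambda>v y. F v (a # y)"] 3(2)[of "\<lambda>v y. F v (b # y)"] 3(3)[of "\<lambda>v y. F v (g a b # y)"]
    by (simp add: zig_add zig_mult)
qed auto

abbreviation dagger_word :: "letter list \<Rightarrow> letter list" where
  "dagger_word w \<equiv> rev (map swap_letter w)"

lemma swap_letter_swap [simp]: "swap_letter (swap_letter a) = a"
  by (cases a) auto

text \<open>Reversing the order turns up steps into down steps, and exchanging the labels restores
  the convention that up steps lead to \<open>E0\<close> and down steps to
  \<open>E1\<close>.\<close>

lemma zig_dagger:
  "zig f (dagger_word s) (swap_letter x) (dagger_word p) (map swap_letter w)
   = zig (\<lambda>v. f (dagger_word v)) p x s w"
proof (induction w arbitrary: p x s)
  case Nil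
  then show ?case by simp
next
  case (Cons a w)
  show ?case
  proof (cases a)
    case E0
    have "zig (\<lambda>v. f (dagger_word v)) (p @ x # s1) E0 s2 w =
        zig f (dagger_word s2) E1 (dagger_word s1 @ swap_letter x # dagger_word p) (map swap_letter w)" for s1 s2
      using Cons.IH[of s2 E0 "p @ x # s1"] by simp
    then show ?thesis
      by (simp add: E0 dec_rev dec_map)
  next
    case E1
    have "zig (\<lambda>v. f (dagger_word v)) p1 E1 (p2 @ x # s) w =
        zig f (dagger_word s @ swap_letter x # dagger_word p2) E0 (dagger_word p1) (map swap_letter w)" for p1 p2
      using Cons.IH[of "p2 @ x # s" E1 p1] by simp
    then show ?thesis
      by (simp add: E1 dec_rev dec_map)
  qed
qed

text \<open>Taking a linear extension of the disjoint union of a chain \<open>u\<close> and a zigzag.\<close>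

lemma zig_shuffle:
  "zig (\<lambda>v. qsh 0 g f u v) p x s w =
   dec (\<lambda>u1 u2. qsh 0 g (\<lambda>p'. qsh 0 g (\<lambda>s'. zig f p' x s' w) u2 s) u1 p) u"
proof (induction w arbitrary: p x s)
  case Nil
  then show ?case by (simp add: shuffle_split)
next
  case (Cons a w)
  show ?case
  proof (cases a)
    case E0
    have "zig (\<lambda>v. qsh 0 g f u v) p x s (a # w) = dec (\<lambda>s1 s2. dec (\<lambda>u1 u2.
        qsh 0 g (\<lambda>p'. qsh 0 g (\<lambda>s'. zig f p' E0 s' w) u2 s2) u1 (p @ x # s1)) u) s"
      by (simp add: E0 Cons.IH)
    \<comment> \<open>The chain is now cut twice, by the new node and by \<open>x\<close>.
      Coassociativity makes the cut at \<open>x\<close> the outer one, and the sums are then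
      reordered.\<close>
    also have "\<dots> = dec (\<lambda>s1 s2. dec (\<lambda>u1 u2. dec (\<lambda>u11 u12. qsh 0 g (\<lambda>p'. qsh 0 g (\<lambda>s'.
        qsh 0 g (\<lambda>s''. zig f (p' @ x # s') E0 s'' w) u2 s2) u12 s1) u11 p) u1) u) s"
      by (simp only: shuffle_split)
    also have "\<dots> = dec (\<lambda>s1 s2. dec (\<lambda>u1 u2. dec (\<lambda>u21 u22. qsh 0 g (\<lambda>p'. qsh 0 g (\<lambda>s'.
        qsh 0 g (\<lambda>s''. zig f (p' @ x # s') E0 s'' w) u22 s2) u21 s1) u1 p) u2) u) s"
      by (simp only: dec_assoc)
    also have "\<dots> = dec (\<lambda>u1 u2. dec (\<lambda>s1 s2. dec (\<lambda>u21 u22. qsh 0 g (\<lambda>p'. qsh 0 g (\<lambda>s'.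
        qsh 0 g (\<lambda>s''. zig f (p' @ x # s') E0 s'' w) u22 s2) u21 s1) u1 p) u2) s) u"
      by (rule dec_swap)
    also have "\<dots> = dec (\<lambda>u1 u2. dec (\<lambda>u21 u22. dec (\<lambda>s1 s2. qsh 0 g (\<lambda>p'. qsh 0 g (\<lambda>s'.
        qsh 0 g (\<lambda>s''. zig f (p' @ x # s') E0 s'' w) u22 s2) u21 s1) u1 p) s) u2) u"
      by (subst dec_swap) (rule refl)
    finally show ?thesis
      by (simp add: E0 qsh_of_dec qsh_dec)
  next
    case E1
    have "zig (\<lambda>v. qsh 0 g f u v) p x s (a # w) = dec (\<lambda>p1 p2. dec (\<lambda>u1 u2.
        qsh 0 g (\<lambda>p'. qsh 0 g (\<lambda>s'. zig f p' E1 s' w) u2 (p2 @ x # s)) u1 p1) u) p"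
      by (simp add: E1 Cons.IH)
    also have "\<dots> = dec (\<lambda>p1 p2. dec (\<lambda>u1 u2. dec (\<lambda>u21 u22. qsh 0 g (\<lambda>p'. qsh 0 g (\<lambda>p''.
        qsh 0 g (\<lambda>s'. zig f p' E1 (p'' @ x # s') w) u22 s) u21 p2) u1 p1) u2) u) p"
      by (simp only: shuffle_split qsh_dec)
    also have "\<dots> = dec (\<lambda>p1 p2. dec (\<lambda>u1 u2. dec (\<lambda>u11 u12. qsh 0 g (\<lambda>p'. qsh 0 g (\<lambda>p''.
        qsh 0 g (\<lambda>s'. zig f p' E1 (p'' @ x # s') w) u2 s) u12 p2) u11 p1) u1) u) p"
      by (simp only: dec_assoc)
    also have "\<dots> = dec (\<lambda>u1 u2. dec (\<lambda>p1 p2. dec (\<lambda>u11 u12. qsh 0 g (\<lambda>p'. qsh 0 g (\<lambda>p''.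
        qsh 0 g (\<lambda>s'. zig f p' E1 (p'' @ x # s') w) u2 s) u12 p2) u11 p1) u1) p) u"
      by (rule dec_swap)
    also have "\<dots> = dec (\<lambda>u1 u2. dec (\<lambda>u11 u12. dec (\<lambda>p1 p2. qsh 0 g (\<lambda>p'. qsh 0 g (\<lambda>p''.
        qsh 0 g (\<lambda>s'. zig f p' E1 (p'' @ x # s') w) u2 s) u12 p2) u11 p1) p) u1) u"
      by (subst dec_swap) (rule refl)
    finally show ?thesis
      by (simp add: E1 qsh_of_dec qsh_dec)
  qed
qed

text \<open>The node \<open>x\<close> takes an arbitrary place in the chain \<open>u\<close>, hence
  is unrelated to it: this is the disjoint union of \<open>u\<close> with the zigzag that starts at
  \<open>x\<close>.\<close>

lemma zig_insert: "dec (\<lambda>u1 u2. zig f u1 x u2 w) u = zig (\<lambda>v. qsh 0 g f u v) [] x [] w"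
  by (simp add: zig_shuffle)


text \<open>The merging function is a placeholder, as merged words have coefficient 0. The value
  \<open>E0\<close> serves where merging must not create the letter \<open>E1\<close>.\<close>

abbreviation sh :: "(letter list \<Rightarrow> 'r::comm_ring_1) \<Rightarrow> letter list \<Rightarrow> letter list \<Rightarrow> 'r" where
  "sh \<equiv> qsh 0 (\<lambda>_ _. E0)"

lemma sh_commute: "sh f u v = sh f v u"
  by (rule qsh_commute) simp

lemma sh_assoc: "sh (\<lambda>x. sh f x w) u v = sh (\<lambda>x. sh f u x) v w"
  by (rule qsh_assoc) simp

section \<open>Cutting zigzags at their downward steps\<close>

lemma sh_snoc: "sh f (t @ [y]) d = dec (\<lambda>d1 d2. sh (\<lambda>t'. f (t' @ y # d2)) t d1) d"
proof -
  have "sh f (t @ [y]) d = sh f d (t @ y # [])"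
    by (rule sh_commute)
  also have "\<dots> = dec (\<lambda>d1 d2. sh (\<lambda>t'. f (t' @ y # d2)) d1 t) d"
    by (simp add: shuffle_split)
  finally show ?thesis
    by (simp add: sh_commute[of _ t])
qed

text \<open>The zigzag \<open>w\<close> starts at the top of the chain \<open>E1 # t\<close>; the elements of the chain \<open>d\<close> lie
  above the bottom element of \<open>E1 # t\<close>.\<close>

definition sided_zig :: "(letter list \<Rightarrow> 'r::comm_ring_1) \<Rightarrow> letter list \<Rightarrow> letter list \<Rightarrow> letter list \<Rightarrow> 'r"
  where
  "sided_zig f t d w = (if t = [] then zig f [] E1 d w
     else dec (\<lambda>d1 d2. sh (\<lambda>t'. zig f (E1 # t') (last t) d2 w) (butlast t) d1) d)"

lemma sided_zig_snoc:
  "sided_zig f (t @ [y]) d w = dec (\<lambda>d1 d2. sh (\<lambda>t'. zig f (E1 # t') y d2 w) t d1) d"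
  by (simp add: sided_zig_def)

lemma sided_zig_Nil: "sided_zig f t d [] = sh (\<lambda>t'. f (E1 # t')) t d"
  by (cases t rule: rev_cases) (simp_all add: sided_zig_def sh_snoc)

lemma sided_zig_E0: "sided_zig f t d (E0 # w) = sided_zig f (t @ [E0]) d w"
proof (cases t rule: rev_cases)
  case Nil
  then show ?thesis by (simp add: sided_zig_def)
next
  case (snoc t' y)
  then show ?thesis
    by (simp add: sided_zig_snoc sh_snoc qsh_dec dec_assoc flip: append_assoc)
qed

text \<open>In the first summand the next node \<open>E1\<close> lies below the top of the chain
  \<open>E1 # t\<close>, in the second it lies above, as the new top. Each linear extension of the
  poset without this relation is of exactly one of the two kinds, and without the relation the rest
  of the zigzag is disconnected from the chain.\<close>

lemma sided_zig_E1:
  "sided_zig f t d (E1 # w) + sided_zig f (t @ [E1]) d w =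
   zig (\<lambda>v. sh (\<lambda>t'. sh f (E1 # t') v) t d) [] E1 [] w"
proof (cases t rule: rev_cases)
  case Nil
  have "sided_zig f t d (E1 # w) + sided_zig f (t @ [E1]) d w = dec (\<lambda>u1 u2. zig f u1 E1 u2 w) (E1 # d)"
    by (simp add: Nil sided_zig_def)
  then show ?thesis
    by (simp add: Nil zig_insert[where g = "\<lambda>_ _. E0"] del: dec.simps)
next
  case (snoc t1 y)
  have "sided_zig f t d (E1 # w) + sided_zig f (t @ [E1]) d w =
    dec (\<lambda>d1 d2. sh (\<lambda>t'. dec (\<lambda>p1 p2. zig f p1 E1 (p2 @ y # d2) w) (E1 # t')) t1 d1
      + sh (\<lambda>t'. dec (\<lambda>s1 s2. zig f (E1 # t' @ y # s1) E1 s2 w) d2) t1 d1) d"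
    unfolding dec_add
    by (simp only: snoc sided_zig_snoc zig.simps)
       (simp only: sh_snoc qsh_dec dec_assoc append_Cons append_assoc append_Nil)
  \<comment> \<open>\<open>y\<close> is the top of the chain: the new node stands before
    \<open>y\<close> in the first summand and after it in the second, so together it takes any
    position.\<close>
  also have "\<dots> = dec (\<lambda>d1 d2. sh (\<lambda>t'. dec (\<lambda>u1 u2. zig f u1 E1 u2 w) (E1 # t' @ y # d2)) t1 d1) d"
    using dec_append_Cons[of "\<lambda>u1 u2. zig f u1 E1 u2 w" "E1 # _"]
    by (simp only: qsh_add[symmetric] append_Cons)
  also have "\<dots> = dec (\<lambda>d1 d2. sh (\<lambda>t'. zig (\<lambda>v. sh f (E1 # t' @ y # d2) v) [] E1 [] w) t1 d1) d"
    by (simp only: zig_insert[where g = "\<lambda>_ _. E0"])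
  also have "\<dots> = zig (\<lambda>v. dec (\<lambda>d1 d2. sh (\<lambda>t'. sh f (E1 # t' @ y # d2) v) t1 d1) d) [] E1 [] w"
    by (simp only: zig_dec zig_qsh)
  also have "\<dots> = zig (\<lambda>v. sh (\<lambda>t'. sh f (E1 # t') v) t d) [] E1 [] w"
    by (simp only: snoc sh_snoc)
  finally show ?thesis .
qed

text \<open>From here on an index \<open>(k\<^sub>1, \<dots>, k\<^sub>r)\<close> is represented by the list of the numbers
  \<open>k\<^sub>i - 1\<close>, so that every list of natural numbers is an index and merging two entries is
  \<open>\<lambda>a b. Suc (a + b)\<close>.\<close>

definition iw :: "nat list \<Rightarrow> letter list" where
  "iw ks = concat (map (\<lambda>k. E1 # replicate k E0) ks)"

lemma iw_simps [simp]: "iw [] = []" "iw (k # ks) = E1 # replicate k E0 @ iw ks"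
  "iw (ks @ ls) = iw ks @ iw ls"
  by (simp_all add: iw_def)

lemma iw_ones: "iw (replicate n 0) = replicate n E1"
  by (induction n) simp_all

lemma H1_word_iw [simp]: "H1_word (iw ks)"
  by (cases ks) (auto simp: H1_word_def)

text \<open>The value of \<open>f\<close> on the zigzag whose integral represents a zeta-star value.\<close>

fun zig_star :: "(letter list \<Rightarrow> 'r::comm_ring_1) \<Rightarrow> nat list \<Rightarrow> 'r" where
  "zig_star f [] = f []"
| "zig_star f (l # L) = zig f [] E1 [] (replicate l E0 @ iw L)"

lemma sided_zig_replicate:
  "sided_zig f t d (replicate l E0 @ w) = sided_zig f (t @ replicate l E0) d w"
  by (induction l arbitrary: t) (simp_all add: sided_zig_E0)

lemma zig_cong_H1:
  assumes "\<And>v. H1_word v \<Longrightarrow> f v = h v" "hd (p @ x # s) = E1"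
  shows "zig f p x s w = zig h p x s w"
proof (rule zig_cong[where P = "\<lambda>v. v \<noteq> [] \<and> hd v = E1"])
  show "p1 @ E1 # p2 @ x # s \<noteq> [] \<and> hd (p1 @ E1 # p2 @ x # s) = E1"
    if "p1 @ p2 @ x # s \<noteq> [] \<and> hd (p1 @ p2 @ x # s) = E1" for p1 p2 x s
    using that by (cases p1) auto
  show "p @ x # s1 @ E0 # s2 \<noteq> [] \<and> hd (p @ x # s1 @ E0 # s2) = E1"
    if "p @ x # s1 @ s2 \<noteq> [] \<and> hd (p @ x # s1 @ s2) = E1" for p x s1 s2
    using that by (cases p) auto
qed (use assms in \<open>auto simp: H1_word_def\<close>)

text \<open>Iterates \<open>sided_zig_E1\<close> along \<open>L\<close>: at each \<open>E1\<close>
  either the rest is detached and contributes \<open>zig_star\<close>, or the next entry joins the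
  chain at the cost of a sign. \<open>p\<close> consists of the entries that have joined.\<close>

lemma sided_zig_iw:
  assumes hom: "\<And>u v. H1_word u \<Longrightarrow> H1_word v \<Longrightarrow> sh f u v = f u * f v"
    and unit: "f [] = 1"
  shows "sided_zig f t d (replicate l E0 @ iw L) =
    dec (\<lambda>p q. (-1) ^ length p * sh (\<lambda>t'. f (E1 # t')) (t @ replicate l E0 @ iw p) d * zig_star f q) L"
proof (induction L arbitrary: t l)
  case Nil
  show ?case by (simp add: sided_zig_replicate[of _ _ _ _ "[]", simplified] sided_zig_Nil unit)
next
  case (Cons m L)
  define t2 where "t2 = t @ replicate l E0"
  let ?w = "replicate m E0 @ iw L"
  have "sided_zig f t2 d (E1 # ?w) =
      zig (\<lambda>v. sh (\<lambda>t'. sh f (E1 # t') v) t2 d) [] E1 [] ?w - sided_zig f (t2 @ [E1]) d ?w"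
    using sided_zig_E1[of f t2 d ?w] by (simp add: algebra_simps)
  also have "zig (\<lambda>v. sh (\<lambda>t'. sh f (E1 # t') v) t2 d) [] E1 [] ?w =
      zig (\<lambda>v. sh (\<lambda>t'. f (E1 # t')) t2 d * f v) [] E1 [] ?w"
    by (rule zig_cong_H1) (simp_all add: hom H1_word_def qsh_mult_right)
  also have "\<dots> = sh (\<lambda>t'. f (E1 # t')) t2 d * zig_star f (m # L)"
    by (simp add: zig_mult)
  finally show ?case
    using Cons.IH[of "t2 @ [E1]" m]
    by (simp add: sided_zig_replicate t2_def dec_minus)
qed

section \<open>Harmonic products of indices\<close>

abbreviation hr :: "'r::comm_ring_1 \<Rightarrow> (nat list \<Rightarrow> 'r) \<Rightarrow> nat list \<Rightarrow> nat list \<Rightarrow> 'r" where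
  "hr c \<equiv> qsh c (\<lambda>a b. Suc (a + b))"

definition alt :: "('a list \<Rightarrow> 'r::comm_ring_1) \<Rightarrow> 'a list \<Rightarrow> 'r" where
  "alt f p = (-1) ^ length p * f p"

lemma alt_Nil [simp]: "alt f [] = f []"
  by (simp add: alt_def)

lemma alt_conv: "alt (conv f h) w = conv (alt f) (alt h) w"
proof -
  have "conv (alt f) (alt h) w = dec (\<lambda>x y. (-1) ^ length w * (f x * h y)) w"
    by (rule dec_cong) (auto simp: alt_def power_add)
  then show ?thesis
    by (simp add: alt_def dec_mult)
qed

text \<open>The value of \<open>f\<close> on the sum of all indices obtained from \<open>rev (a # L)\<close> by merging.\<close>

fun star_sum :: "(nat list \<Rightarrow> 'r::comm_ring_1) \<Rightarrow> nat \<Rightarrow> nat list \<Rightarrow> 'r" where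
  "star_sum f a [] = f [a]"
| "star_sum f a (b # L) = star_sum (\<lambda>ms. f (ms @ [a])) b L + star_sum f (Suc (a + b)) L"

fun star_val :: "(nat list \<Rightarrow> 'r::comm_ring_1) \<Rightarrow> nat list \<Rightarrow> 'r" where
  "star_val f [] = f []"
| "star_val f (a # L) = star_sum f a L"

lemma star_sum_cong:
  "(\<And>ms. ms \<noteq> [] \<Longrightarrow> a \<le> last ms \<Longrightarrow> f ms = h ms) \<Longrightarrow> star_sum f a L = star_sum h a L"
proof (induction f a L arbitrary: h rule: star_sum.induct)
  case (2 f a b L)
  have "star_sum (\<lambda>ms. f (ms @ [a])) b L = star_sum (\<lambda>ms. h (ms @ [a])) b L"
    by (rule 2(1)) (auto intro!: 2(3))
  moreover have "star_sum f (Suc (a + b)) L = star_sum h (Suc (a + b)) L"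
    by (rule 2(2)) (auto intro!: 2(3))
  ultimately show ?case by simp
qed auto

lemma star_sum_add: "star_sum (\<lambda>ms. f ms + h ms) a L = star_sum f a L + star_sum h a L"
proof (induction f a L arbitrary: h rule: star_sum.induct)
  case (2 f a b L)
  show ?case
    by (simp only: star_sum.simps 2) (simp add: algebra_simps)
qed simp

lemma star_sum_mult: "star_sum (\<lambda>ms. c * f ms) a L = c * star_sum f a L"
  by (induction f a L rule: star_sum.induct) (simp_all add: algebra_simps)

text \<open>Only the last entry of a merged index depends on the starting entry, and it does so
  additively.\<close>

lemma star_sum_shift:
  "star_sum (\<lambda>ms. H (butlast ms) (last ms)) (Suc (b + d)) L =
   star_sum (\<lambda>ms. H (butlast ms) (Suc (b + last ms))) d L"
proof (induction L arbitrary: d)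
  case (Cons e L)
  then show ?case
    using Cons[of "Suc (d + e)"] by (simp add: add.assoc)
qed simp

text \<open>By \<open>ev_circ_star\<close>, the value of \<open>f\<close> on the circled asterisk
  product of \<open>c @ [b]\<close> with the star of \<open>rev (a' # L)\<close>, where
  \<open>a\<close> is \<open>Suc (b + a')\<close>: the two last entries are already added, and
  merging only enlarges the sum.\<close>

definition circ_star :: "(nat list \<Rightarrow> 'r::comm_ring_1) \<Rightarrow> nat list \<Rightarrow> nat \<Rightarrow> nat list \<Rightarrow> 'r" where
  "circ_star f c a L = star_sum (\<lambda>ms. hr 1 (\<lambda>x. f (x @ [last ms])) c (butlast ms)) a L"

lemma circ_star_Nil: "circ_star f [] a L = star_sum f a L"
  unfolding circ_star_def by (rule star_sum_cong) simp

text \<open>The harmonic counterpart of \<open>sided_zig_E1\<close>. The product of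
  \<open>c @ [a]\<close> with \<open>ms\<close> is split by its last entry: \<open>a\<close> alone
  and \<open>a\<close> merged with \<open>last ms\<close> make up
  \<open>circ_star f c a (b # L)\<close>, while \<open>last ms\<close> alone gives the subtracted
  term.\<close>

lemma circ_star_Cons:
  "circ_star f c a (b # L) = star_sum (\<lambda>ms. hr 1 f (c @ [a]) ms) b L - circ_star f (c @ [a]) b L"
proof -
  have "star_sum (\<lambda>ms. hr 1 f (c @ [a]) ms) b L =
     star_sum (\<lambda>ms. hr 1 (\<lambda>x. f (x @ [a])) c ms + hr 1 (\<lambda>x. f (x @ [last ms])) (c @ [a]) (butlast ms)
       + hr 1 (\<lambda>x. f (x @ [Suc (a + last ms)])) c (butlast ms)) b L"
  proof (rule star_sum_cong)
    fix ms :: "nat list" assume "ms \<noteq> []"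
    then obtain ms' e where "ms = ms' @ [e]"
      by (meson rev_exhaust)
    then show "hr 1 f (c @ [a]) ms = hr 1 (\<lambda>x. f (x @ [a])) c ms + hr 1 (\<lambda>x. f (x @ [last ms])) (c @ [a]) (butlast ms)
       + hr 1 (\<lambda>x. f (x @ [Suc (a + last ms)])) c (butlast ms)"
      by (simp add: qsh_snoc_snoc)
  qed
  then show ?thesis
    by (simp add: circ_star_def star_sum_add
        star_sum_shift[of "\<lambda>y e. hr 1 (\<lambda>x. f (x @ [e])) c y"])
qed

lemma circ_star_hom:
  assumes hom: "\<And>u v. hr 1 f u v = f u * f v" and unit: "f [] = 1"
  shows "circ_star f c a L = dec (\<lambda>p q. (-1) ^ length p * f (c @ a # p) * star_val f q) L"
proof (induction L arbitrary: c a)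
  case Nil
  show ?case by (simp add: circ_star_def unit)
next
  case (Cons b L)
  show ?case
    using Cons[of "c @ [a]" b]
    by (simp add: circ_star_Cons hom star_sum_mult dec_minus)
qed

text \<open>For \<open>c = []\<close>, \<open>circ_star\<close> is \<open>star_sum\<close> itself,
  so \<open>circ_star_hom\<close> expresses \<open>star_val\<close> through its values at shorter
  lists. Brought to one side, this is the inverse relation. \<open>conv_zig_star\<close> arises from
  \<open>sided_zig_iw\<close> in the same way.\<close>

lemma conv_star_val:
  assumes hom: "\<And>u v. hr 1 f u v = f u * f v" and unit: "f [] = 1"
  shows "conv (alt f) (star_val f) L = (if L = [] then 1 else 0)"
proof (cases L)
  case (Cons a L')
  then show ?thesis
    using circ_star_hom[OF assms, of "[]" a L']
    by (simp add: circ_star_Nil alt_def unit dec_minus)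
qed (simp add: unit)

lemma conv_zig_star:
  assumes hom: "\<And>u v. H1_word u \<Longrightarrow> H1_word v \<Longrightarrow> sh f u v = f u * f v" and unit: "f [] = 1"
  shows "conv (alt (\<lambda>p. f (iw p))) (zig_star f) L = (if L = [] then 1 else 0)"
proof (cases L)
  case (Cons a L')
  have "zig_star f L = dec (\<lambda>p q. (-1) ^ length p * f (iw (a # p)) * zig_star f q) L'"
    using sided_zig_iw[OF assms, of "[]" "[]" a L'] by (simp add: Cons sided_zig_def)
  then show ?thesis
    by (simp add: Cons alt_def unit dec_minus)
qed (simp add: unit)

text \<open>The defect \<open>D\<close> of multiplicativity is annihilated by convolving with
  \<open>f\<close> in both variables; \<open>conv_left_cancel\<close>, applied once for each
  variable, removes \<open>f\<close> again.\<close>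

lemma qsh_conv_inverse:
  fixes f h :: "'a list \<Rightarrow> 'r::comm_ring_1"
  assumes hom: "\<And>u v. qsh c g f u v = f u * f v" and unit: "f [] = 1"
    and inv: "\<And>w. conv f h w = (if w = [] then 1 else 0)"
  shows "qsh c g h u v = h u * h v"
proof -
  have delta: "qsh c g (\<lambda>w. if w = [] then 1 else 0 :: 'r) u v = (if u = [] \<and> v = [] then 1 else 0)" for u v
  proof (cases "u = [] \<and> v = []")
    case False
    then have "qsh c g (\<lambda>w. if w = [] then 1 else 0 :: 'r) u v = qsh c g (\<lambda>w. 0) u v"
      by (intro qsh_cong) (use qsh_words_nonempty in force)
    then show ?thesis using False by auto
  qed simp
  have 1: "dec (\<lambda>u1 u2. dec (\<lambda>v1 v2. f u1 * f v1 * qsh c g h u2 v2) v) u = (if u = [] \<and> v = [] then 1 else 0)" for u v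
    using qsh_conv[of c g f h u v] by (simp add: hom inv delta)
  have 2: "dec (\<lambda>u1 u2. dec (\<lambda>v1 v2. f u1 * f v1 * (h u2 * h v2)) v) u = (if u = [] \<and> v = [] then 1 else 0)" for u v
  proof -
    have "dec (\<lambda>u1 u2. dec (\<lambda>v1 v2. f u1 * f v1 * (h u2 * h v2)) v) u =
        dec (\<lambda>u1 u2. dec (\<lambda>v1 v2. f u1 * h u2 * (f v1 * h v2)) v) u"
      by (simp add: ac_simps)
    also have "\<dots> = conv f h u * conv f h v"
      by (simp only: dec_mult dec_mult_right)
    finally have "dec (\<lambda>u1 u2. dec (\<lambda>v1 v2. f u1 * f v1 * (h u2 * h v2)) v) u = conv f h u * conv f h v" .
    then show ?thesis by (simp add: inv)
  qed
  define D where "D = (\<lambda>u v. qsh c g h u v - h u * h v)"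
  have "conv f (\<lambda>u2. conv f (D u2) v) u = conv f (\<lambda>_. 0) u" for u v
  proof -
    have "conv f (\<lambda>u2. conv f (D u2) v) u =
       dec (\<lambda>u1 u2. dec (\<lambda>v1 v2. f u1 * f v1 * qsh c g h u2 v2 + (- 1) * (f u1 * f v1 * (h u2 * h v2))) v) u"
      by (simp flip: dec_mult add: D_def algebra_simps)
    also have "\<dots> = 0"
      unfolding dec_add dec_mult by (simp add: 1 2)
    finally show ?thesis by simp
  qed
  then have "conv f (D u2) v = 0" for u2 v
    by (intro conv_left_cancel[of "\<lambda>_. True" f "\<lambda>u2. conv f (D u2) v" "\<lambda>_. 0" u2]) (auto simp: unit)
  then have "D u v = 0" for u v
    by (intro conv_left_cancel[of "\<lambda>_. True" f "D u" "\<lambda>_. 0" v]) (auto simp: unit)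
  then show ?thesis
    by (simp add: D_def)
qed

text \<open>A merged term is one entry shorter than the others, so a sign depending on the length
  reverses it: the twist exchanges the harmonic and the star-harmonic product.\<close>

lemma hr_alt: "hr (-1) (alt f) u v = (-1) ^ (length u + length v) * hr 1 f u v"
proof (induction "length u + length v" arbitrary: u v f rule: less_induct)
  case less
  show ?case
  proof (cases "u = [] \<or> v = []")
    case True
    then show ?thesis by (auto simp: alt_def)
  next
    case False
    then obtain a u' b v' where uv: "u = a # u'" "v = b # v'"
      by (meson list.exhaust)
    have alt_Cons: "alt f (e # x) = - alt (\<lambda>y. f (e # y)) x" for e x
      by (simp add: alt_def)
    show ?thesis
      using less[of u' v "\<lambda>x. f (a # x)"] less[of u v' "\<lambda>x. f (b # x)"]
        less[of u' v' "\<lambda>x. f (Suc (a + b) # x)"]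
      by (simp add: uv alt_Cons qsh_minus algebra_simps)
  qed
qed

lemma hr_alt_hom:
  assumes "\<And>u v. hr 1 f u v = f u * f v"
  shows "hr (-1) (alt f) u v = alt f u * alt f v"
  by (simp add: hr_alt assms alt_def power_add)

section \<open>The derivation raising an entry\<close>

text \<open>The transpose of the derivation. The entry \<open>k\<close> represents k + 1, whence the
  factor \<open>Suc k\<close>.\<close>

fun dl :: "(nat list \<Rightarrow> 'r::comm_ring_1) \<Rightarrow> nat list \<Rightarrow> 'r" where
  "dl f [] = 0"
| "dl f (k # p) = of_nat (Suc k) * f (Suc k # p) + dl (\<lambda>x. f (k # x)) p"

lemma dl_add: "dl (\<lambda>x. f x + h x) p = dl f p + dl h p"
  by (induction p arbitrary: f h) (simp_all add: algebra_simps)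

lemma dl_mult: "dl (\<lambda>x. c * f x) p = c * dl f p"
  by (induction p arbitrary: f) (simp_all add: algebra_simps)

lemma dl_mult_right: "dl (\<lambda>x. f x * c) p = dl f p * c"
  using dl_mult[of c f p] by (simp add: mult.commute)

lemma dl_sum: "dl (\<lambda>x. \<Sum>i\<in>A. f i x) p = (\<Sum>i\<in>A. dl (f i) p)"
proof (induction A rule: infinite_finite_induct)
  case (insert i A)
  then show ?case by (simp add: dl_add)
qed (use dl_mult[of 0 "\<lambda>_. 0" p] in simp_all)

lemma dl_eq_zero: "(\<And>x k y. f (x @ Suc k # y) = 0) \<Longrightarrow> dl f p = 0"
proof (induction p arbitrary: f)
  case (Cons k p)
  have "dl (\<lambda>x. f (k # x)) p = 0"
    by (rule Cons.IH) (use Cons.prems[of "k # _"] in simp)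
  then show ?case
    using Cons.prems[of "[]"] by simp
qed simp

text \<open>The Leibniz rule. For a merged entry, deriving either factor leads to the same index,
  and the two coefficients add up to the merged entry, which is the coefficient of its own
  derivation.\<close>

lemma hr_dl:
  "hr c (dl f) u v = dl (\<lambda>x. hr c f x v) u + dl (\<lambda>y. hr c f u y) v"
proof (induction "length u + length v" arbitrary: u v f rule: less_induct)
  case less
  show ?case
  proof (cases "u = [] \<or> v = []")
    case True
    then show ?thesis by auto
  next
    case False
    then obtain a u' b v' where uv: "u = a # u'" "v = b # v'"
      by (meson list.exhaust)
    show ?thesis
      using less[of u' v "\<lambda>x. f (a # x)"] less[of u v' "\<lambda>x. f (b # x)"]
        less[of u' v' "\<lambda>x. f (Suc (a + b) # x)"]
      by (simp add: uv qsh_add qsh_mult dl_add dl_mult algebra_simps)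
  qed
qed

lemma dl_dec:
  "dl (dec H) w = dec (\<lambda>x y. dl (\<lambda>x'. H x' y) x + dl (\<lambda>y'. H x y') y) w"
  by (induction w arbitrary: H) (simp_all add: dl_add dec_add dec_mult algebra_simps)

text \<open>\<open>dl\<close> evaluates \<open>h\<close> only at indices that contain an entry
  \<open>Suc k\<close>, where \<open>h\<close> vanishes. With \<open>h = ones a\<close> this is what
  separates the derivation from \<open>\<kappa>\<close>.\<close>

lemma dl_conv:
  assumes "\<And>x k y. h (x @ Suc k # y) = 0"
  shows "dl (conv f h) w = conv (dl f) h w"
  by (simp add: dl_dec dl_mult dl_mult_right dl_eq_zero[of h, OF assms])

lemma dl_funpow_conv:
  assumes "\<And>x k y. h (x @ Suc k # y) = 0"
  shows "(dl ^^ m) (conv f h) = conv ((dl ^^ m) f) h"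
proof (induction m)
  case (Suc m)
  show ?case
    by (rule ext) (simp add: Suc dl_conv[of h, OF assms])
qed simp

text \<open>The exponential of the derivation with a formal parameter, that is, the generating
  series of its divided powers.\<close>

definition shift :: "(nat list \<Rightarrow> real) \<Rightarrow> nat list \<Rightarrow> real fps" where
  "shift f p = Abs_fps (\<lambda>m. (dl ^^ m) f p / fact m)"

lemma shift_Suc: "of_nat (Suc m) * fps_nth (shift f p) (Suc m) = dl (\<lambda>x. fps_nth (shift f x) m) p"
  using dl_mult_right[of "(dl ^^ m) f" "1 / fact m" p]
  by (simp add: shift_def field_simps del: of_nat_Suc)

lemma qsh_fps_nth: "fps_nth (hr (fps_const c) F u v) m = hr c (\<lambda>x. fps_nth (F x) m) u v"
proof (induction "fps_const c" "\<lambda>a b::nat. Suc (a + b)" F u v rule: qsh.induct)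
qed auto

text \<open>By \<open>shift_Suc\<close> the derivative of the series is \<open>dl\<close> applied to
  it, so the Leibniz rules of \<open>dl\<close> and of \<open>fps_deriv\<close> let the coefficients
  be compared inductively.\<close>

lemma shift_hom:
  assumes hom: "\<And>u v. hr 1 f u v = f u * f v"
  shows "hr 1 (shift f) u v = shift f u * shift f v"
proof -
  have "hr 1 (\<lambda>x. fps_nth (shift f x) m) u v = fps_nth (shift f u * shift f v) m" for m u v
  proof (induction m arbitrary: u v)
    case 0
    show ?case by (simp add: shift_def hom)
  next
    case (Suc m)
    have d: "dl (\<lambda>x. fps_nth (shift f x * s) m) u = fps_nth (fps_deriv (shift f u) * s) m" for u s
      by (simp add: fps_mult_nth dl_sum dl_mult_right flip: shift_Suc)
    have "of_nat (Suc m) * hr 1 (\<lambda>x. fps_nth (shift f x) (Suc m)) u v =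
        hr 1 (dl (\<lambda>x. fps_nth (shift f x) m)) u v"
      unfolding qsh_mult[symmetric] shift_Suc ..
    also have "\<dots> = fps_nth (fps_deriv (shift f u) * shift f v) m + fps_nth (fps_deriv (shift f v) * shift f u) m"
      by (simp add: hr_dl Suc d mult.commute[of "shift f u"])
    also have "\<dots> = fps_nth (fps_deriv (shift f u * shift f v)) m"
      unfolding fps_deriv_mult by (simp add: mult.commute[of "fps_deriv (shift f v)"])
    also have "\<dots> = of_nat (Suc m) * fps_nth (shift f u * shift f v) (Suc m)"
      by (simp only: fps_deriv_nth Suc_eq_plus1)
    finally show ?case by simp
  qed
  then show ?thesis
    using qsh_fps_nth[of 1 "shift f" u v] by (simp add: fps_eq_iff)
qed

text \<open>A letter \<open>E0\<close> inserted behind the leading \<open>E1\<close> lengthens one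
  of the blocks of \<open>E0\<close>. A block of k letters can be lengthened in k + 1 places, which
  is the coefficient in \<open>dl\<close>.\<close>

lemma shuffle_E0:
  "sh (\<lambda>t. f (E1 # t)) (replicate l E0 @ iw p) [E0] = dl (\<lambda>q. f (iw q)) (l # p)"
proof -
  have ins: "sh F u [E0] = dec (\<lambda>a b. F (a @ E0 # b)) u" for F :: "letter list \<Rightarrow> 'a" and u
    using shuffle_split[of "\<lambda>_ _. E0" F u "[]" E0 "[]"] by simp
  have block: "dec (\<lambda>a b. F (a @ E0 # b)) (replicate l E0 @ w) =
     of_nat l * F (replicate (Suc l) E0 @ w) + dec (\<lambda>a b. F (replicate l E0 @ a @ E0 # b)) w"
    for F :: "letter list \<Rightarrow> 'a" and l w
    by (induction l arbitrary: F) (simp_all add: algebra_simps)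
  show ?thesis
    unfolding ins
  proof (induction p arbitrary: l f)
    case Nil
    show ?case
      using block[of "\<lambda>t. f (E1 # t)" l "[]"]
      by (simp add: algebra_simps replicate_append_same)
  next
    case (Cons k p)
    show ?case
      using block[of "\<lambda>t. f (E1 # t)" l "iw (k # p)"] Cons[of "\<lambda>v. f (E1 # replicate l E0 @ v)" k]
      by (simp add: algebra_simps replicate_app_Cons_same)
  qed
qed

lemma shuffle_E0_power: "sh f (replicate m E0) [E0] = of_nat (Suc m) * f (replicate (Suc m) E0)"
  by (induction m arbitrary: f) (simp_all add: algebra_simps)

text \<open>The m-th shuffle power of \<open>E0\<close> is m! times the chain of m letters
  \<open>E0\<close>, so by associativity the chain acts as a divided power of the
  derivation.\<close>

lemma shuffle_replicate_E0:
  fixes f :: "letter list \<Rightarrow> real"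
  shows "sh (\<lambda>t. f (E1 # t)) (replicate l E0 @ iw p) (replicate m E0) =
    fps_nth (shift (\<lambda>q. f (iw q)) (l # p)) m"
proof -
  have "fact m * sh (\<lambda>t. f (E1 # t)) (replicate l E0 @ iw p) (replicate m E0) =
    (dl ^^ m) (\<lambda>q. f (iw q)) (l # p)"
  proof (induction m arbitrary: f)
    case 0
    then show ?case by simp
  next
    case (Suc m)
    define f' where "f' = (\<lambda>v. sh (\<lambda>t. f (E1 # t)) (tl v) [E0])"
    \<comment> \<open>\<open>f'\<close> drops the leading \<open>E1\<close> of its argument, so it
      agrees with the derived functional only at non-empty indices; \<open>dl\<close> keeps the
      length and stays among them.\<close>
    have f': "(dl ^^ i) (\<lambda>q. f' (iw q)) p = (dl ^^ i) (dl (\<lambda>q. f (iw q))) p" if "p \<noteq> []" for i p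
      using that
    proof (induction i arbitrary: p)
      case 0
      then show ?case
        by (cases p) (simp_all add: f'_def shuffle_E0 del: dl.simps)
    next
      case (Suc i)
      obtain a p' where p: "p = a # p'"
        using Suc.prems by (cases p) auto
      show ?case
        by (simp add: p Suc.IH)
    qed
    have "of_nat (Suc m) * sh (\<lambda>t. f (E1 # t)) (replicate l E0 @ iw p) (replicate (Suc m) E0)
       = sh (\<lambda>x. sh (\<lambda>t. f (E1 # t)) (replicate l E0 @ iw p) x) (replicate m E0) [E0]"
      by (simp add: shuffle_E0_power)
    also have "\<dots> = sh (\<lambda>x. sh (\<lambda>t. f (E1 # t)) x [E0]) (replicate l E0 @ iw p) (replicate m E0)"
      by (rule sh_assoc[symmetric])
    also have "\<dots> = sh (\<lambda>t. f' (E1 # t)) (replicate l E0 @ iw p) (replicate m E0)"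
      by (simp add: f'_def)
    finally have "fact (Suc m) * sh (\<lambda>t. f (E1 # t)) (replicate l E0 @ iw p) (replicate (Suc m) E0) =
       fact m * sh (\<lambda>t. f' (E1 # t)) (replicate l E0 @ iw p) (replicate m E0)"
      by (simp add: mult.assoc mult.left_commute)
    then show ?case
      by (simp only: Suc f' list.distinct simp_thms funpow_Suc_right o_def)
  qed
  then show ?thesis
    by (simp add: shift_def field_simps)
qed

section \<open>Regularized homomorphisms\<close>

definition trail :: "'a \<Rightarrow> 'a list \<Rightarrow> nat" where
  "trail e w = length (takeWhile (\<lambda>a. a = e) (rev w))"

lemma trail_simps [simp]: "trail e [] = 0" "trail e (w @ [a]) = (if a = e then Suc (trail e w) else 0)"
  by (simp_all add: trail_def)

lemma trail_append2 [simp]: "trail e (w @ [b, a]) = (if a = e then Suc (trail e (w @ [b])) else 0)"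
  using trail_simps(2)[of e "w @ [b]" a] by simp

lemma trail_eq_0_iff: "trail e u = 0 \<longleftrightarrow> u = [] \<or> last u \<noteq> e"
  by (cases u rule: rev_cases) auto

text \<open>The last letter of a product comes from a factor or from merging, and merging never
  creates \<open>e\<close>. For shuffles \<open>e\<close> is \<open>E1\<close>; for harmonic
  products it is the entry 0, and merged entries are successors.\<close>

lemma qsh_words_trail:
  assumes "x \<in> qsh_words c g u v" "\<And>a b. g a b \<noteq> e" "trail e u = 0" "trail e v = 0"
  shows "trail e x = 0"
  using assms unfolding trail_eq_0_iff
proof (induction c g u v arbitrary: x rule: qsh_words.induct)
  case (3 c g a u b v)
  from "3.prems"(1) consider y where "x = a # y" "y \<in> qsh_words c g u (b # v)"
    | y where "x = b # y" "y \<in> qsh_words c g (a # u) v"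
    | y where "c \<noteq> 0" "x = g a b # y" "y \<in> qsh_words c g u v"
    by (auto split: if_splits)
  then show ?case
  proof cases
    case 1
    then show ?thesis
      using "3.IH"(1)[of y] "3.prems" qsh_words_nonempty[OF 1(2)] by (auto split: if_splits)
  next
    case 2
    then show ?thesis
      using "3.IH"(2)[of y] "3.prems" qsh_words_nonempty[OF 2(2)] by (auto split: if_splits)
  next
    case 3
    then show ?thesis
      using "3.IH"(3)[of y] "3.prems" by (auto split: if_splits)
  qed
qed auto

lemma trail_SucE:
  assumes "trail e u = Suc n"
  obtains v where "u = v @ [e]" "trail e v = n"
  using assms by (cases u rule: rev_cases) (auto split: if_splits)

text \<open>Inserting \<open>e\<close> inside or at an end of the final block of letters
  \<open>e\<close> gives \<open>u @ [e]\<close>, in one way more than the block has letters. All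
  other insertions and all mergings leave a final block that is no longer than that of
  \<open>u\<close>.\<close>

lemma qsh_singleton_trail:
  assumes g: "\<And>a b. g a b \<noteq> e"
  shows "qsh c g f [e] u =
    of_nat (Suc (trail e u)) * f (u @ [e]) + qsh c g (\<lambda>x. if trail e x \<le> trail e u then f x else 0) [e] u"
proof (induction u arbitrary: f rule: rev_induct)
  case Nil
  show ?case using trail_simps(2)[of e "[]" e] by simp
next
  case (snoc b u)
  show ?case
  proof (cases "b = e")
    case True
    then show ?thesis
      by (simp add: qsh_singleton_snoc g snoc[of "\<lambda>x. f (x @ [e])"] algebra_simps cong: if_cong)
  next
    case False
    then show ?thesis
      by (simp add: qsh_singleton_snoc g)
  qed
qed

text \<open>\<open>qsh_singleton_trail\<close> yields a positive multiple of the value at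
  \<open>u @ [e]\<close> from the product with \<open>[e]\<close> and from values at words with
  shorter final blocks, so induction on \<open>trail\<close> applies.\<close>

lemma qsh_determined:
  fixes G H :: "'a list \<Rightarrow> 'r::{idom,ring_char_0}"
  assumes g: "\<And>a b. g a b \<noteq> e"
    and closed: "\<And>u x. P u \<Longrightarrow> x \<in> qsh_words c g [e] u \<Longrightarrow> P x"
    and prefix: "\<And>u. P (u @ [e]) \<Longrightarrow> P u"
    and base: "\<And>u. P u \<Longrightarrow> trail e u = 0 \<Longrightarrow> G u = H u"
    and step: "\<And>u. P u \<Longrightarrow> G u = H u \<Longrightarrow> qsh c g G [e] u = qsh c g H [e] u"
    and "P u"
  shows "G u = H u"
  using \<open>P u\<close>
proof (induction "trail e u" arbitrary: u rule: less_induct)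
  case less
  show ?case
  proof (cases "trail e u")
    case 0
    then show ?thesis using base less.prems by blast
  next
    case (Suc n)
    then obtain v where v: "u = v @ [e]" "trail e v = n"
      by (rule trail_SucE)
    have Pv: "P v"
      using prefix less.prems v by blast
    have GH: "G x = H x" if "P x" "trail e x \<le> n" for x
      using less.hyps[of x] that Suc by simp
    have "qsh c g G [e] v = qsh c g H [e] v"
      using step[OF Pv] GH[OF Pv] v by simp
    moreover have "qsh c g (\<lambda>x. if trail e x \<le> n then G x else 0) [e] v =
        qsh c g (\<lambda>x. if trail e x \<le> n then H x else 0) [e] v"
      by (rule qsh_cong) (use GH closed[OF Pv] in auto)
    ultimately have "of_nat (Suc n) * G u = of_nat (Suc n) * H u"
      using qsh_singleton_trail[of g e c G v, OF g] qsh_singleton_trail[of g e c H v, OF g] v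
      by (simp del: of_nat_Suc)
    then show ?thesis
      by (simp del: of_nat_Suc)
  qed
qed

text \<open>The equation of \<open>qsh_singleton_trail\<close> solved for the value at a word ending
  in \<open>e\<close>, the product with \<open>[e]\<close> being prescribed as multiplication by
  \<open>T\<close>. Stage n is meant for words with at most n trailing letters
  \<open>e\<close>.\<close>

primrec reg_poly ::
    "real poly \<Rightarrow> ('a \<Rightarrow> 'a \<Rightarrow> 'a) \<Rightarrow> 'a \<Rightarrow> ('a list \<Rightarrow> real poly) \<Rightarrow> nat \<Rightarrow> 'a list \<Rightarrow> real poly" where
  "reg_poly c g e z 0 w = z w"
| "reg_poly c g e z (Suc n) w = (if trail e w = Suc n
     then smult (1 / real (Suc n)) ([:0, 1:] * reg_poly c g e z n (butlast w)
       - qsh c g (\<lambda>x. if trail e x \<le> n then reg_poly c g e z n x else 0) [e] (butlast w))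
     else reg_poly c g e z n w)"

text \<open>The construction gives multiplicativity only against \<open>[e]\<close>. Associativity
  and \<open>qsh_determined\<close> extend it from first factors without trailing \<open>e\<close>
  to all first factors (\<open>left\<close>), and commutativity lets this be done for both factors
  in turn.\<close>

lemma ex_regularized_hom:
  fixes z :: "'a list \<Rightarrow> real poly"
  assumes g: "\<And>a b. g a b \<noteq> e" and comm: "\<And>a b. g a b = g b a"
    and assoc: "\<And>a b d. g (g a b) d = g a (g b d)"
    and closed: "\<And>u v x. P u \<Longrightarrow> P v \<Longrightarrow> x \<in> qsh_words c g u v \<Longrightarrow> P x"
    and single: "P [e]"
    and prefix: "\<And>u. P (u @ [e]) \<Longrightarrow> P u"
    and hom: "\<And>u v. P u \<Longrightarrow> P v \<Longrightarrow> trail e u = 0 \<Longrightarrow> trail e v = 0 \<Longrightarrow> qsh c g z u v = z u * z v"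
  shows "\<exists>\<phi>. (\<forall>u. trail e u = 0 \<longrightarrow> \<phi> u = z u) \<and> (\<forall>u. qsh c g \<phi> [e] u = [:0, 1:] * \<phi> u) \<and>
    (\<forall>u v. P u \<longrightarrow> P v \<longrightarrow> qsh c g \<phi> u v = \<phi> u * \<phi> v)"
proof -
  define \<phi> where "\<phi> = (\<lambda>w. reg_poly c g e z (trail e w) w)"
  have reg: "reg_poly c g e z n w = \<phi> w" if "trail e w \<le> n" for n w
    using that
  proof (induction n)
    case 0
    then show ?case by (simp add: \<phi>_def)
  next
    case (Suc n)
    show ?case
    proof (cases "trail e w = Suc n")
      case True
      then show ?thesis by (simp only: \<phi>_def)
    next
      case False
      then have "reg_poly c g e z (Suc n) w = reg_poly c g e z n w"
        by (simp only: reg_poly.simps if_False)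
      also have "\<dots> = \<phi> w"
        by (rule Suc.IH) (use Suc.prems False in linarith)
      finally show ?thesis .
    qed
  qed
  have base: "\<phi> u = z u" if "trail e u = 0" for u
    by (simp add: \<phi>_def that)
  have lead: "qsh c g \<phi> [e] u = [:0, 1:] * \<phi> u" for u
  proof -
    let ?n = "trail e u"
    let ?R = "[:0, 1:] * \<phi> u - qsh c g (\<lambda>x. if trail e x \<le> ?n then \<phi> x else 0) [e] u"
    have "\<phi> (u @ [e]) = smult (1 / real (Suc ?n)) ?R"
    proof -
      have "\<phi> (u @ [e]) = reg_poly c g e z (Suc ?n) (u @ [e])"
        by (rule reg[symmetric]) simp
      also have "\<dots> = smult (1 / real (Suc ?n)) ([:0, 1:] * reg_poly c g e z ?n u
          - qsh c g (\<lambda>x. if trail e x \<le> ?n then reg_poly c g e z ?n x else 0) [e] u)"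
        by simp
      also have "(\<lambda>x. if trail e x \<le> ?n then reg_poly c g e z ?n x else 0) =
          (\<lambda>x. if trail e x \<le> ?n then \<phi> x else 0)"
        using reg by auto
      finally show ?thesis
        by (simp only: reg[OF order_refl])
    qed
    then have "of_nat (Suc ?n) * \<phi> (u @ [e]) = ?R"
      by (simp add: of_nat_poly del: of_nat_Suc)
    then show ?thesis
      by (subst qsh_singleton_trail[where g = g, OF g]) simp
  qed
  have left: "qsh c g \<phi> u v = \<phi> u * \<phi> v"
    if v: "P v" and u: "P u" and base': "\<And>x. P x \<Longrightarrow> trail e x = 0 \<Longrightarrow> qsh c g \<phi> x v = \<phi> x * \<phi> v" for u v
  proof (rule qsh_determined[where P = P and e = e and G = "\<lambda>x. qsh c g \<phi> x v" and c = c and g = g,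
        OF g closed[OF single] prefix base' _ u])
    fix x assume x: "P x" "qsh c g \<phi> x v = \<phi> x * \<phi> v"
    have "qsh c g (\<lambda>y. qsh c g \<phi> y v) [e] x = qsh c g (\<lambda>y. [:0, 1:] * \<phi> y) x v"
      by (simp only: qsh_assoc[where g = g, OF assoc] lead)
    also have "\<dots> = qsh c g (\<lambda>y. \<phi> y * \<phi> v) [e] x"
      by (simp only: qsh_mult qsh_mult_right lead x mult.assoc)
    finally show "qsh c g (\<lambda>y. qsh c g \<phi> y v) [e] x = qsh c g (\<lambda>y. \<phi> y * \<phi> v) [e] x" .
  qed
  have base2: "qsh c g \<phi> x v = \<phi> x * \<phi> v" if x: "P x" "trail e x = 0" and v: "P v" for x v
  proof -
    have "qsh c g \<phi> v x = \<phi> v * \<phi> x"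
    proof (rule left)
      fix y assume y: "P y" "trail e y = 0"
      have "qsh c g \<phi> y x = qsh c g z y x"
      proof (rule qsh_cong)
        fix w assume "w \<in> qsh_words c g y x"
        then have "trail e w = 0"
          using qsh_words_trail[of w c g y x e] g x y by blast
        then show "\<phi> w = z w"
          by (rule base)
      qed
      then show "qsh c g \<phi> y x = \<phi> y * \<phi> x"
        by (simp add: hom base x y)
    qed (use x v in auto)
    then show ?thesis
      by (simp add: qsh_commute[where g = g, OF comm] mult.commute)
  qed
  have "qsh c g \<phi> u v = \<phi> u * \<phi> v" if "P u" "P v" for u v
    by (rule left) (use that base2 in auto)
  then show ?thesis
    using base lead by (intro exI[of _ \<phi>]) simp
qed

lemma qsh_pderiv:
  assumes "pderiv c = 0"
  shows "pderiv (qsh c g f u v) = qsh c g (\<lambda>x. pderiv (f x)) u v"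
  using assms by (induction c g f u v rule: qsh.induct) (simp_all add: pderiv_add pderiv_mult)

text \<open>The product with \<open>[e]\<close> sends both sides, say with value h at
  \<open>u\<close>, to \<open>\<phi> u\<close> plus T times h: on the left by differentiating T
  times \<open>\<phi> u\<close>, on the right because the last letter of a product is the new
  \<open>e\<close>, the old last letter, or a merged letter, which is not \<open>e\<close>.\<close>

lemma pderiv_regularized:
  fixes \<phi> :: "'a list \<Rightarrow> real poly"
  assumes g: "\<And>a b. g a b \<noteq> e"
    and closed: "\<And>u x. P u \<Longrightarrow> x \<in> qsh_words c g [e] u \<Longrightarrow> P x"
    and prefix: "\<And>u. P (u @ [e]) \<Longrightarrow> P u"
    and c: "pderiv c = 0"
    and base: "\<And>u. P u \<Longrightarrow> trail e u = 0 \<Longrightarrow> pderiv (\<phi> u) = 0"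
    and lead: "\<And>u. P u \<Longrightarrow> qsh c g \<phi> [e] u = [:0, 1:] * \<phi> u"
    and "P u"
  shows "pderiv (\<phi> u) = (if u \<noteq> [] \<and> last u = e then \<phi> (butlast u) else 0)"
proof -
  define H where "H = (\<lambda>u. if u \<noteq> [] \<and> last u = e then \<phi> (butlast u) else 0)"
  have snoc: "H (v @ [b]) = (if b = e then \<phi> v else 0)" for v b
    by (simp add: H_def)
  have nil: "H [] = 0"
    by (simp add: H_def)
  have H: "qsh c g H [e] u = \<phi> u + [:0, 1:] * H u" if "P u" for u
  proof (cases u rule: rev_cases)
    case Nil
    then show ?thesis using snoc[of "[]" e] by (simp add: nil)
  next
    case (snoc v b)
    have "H (v @ [b, e]) = \<phi> u"
      using \<open>\<And>v b. H (v @ [b]) = _\<close>[of "v @ [b]" e] snoc by simp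
    then show ?thesis
      using that prefix[of v] lead[of v]
      by (auto simp: snoc qsh_singleton_snoc \<open>\<And>v b. H (v @ [b]) = _\<close> g)
  qed
  have "pderiv (\<phi> u) = H u"
  proof (rule qsh_determined[where P = P and e = e and c = c and g = g, OF g closed prefix _ _ \<open>P u\<close>])
    show "pderiv (\<phi> u) = H u" if "P u" "trail e u = 0" for u
      using that base by (cases u rule: rev_cases) (auto simp: nil snoc split: if_splits)
    show "qsh c g (\<lambda>u. pderiv (\<phi> u)) [e] u = qsh c g H [e] u" if "P u" "pderiv (\<phi> u) = H u" for u
      using qsh_pderiv[OF c, of g \<phi> "[e]" u] that
      by (simp add: lead H pderiv_mult pderiv_pCons)
  qed
  then show ?thesis
    by (simp add: H_def)
qed

section \<open>The map \<open>rho\<close> as a differential operator\<close>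

lemma rho_eq_pderiv:
  assumes "degree p \<le> N"
  shows "rho Z p = (\<Sum>j\<le>N. smult (fps_nth (A_series Z) j) ((pderiv ^^ j) p))"
proof (rule poly_eqI)
  fix i
  let ?a = "fps_nth (A_series Z)"
  \<comment> \<open>Only the coefficient of u^i in the exponential series contains T^i, so the
    factor from \<open>A_series\<close> has degree n - i.\<close>
  have A: "coeff (fps_nth (A_exp_Tu Z) n) i = (if i \<le> n then ?a (n - i) / fact i else 0)" for n
  proof -
    have "coeff (fps_nth (A_exp_Tu Z) n) i = (\<Sum>j\<le>n. ?a j * (if n - j = i then 1 / fact (n - j) else 0))"
      by (simp add: A_exp_Tu_def exp_Tu_def fps_mult_nth coeff_sum atLeast0AtMost)
    also have "\<dots> = (\<Sum>j\<le>n. if j = n - i \<and> i \<le> n then ?a (n - i) / fact i else 0)"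
      by (rule sum.cong) auto
    also have "\<dots> = (if i \<le> n then ?a (n - i) / fact i else 0)"
      by simp
    finally show ?thesis .
  qed
  have "coeff (rho Z p) i = (\<Sum>n\<le>N. coeff p n * fact n * (if i \<le> n then ?a (n - i) / fact i else 0))"
    by (simp add: rho_eq_sum[OF assms] coeff_sum A)
  also have "\<dots> = (\<Sum>n\<in>{i..N}. coeff p n * fact n * ?a (n - i) / fact i)"
    by (rule sum.mono_neutral_cong_right) auto
  also have "\<dots> = (\<Sum>j\<in>{j. i + j \<le> N}. coeff p (i + j) * fact (i + j) * ?a j / fact i)"
    by (rule sum.reindex_bij_witness[of _ "\<lambda>j. i + j" "\<lambda>n. n - i"]) auto
  also have "\<dots> = (\<Sum>j\<le>N. coeff p (i + j) * fact (i + j) * ?a j / fact i)"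
    by (rule sum.mono_neutral_left) (use assms in \<open>auto intro!: coeff_eq_0\<close>)
  also have "\<dots> = (\<Sum>j\<le>N. ?a j * (pochhammer (of_nat (Suc i)) j * coeff p (i + j)))"
  proof (rule sum.cong)
    have "fact (i + j) = (fact i * pochhammer (of_nat (Suc i)) j :: real)" for j
      using pochhammer_product'[of "1::real" i j] by (simp add: pochhammer_fact)
    then show "coeff p (i + j) * fact (i + j) * ?a j / fact i = ?a j * (pochhammer (of_nat (Suc i)) j * coeff p (i + j))" for j
      by simp
  qed simp
  finally show "coeff (rho Z p) i = coeff (\<Sum>j\<le>N. smult (?a j) ((pderiv ^^ j) p)) i"
    by (simp add: coeff_sum coeff_higher_pderiv)
qed

text \<open>The entry 1 of an index is represented by 0, so these are the functionals supported on
  the indices (1, ..., 1).\<close>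

definition ones :: "(nat \<Rightarrow> 'r::comm_ring_1) \<Rightarrow> nat list \<Rightarrow> 'r" where
  "ones a q = (if set q \<subseteq> {0} then a (length q) else 0)"

lemma ones_Suc [simp]: "ones a (x @ Suc k # y) = 0"
  by (simp add: ones_def)

lemma conv_ones: "conv f (ones a) w = (\<Sum>j\<le>trail 0 w. f (take (length w - j) w) * a j)"
proof (induction w arbitrary: a rule: rev_induct)
  case Nil
  then show ?case by (simp add: ones_def)
next
  case (snoc b w)
  show ?case
  proof (cases "b = 0")
    case True
    have o: "ones a (y @ [0]) = ones (\<lambda>j. a (Suc j)) y" for y
      by (simp add: ones_def)
    show ?thesis
      by (simp add: dec_snoc True o snoc sum.atMost_Suc_shift del: sum.atMost_Suc)
         (simp add: ones_def add.commute)
  next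
    case False
    then show ?thesis by (simp add: dec_snoc ones_def)
  qed
qed

section \<open>Words and indices\<close>

lemma index_word_Suc: "index_word (map Suc ks) = iw ks"
  by (simp add: index_word_def iw_def o_def)

lemma idx_Suc: "idx (map Suc ks) = word (iw ks)"
  by (simp add: idx_def index_word_Suc)

lemma index_of_iw [simp]: "index_of (iw ks) = map Suc ks"
  unfolding index_word_Suc[symmetric] by (rule index_of_index_word) (auto simp: is_index_def)

lemma is_index_obtain:
  assumes "is_index ks"
  obtains ks' where "ks = map Suc ks'"
proof
  show "ks = map Suc (map (\<lambda>k. k - 1) ks)"
    using assms by (induction ks) (auto simp: is_index_def)
qed

lemma H1_word_obtain:
  assumes "H1_word w"
  obtains ks where "w = iw ks"
proof -
  have "index_word (index_of w) = w" "is_index (index_of w)"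
    using index_word_index_of[of w] assms by (auto simp: H1_word_def)
  then show ?thesis
    using that is_index_obtain by (metis index_word_Suc)
qed

lemma admissible_iw [simp]: "admissible_word (iw ks) \<longleftrightarrow> trail 0 ks = 0"
proof (cases ks rule: rev_cases)
  case (snoc ks' k)
  have "hd (iw ks' @ E1 # replicate k E0) = E1"
    by (cases ks') auto
  then show ?thesis
    by (simp add: snoc admissible_word_def)
qed (simp add: admissible_word_def)

lemma admissible_H1_word: "admissible_word w \<Longrightarrow> H1_word w"
  by (auto simp: admissible_word_def H1_word_def)

lemma ev_shuffle_words: "ev f (shuffle_words u v) = sh f u v"
  by (induction u v arbitrary: f rule: shuffle_words.induct) simp_all

lemma ev_harmonic_indices:
  "ev f (harmonic_indices (map Suc k) (map Suc l)) = hr 1 (\<lambda>x. f (iw x)) k l"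
proof (induction "1 :: real" "\<lambda>a b::nat. Suc (a + b)" "\<lambda>x. f (iw x)" k l arbitrary: f rule: qsh.induct)
  case (3 a u b v)
  show ?case
    using 3(1)[of "\<lambda>x. f (iw [a] @ x)"] 3(2)[of "\<lambda>x. f (iw [b] @ x)"] 3(3)[of "\<lambda>x. f (iw [Suc (a + b)] @ x)"]
    by (simp add: idx_def index_word_def)
qed (simp_all add: idx_Suc[of "_ # _", simplified] idx_Suc)

lemma ev_star_harmonic_indices:
  "ev f (star_harmonic_indices (map Suc k) (map Suc l)) = hr (-1) (\<lambda>x. f (iw x)) k l"
proof (induction "-1 :: real" "\<lambda>a b::nat. Suc (a + b)" "\<lambda>x. f (iw x)" k l arbitrary: f rule: qsh.induct)
  case (3 a u b v)
  show ?case
    using 3(1)[of "\<lambda>x. f (iw [a] @ x)"] 3(2)[of "\<lambda>x. f (iw [b] @ x)"] 3(3)[of "\<lambda>x. f (iw [Suc (a + b)] @ x)"]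
    by (simp add: idx_def index_word_def)
qed (simp_all add: idx_Suc[of "_ # _", simplified] idx_Suc)

lemma one_eq_word: "(1 :: ncpoly) = word []"
  by (simp add: word_def flip: zero_list_def single_one)

lemma const_1 [simp]: "const 1 = 1"
  by (simp add: const_def one_eq_word word_def)

lemma ev_const [simp]: "ev f (const c) = of_rat c * f []"
  by (simp add: const_def ev_single)

lemma bilinear_ext_word [simp]: "bilinear_ext B (word u) (word v) = B u v"
  by (simp add: bilinear_ext_def word_def)

lemma linear_eq_ev:
  assumes add: "\<And>x y. Poly_Mapping.keys x \<subseteq> A \<Longrightarrow> Poly_Mapping.keys y \<subseteq> A \<Longrightarrow> F (x + y) = F x + F y"
    and scale: "\<And>c x. Poly_Mapping.keys x \<subseteq> A \<Longrightarrow> F (const c * x) = of_rat c * F x"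
    and x: "Poly_Mapping.keys x \<subseteq> A"
  shows "F x = ev (\<lambda>w. F (word w)) x"
proof -
  let ?s = "\<lambda>w. const (Poly_Mapping.lookup x w) * word w"
  have sum: "F (\<Sum>w\<in>K. ?s w) = (\<Sum>w\<in>K. of_rat (Poly_Mapping.lookup x w) * F (word w)) \<and>
      Poly_Mapping.keys (\<Sum>w\<in>K. ?s w) \<subseteq> A" if "finite K" "K \<subseteq> A" for K
    using that
  proof (induction K rule: finite_induct)
    case empty
    show ?case using scale[of 0 0] by simp
  next
    case (insert w K)
    have "Poly_Mapping.keys (?s w) \<subseteq> A" "Poly_Mapping.keys (word w) \<subseteq> A"
      using insert by (simp_all add: keys_subset_iff_ev)
    then show ?case
      using insert add scale
      by (auto simp: keys_subset_iff_ev)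
  qed
  have "x = (\<Sum>w\<in>Poly_Mapping.keys x. ?s w)"
    by (subst sum_single_keys) (simp add: const_def word_def mult_single plus_list_def)
  then show ?thesis
    using sum[OF finite_keys x] by (simp add: ev_def)
qed

lemma linear_on_H0_eq_ev: "linear_on_H0 Z \<Longrightarrow> x \<in> H0 \<Longrightarrow> Z x = ev (\<lambda>w. Z (word w)) x"
  by (rule linear_eq_ev[of "Collect admissible_word"]) (auto simp: linear_on_H0_def H0_iff)

section \<open>Existence of the regularizations\<close>

text \<open>The conditions on a regularized homomorphism, restricted to words. They are stated at
  real \<open>t\<close> because \<open>ev\<close> takes real functionals; \<open>poly_eqI2\<close>
  recovers identities of polynomials.\<close>

definition word_hom ::
    "(letter list \<Rightarrow> letter list \<Rightarrow> ncpoly) \<Rightarrow> (ncpoly \<Rightarrow> real) \<Rightarrow> (letter list \<Rightarrow> real poly) \<Rightarrow> bool" where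
  "word_hom B Z \<phi> \<longleftrightarrow> (\<forall>w. admissible_word w \<longrightarrow> \<phi> w = [:Z (word w):]) \<and> \<phi> [E1] = [:0, 1:] \<and>
     (\<forall>u v t. H1_word u \<longrightarrow> H1_word v \<longrightarrow>
        ev (\<lambda>w. poly (\<phi> w) t) (B u v) = poly (\<phi> u) t * poly (\<phi> v) t)"

text \<open>The default value outside \<open>H1\<close> is the one that \<open>extensional\<close>
  demands.\<close>

definition lift :: "(letter list \<Rightarrow> real poly) \<Rightarrow> ncpoly \<Rightarrow> real poly" where
  "lift \<phi> x = (if x \<in> H1 then
     \<Sum>w\<in>Poly_Mapping.keys x. smult (of_rat (Poly_Mapping.lookup x w)) (\<phi> w) else undefined)"

lemma poly_lift: "x \<in> H1 \<Longrightarrow> poly (lift \<phi> x) t = ev (\<lambda>w. poly (\<phi> w) t) x"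
  by (simp add: lift_def ev_def poly_sum)

lemma bilinear_ext_H1:
  assumes "\<And>u v. H1_word u \<Longrightarrow> H1_word v \<Longrightarrow> B u v \<in> H1" "x \<in> H1" "y \<in> H1"
  shows "bilinear_ext B x y \<in> H1"
  unfolding H1_iff keys_subset_iff_ev
proof (intro allI impI)
  fix f :: "letter list \<Rightarrow> real" assume f: "\<forall>w\<in>Collect H1_word. f w = 0"
  have "ev f (B u v) = 0" if "u \<in> Poly_Mapping.keys x" "v \<in> Poly_Mapping.keys y" for u v
  proof -
    have "B u v \<in> H1"
      using assms that by (auto simp: H1_iff)
    then show ?thesis
      using f by (simp only: H1_iff keys_subset_iff_ev)
  qed
  then have "ev (\<lambda>v. ev (\<lambda>w. ev f (B v w)) y) x = ev (\<lambda>v. 0) x"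
    by (intro ev_cong) (simp add: ev_def)
  then show "ev f (bilinear_ext B x y) = 0"
    by (simp add: ev_bilinear_ext)
qed

lemma H1_add: "x \<in> H1 \<Longrightarrow> y \<in> H1 \<Longrightarrow> x + y \<in> H1"
  by (simp add: H1_iff keys_subset_iff_ev)

lemma H1_scale: "x \<in> H1 \<Longrightarrow> const c * x \<in> H1"
  by (simp add: H1_iff keys_subset_iff_ev)

lemma H0_subset_H1: "x \<in> H0 \<Longrightarrow> x \<in> H1"
  by (auto simp: H0_iff H1_iff admissible_H1_word)

lemma poly_eqI2: "(\<And>t. poly p t = poly q t) \<Longrightarrow> p = (q :: real poly)"
  using poly_eq_poly_eq_iff[of p q] by auto

lemma lift_regularized_hom:
  assumes B: "\<And>u v. H1_word u \<Longrightarrow> H1_word v \<Longrightarrow> B u v \<in> H1"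
    and lin: "linear_on_H0 Z" and unit: "Z 1 = 1" and \<phi>: "word_hom B Z \<phi>"
  shows "is_regularized_hom (bilinear_ext B) Z (lift \<phi>)"
  unfolding is_regularized_hom_def
proof (intro conjI ballI allI)
  show "lift \<phi> \<in> extensional H1"
    by (simp add: extensional_def lift_def)
  show "lift \<phi> (x + y) = lift \<phi> x + lift \<phi> y" if "x \<in> H1" "y \<in> H1" for x y
    by (rule poly_eqI2) (simp add: that poly_lift H1_add)
  show "lift \<phi> (const c * x) = smult (of_rat c) (lift \<phi> x)" if "x \<in> H1" for x c
    by (rule poly_eqI2) (simp add: that poly_lift H1_scale)
  have "\<phi> [] = 1"
    using \<phi> unit by (simp add: word_hom_def admissible_word_def one_eq_word)
  then show "lift \<phi> 1 = 1"
    by (intro poly_eqI2) (simp add: one_eq_word poly_lift H1_word_def)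
  show "lift \<phi> (bilinear_ext B x y) = lift \<phi> x * lift \<phi> y" if "x \<in> H1" "y \<in> H1" for x y
  proof (rule poly_eqI2)
    fix t
    let ?F = "\<lambda>w. poly (\<phi> w) t"
    have "H1_word v" if "v \<in> Poly_Mapping.keys x \<or> v \<in> Poly_Mapping.keys y" for v
      using \<open>x \<in> H1\<close> \<open>y \<in> H1\<close> that by (auto simp: H1_iff)
    then have "ev (\<lambda>v. ev (\<lambda>w. ev ?F (B v w)) y) x = ev (\<lambda>v. ev (\<lambda>w. ?F v * ?F w) y) x"
      using \<phi> by (intro ev_cong) (simp add: word_hom_def)
    then show "poly (lift \<phi> (bilinear_ext B x y)) t = poly (lift \<phi> x * lift \<phi> y) t"
      by (simp add: poly_lift bilinear_ext_H1 B that ev_bilinear_ext ev_fun_mult ev_fun_mult_right)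
  qed
  show "lift \<phi> x = [:Z x:]" if "x \<in> H0" for x
  proof (rule poly_eqI2)
    fix t
    have "ev (\<lambda>w. poly (\<phi> w) t) x = ev (\<lambda>w. Z (word w)) x"
      using that \<phi> by (intro ev_cong) (auto simp: word_hom_def H0_iff)
    then show "poly (lift \<phi> x) t = poly [:Z x:] t"
      using that lin by (simp add: poly_lift H0_subset_H1 linear_on_H0_eq_ev)
  qed
  show "lift \<phi> (word [E1]) = [:0, 1:]"
    using \<phi> by (intro poly_eqI2) (simp add: poly_lift H1_word_def word_hom_def)
qed

lemma regularized_hom_eq_ev:
  assumes "is_regularized_hom P Z \<Phi>" "x \<in> H1"
  shows "poly (\<Phi> x) t = ev (\<lambda>w. poly (\<Phi> (word w)) t) x"
  by (rule linear_eq_ev[of "Collect H1_word"]) (use assms in \<open>auto simp: is_regularized_hom_def H1_iff\<close>)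

lemma word_hom_of_regularized_hom:
  assumes B: "\<And>u v. H1_word u \<Longrightarrow> H1_word v \<Longrightarrow> B u v \<in> H1"
    and \<Phi>: "is_regularized_hom (bilinear_ext B) Z \<Phi>"
  shows "word_hom B Z (\<lambda>w. \<Phi> (word w))"
  unfolding word_hom_def
proof (intro conjI allI impI)
  fix u v t assume uv: "H1_word u" "H1_word v"
  have "ev (\<lambda>w. poly (\<Phi> (word w)) t) (B u v) = poly (\<Phi> (B u v)) t"
    by (rule regularized_hom_eq_ev[OF \<Phi> B[OF uv], symmetric])
  also have "\<Phi> (B u v) = \<Phi> (bilinear_ext B (word u) (word v))"
    by simp
  also have "\<dots> = \<Phi> (word u) * \<Phi> (word v)"
    using \<Phi> uv unfolding is_regularized_hom_def by (metis word_in_H1)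
  finally show "ev (\<lambda>w. poly (\<Phi> (word w)) t) (B u v) = poly (\<Phi> (word u)) t * poly (\<Phi> (word v)) t"
    by simp
qed (use \<Phi> in \<open>auto simp: is_regularized_hom_def\<close>)

lemma regularized_hom_The:
  assumes B: "\<And>u v. H1_word u \<Longrightarrow> H1_word v \<Longrightarrow> B u v \<in> H1"
    and lin: "linear_on_H0 Z" and unit: "Z 1 = 1" and ex: "\<exists>\<phi>. word_hom B Z \<phi>"
    and unique: "\<And>\<phi> \<phi>' w. word_hom B Z \<phi> \<Longrightarrow> word_hom B Z \<phi>' \<Longrightarrow> H1_word w \<Longrightarrow> \<phi> w = \<phi>' w"
  shows "is_regularized_hom (bilinear_ext B) Z (THE \<Phi>. is_regularized_hom (bilinear_ext B) Z \<Phi>)"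
proof -
  have ex1: "\<exists>!\<Phi>. is_regularized_hom (bilinear_ext B) Z \<Phi>"
  proof (rule ex_ex1I)
    show "\<exists>\<Phi>. is_regularized_hom (bilinear_ext B) Z \<Phi>"
      using ex lift_regularized_hom[where B = B, OF B lin unit] by blast
  next
    fix \<Phi> \<Phi>' :: "ncpoly \<Rightarrow> real poly"
    assume h: "is_regularized_hom (bilinear_ext B) Z \<Phi>" "is_regularized_hom (bilinear_ext B) Z \<Phi>'"
    have w: "\<Phi> (word w) = \<Phi>' (word w)" if "H1_word w" for w
      by (rule unique[OF word_hom_of_regularized_hom[where B = B, OF B h(1)] word_hom_of_regularized_hom[where B = B, OF B h(2)] that])
    show "\<Phi> = \<Phi>'"
    proof
      fix x
      show "\<Phi> x = \<Phi>' x"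
      proof (cases "x \<in> H1")
        case True
        show ?thesis
        proof (rule poly_eqI2)
          fix t
          have "ev (\<lambda>w. poly (\<Phi> (word w)) t) x = ev (\<lambda>w. poly (\<Phi>' (word w)) t) x"
            by (rule ev_cong) (use w True in \<open>auto simp: H1_iff\<close>)
          then show "poly (\<Phi> x) t = poly (\<Phi>' x) t"
            by (simp add: regularized_hom_eq_ev[OF h(1) True] regularized_hom_eq_ev[OF h(2) True])
        qed
      next
        case False
        then show ?thesis
          using h by (simp add: is_regularized_hom_def extensional_def)
      qed
    qed
  qed
  show ?thesis
    by (rule theI'[OF ex1])
qed

lemma poly_qsh: "poly (qsh c g f u v) t = qsh (poly c t) g (\<lambda>x. poly (f x) t) u v"
  by (induction c g f u v rule: qsh.induct) simp_all

lemma qsh_words_shuffle_H1: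
  "x \<in> qsh_words (0 :: 'r::comm_ring_1) g u v \<Longrightarrow> H1_word u \<Longrightarrow> H1_word v \<Longrightarrow> H1_word x"
  by (cases "(0 :: 'r, g, u, v)" rule: qsh_words.cases) (auto simp: H1_word_def)

lemma H1_word_prefix: "H1_word (u @ [a]) \<Longrightarrow> H1_word u"
  by (cases u) (auto simp: H1_word_def)

lemma admissible_iff_trail: "admissible_word w \<longleftrightarrow> H1_word w \<and> trail E1 w = 0"
  by (auto simp: admissible_word_def H1_word_def trail_eq_0_iff) (metis letter.exhaust)+

lemma shuffle_words_H1: "H1_word u \<Longrightarrow> H1_word v \<Longrightarrow> shuffle_words u v \<in> H1"
  unfolding H1_iff keys_subset_iff_ev
  by (auto simp: ev_shuffle_words qsh_words_shuffle_H1 intro!: qsh_cong[of 0 _ u v _ "\<lambda>_. 0", simplified])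

lemma shuffle_words_H0: "admissible_word u \<Longrightarrow> admissible_word v \<Longrightarrow> shuffle_words u v \<in> H0"
  unfolding H0_iff keys_subset_iff_ev
  using qsh_words_trail[where e = E1 and c = "0 :: real" and g = "\<lambda>_ _. E0" and u = u and v = v]
  by (auto simp: ev_shuffle_words qsh_words_shuffle_H1 admissible_iff_trail
      intro!: qsh_cong[of 0 _ u v _ "\<lambda>_. 0", simplified])

lemma word_hom_shuffle:
  "word_hom shuffle_words Z \<phi> \<longleftrightarrow> (\<forall>w. admissible_word w \<longrightarrow> \<phi> w = [:Z (word w):]) \<and> \<phi> [E1] = [:0, 1:] \<and>
     (\<forall>u v. H1_word u \<longrightarrow> H1_word v \<longrightarrow> sh \<phi> u v = \<phi> u * \<phi> v)"
proof -
  have "(\<forall>t. ev (\<lambda>w. poly (\<phi> w) t) (shuffle_words u v) = poly (\<phi> u) t * poly (\<phi> v) t) \<longleftrightarrow>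
      sh \<phi> u v = \<phi> u * \<phi> v" for u v
    using poly_qsh[of 0 "\<lambda>_ _. E0" \<phi> u v]
    by (auto simp: ev_shuffle_words intro!: poly_eqI2)
  then show ?thesis
    unfolding word_hom_def by meson
qed

lemma Z_shuffle_regularized:
  assumes lin: "linear_on_H0 Z" and ds: "double_shuffle Z" and unit: "Z 1 = 1"
  shows "is_regularized_hom shuffle Z (Z_shuffle Z)"
  unfolding Z_shuffle_def shuffle_def
proof (rule regularized_hom_The[OF shuffle_words_H1 lin unit])
  let ?z = "\<lambda>w. [:Z (word w):]"
  have hom: "sh ?z u v = ?z u * ?z v" if "admissible_word u" "admissible_word v" for u v
  proof (rule poly_eqI2)
    fix t
    have "poly (sh ?z u v) t = ev (\<lambda>w. Z (word w)) (shuffle_words u v)"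
      by (simp add: poly_qsh ev_shuffle_words)
    also have "\<dots> = Z (shuffle (word u) (word v))"
      by (simp add: shuffle_def linear_on_H0_eq_ev[OF lin shuffle_words_H0[OF that]])
    also have "\<dots> = Z (word u) * Z (word v)"
      using ds that by (simp add: double_shuffle_def)
    finally show "poly (sh ?z u v) t = poly (?z u * ?z v) t"
      by simp
  qed
  have "\<exists>\<phi>. (\<forall>u. trail E1 u = 0 \<longrightarrow> \<phi> u = ?z u) \<and> (\<forall>u. sh \<phi> [E1] u = [:0, 1:] * \<phi> u) \<and>
    (\<forall>u v. H1_word u \<longrightarrow> H1_word v \<longrightarrow> sh \<phi> u v = \<phi> u * \<phi> v)"
    by (rule ex_regularized_hom)
       (auto simp: H1_word_prefix hom admissible_iff_trail intro: qsh_words_shuffle_H1, simp add: H1_word_def)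
  then obtain \<phi> where \<phi>: "\<And>u. trail E1 u = 0 \<Longrightarrow> \<phi> u = ?z u" "\<And>u. sh \<phi> [E1] u = [:0, 1:] * \<phi> u"
    "\<And>u v. H1_word u \<Longrightarrow> H1_word v \<Longrightarrow> sh \<phi> u v = \<phi> u * \<phi> v"
    by blast
  have "\<phi> [E1] = [:0, 1:]"
    using \<phi>(2)[of "[]"] \<phi>(1)[of "[]"] unit by (simp add: one_eq_word)
  then show "\<exists>\<phi>. word_hom shuffle_words Z \<phi>"
    using \<phi>(1,3) by (intro exI[of _ \<phi>]) (simp add: word_hom_shuffle admissible_iff_trail)
next
  fix \<phi> \<phi>' w
  assume h: "word_hom shuffle_words Z \<phi>" "word_hom shuffle_words Z \<phi>'" and w: "H1_word w"
  have E1: "H1_word [E1]"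
    by (simp add: H1_word_def)
  show "\<phi> w = \<phi>' w"
  proof (rule qsh_determined[where e = E1 and P = H1_word and c = 0 and g = "\<lambda>_ _. E0"])
    show "sh \<phi> [E1] u = sh \<phi>' [E1] u" if "H1_word u" "\<phi> u = \<phi>' u" for u
      using h that E1 by (simp add: word_hom_shuffle)
    show "\<phi> u = \<phi>' u" if "H1_word u" "trail E1 u = 0" for u
      using h that by (simp add: word_hom_shuffle admissible_iff_trail)
    show "H1_word x" if "H1_word u" "x \<in> qsh_words (0 :: real poly) (\<lambda>_ _. E0) [E1] u" for u x
      using qsh_words_shuffle_H1[OF that(2) E1 that(1)] .
  qed (use H1_word_prefix w in auto)
qed


lemma harmonic_words_H1:
  assumes "H1_word u" "H1_word v"
  shows "harmonic_indices (index_of u) (index_of v) \<in> H1"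
proof -
  obtain k l where uv: "u = iw k" "v = iw l"
    using assms by (meson H1_word_obtain)
  show ?thesis
    unfolding H1_iff keys_subset_iff_ev by (simp add: uv ev_harmonic_indices)
qed

lemma harmonic_indices_H0:
  assumes "trail 0 k = 0" "trail 0 l = 0"
  shows "harmonic_indices (map Suc k) (map Suc l) \<in> H0"
  unfolding H0_iff keys_subset_iff_ev
  using assms qsh_words_trail[where e = 0 and c = "1 :: real" and g = "\<lambda>a b. Suc (a + b)" and u = k and v = l]
  by (auto simp: ev_harmonic_indices intro!: qsh_cong[of 1 _ k l _ "\<lambda>_. 0", simplified])

lemma word_hom_harmonic:
  "word_hom (\<lambda>v w. harmonic_indices (index_of v) (index_of w)) Z \<phi> \<longleftrightarrow>
     (\<forall>k. trail 0 k = 0 \<longrightarrow> \<phi> (iw k) = [:Z (word (iw k)):]) \<and> \<phi> (iw [0]) = [:0, 1:] \<and>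
     (\<forall>k l. hr 1 (\<lambda>x. \<phi> (iw x)) k l = \<phi> (iw k) * \<phi> (iw l))"
proof -
  have 1: "(\<forall>t. ev (\<lambda>w. poly (\<phi> w) t) (harmonic_indices (map Suc k) (map Suc l)) = poly (\<phi> (iw k)) t * poly (\<phi> (iw l)) t)
      \<longleftrightarrow> hr 1 (\<lambda>x. \<phi> (iw x)) k l = \<phi> (iw k) * \<phi> (iw l)" for k l
    using poly_qsh[of 1 "\<lambda>a b. Suc (a + b)" "\<lambda>x. \<phi> (iw x)" k l]
    by (auto simp: ev_harmonic_indices intro!: poly_eqI2)
  have 2: "(\<forall>w. H1_word w \<longrightarrow> Q w) \<longleftrightarrow> (\<forall>k. Q (iw k))" for Q
    using H1_word_iw H1_word_obtain by metis
  have 3: "(\<forall>w. admissible_word w \<longrightarrow> Q w) \<longleftrightarrow> (\<forall>k. trail 0 k = 0 \<longrightarrow> Q (iw k))" for Q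
    using admissible_iw admissible_H1_word H1_word_obtain by metis
  have 4: "(\<forall>u v t. H1_word u \<longrightarrow> H1_word v \<longrightarrow> Q u v t) \<longleftrightarrow> (\<forall>k l t. Q (iw k) (iw l) t)" for Q :: "_ \<Rightarrow> _ \<Rightarrow> real \<Rightarrow> bool"
    using H1_word_iw H1_word_obtain by metis
  show ?thesis
    unfolding word_hom_def 3 4 index_of_iw 1 by simp
qed

lemma Z_harmonic_regularized:
  assumes lin: "linear_on_H0 Z" and ds: "double_shuffle Z" and unit: "Z 1 = 1"
  shows "is_regularized_hom harmonic Z (Z_harmonic Z)"
  unfolding Z_harmonic_def harmonic_def
proof (rule regularized_hom_The[OF harmonic_words_H1 lin unit])
  let ?z = "\<lambda>k. [:Z (word (iw k)):]"
  have hom: "hr 1 ?z k l = ?z k * ?z l" if "trail 0 k = 0" "trail 0 l = 0" for k l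
  proof (rule poly_eqI2)
    fix t
    have "poly (hr 1 ?z k l) t = ev (\<lambda>w. Z (word w)) (harmonic_indices (map Suc k) (map Suc l))"
      by (simp add: poly_qsh ev_harmonic_indices)
    also have "\<dots> = Z (harmonic (word (iw k)) (word (iw l)))"
      by (simp add: harmonic_def linear_on_H0_eq_ev[OF lin harmonic_indices_H0[OF that]])
    also have "\<dots> = Z (word (iw k)) * Z (word (iw l))"
      using ds that by (simp add: double_shuffle_def)
    finally show "poly (hr 1 ?z k l) t = poly (?z k * ?z l) t"
      by simp
  qed
  have "\<exists>\<phi>. (\<forall>u. trail 0 u = 0 \<longrightarrow> \<phi> u = ?z u) \<and> (\<forall>u. hr 1 \<phi> [0] u = [:0, 1:] * \<phi> u) \<and>
    (\<forall>u v. True \<longrightarrow> True \<longrightarrow> hr 1 \<phi> u v = \<phi> u * \<phi> v)"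
    by (rule ex_regularized_hom) (simp_all add: hom)
  then obtain \<phi> where \<phi>: "\<And>u. trail 0 u = 0 \<Longrightarrow> \<phi> u = ?z u" "\<And>u. hr 1 \<phi> [0] u = [:0, 1:] * \<phi> u"
    "\<And>u v. hr 1 \<phi> u v = \<phi> u * \<phi> v"
    by blast
  define \<phi>' where "\<phi>' = (\<lambda>w. \<phi> (map (\<lambda>k. k - 1) (index_of w)))"
  have \<phi>': "\<phi>' (iw k) = \<phi> k" for k
    by (simp add: \<phi>'_def o_def)
  have "\<phi> [0] = [:0, 1:]"
    using \<phi>(2)[of "[]"] \<phi>(1)[of "[]"] unit by (simp add: one_eq_word)
  then show "\<exists>\<phi>. word_hom (\<lambda>v w. harmonic_indices (index_of v) (index_of w)) Z \<phi>"
    using \<phi>(1,3) by (intro exI[of _ \<phi>']) (simp only: word_hom_harmonic \<phi>', simp)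
next
  fix \<phi> \<phi>' w
  assume h: "word_hom (\<lambda>v w. harmonic_indices (index_of v) (index_of w)) Z \<phi>"
    "word_hom (\<lambda>v w. harmonic_indices (index_of v) (index_of w)) Z \<phi>'" and w: "H1_word w"
  have "\<phi> (iw k) = \<phi>' (iw k)" for k
  proof (rule qsh_determined[where e = 0 and P = "\<lambda>_. True" and c = 1 and g = "\<lambda>a b. Suc (a + b)"
        and G = "\<lambda>k. \<phi> (iw k)" and H = "\<lambda>k. \<phi>' (iw k)"])
    show "hr 1 (\<lambda>k. \<phi> (iw k)) [0] u = hr 1 (\<lambda>k. \<phi>' (iw k)) [0] u" if "\<phi> (iw u) = \<phi>' (iw u)" for u
      using h that by (simp only: word_hom_harmonic)
    show "\<phi> (iw u) = \<phi>' (iw u)" if "trail 0 u = 0" for u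
      using h that by (simp only: word_hom_harmonic)
  qed auto
  then show "\<phi> w = \<phi>' w"
    using w H1_word_obtain by metis
qed

section \<open>The regularizations at a real number\<close>

definition reg_sh :: "(ncpoly \<Rightarrow> real) \<Rightarrow> real \<Rightarrow> letter list \<Rightarrow> real" where
  "reg_sh Z t w = poly (Z_shuffle Z (word w)) t"

definition reg_hr :: "(ncpoly \<Rightarrow> real) \<Rightarrow> real \<Rightarrow> nat list \<Rightarrow> real" where
  "reg_hr Z t k = poly (Z_harmonic Z (word (iw k))) t"

locale double_shuffle_map =
  fixes Z :: "ncpoly \<Rightarrow> real"
  assumes lin: "linear_on_H0 Z" and ds: "double_shuffle Z" and unit: "Z 1 = 1"
begin

lemma word_hom_Z_shuffle: "word_hom shuffle_words Z (\<lambda>w. Z_shuffle Z (word w))"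
  using Z_shuffle_regularized[OF lin ds unit]
  unfolding shuffle_def by (intro word_hom_of_regularized_hom shuffle_words_H1)

lemma word_hom_Z_harmonic:
  "word_hom (\<lambda>v w. harmonic_indices (index_of v) (index_of w)) Z (\<lambda>w. Z_harmonic Z (word w))"
  using Z_harmonic_regularized[OF lin ds unit]
  unfolding harmonic_def by (intro word_hom_of_regularized_hom harmonic_words_H1)

lemma reg_sh_hom: "H1_word u \<Longrightarrow> H1_word v \<Longrightarrow> sh (reg_sh Z t) u v = reg_sh Z t u * reg_sh Z t v"
  using word_hom_Z_shuffle poly_qsh[of 0 "\<lambda>_ _. E0" "\<lambda>w. Z_shuffle Z (word w)" u v t]
  by (simp add: word_hom_shuffle reg_sh_def[abs_def])

lemma reg_sh_admissible: "admissible_word w \<Longrightarrow> reg_sh Z t w = Z (word w)"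
  using word_hom_Z_shuffle by (simp add: word_hom_shuffle reg_sh_def)

lemma reg_sh_Nil [simp]: "reg_sh Z t [] = 1"
  using reg_sh_admissible[of "[]"] unit by (simp add: admissible_word_def one_eq_word)

lemma reg_sh_E1: "reg_sh Z t [E1] = t"
  using word_hom_Z_shuffle by (simp add: word_hom_shuffle reg_sh_def)

lemma reg_hr_hom: "hr 1 (reg_hr Z t) k l = reg_hr Z t k * reg_hr Z t l"
  using word_hom_Z_harmonic poly_qsh[of 1 "\<lambda>a b. Suc (a + b)" "\<lambda>k. Z_harmonic Z (word (iw k))" k l t]
  by (simp only: word_hom_harmonic reg_hr_def[abs_def]) simp

lemma reg_hr_admissible: "trail 0 k = 0 \<Longrightarrow> reg_hr Z t k = Z (word (iw k))"
  using word_hom_Z_harmonic by (simp add: word_hom_harmonic reg_hr_def)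

lemma reg_hr_Nil [simp]: "reg_hr Z t [] = 1"
  using reg_hr_admissible[of "[]"] unit by (simp add: one_eq_word)

lemma reg_hr_0: "reg_hr Z t [0] = t"
  using word_hom_Z_harmonic by (simp only: word_hom_harmonic reg_hr_def) simp

lemma poly_rho_Z_harmonic:
  "poly (rho Z (Z_harmonic Z (word (iw k)))) t = conv (reg_hr Z t) (ones (fps_nth (A_series Z))) k"
proof -
  let ?\<phi> = "\<lambda>k. Z_harmonic Z (word (iw k))"
  have h: "\<And>k. trail 0 k = 0 \<Longrightarrow> ?\<phi> k = [:Z (word (iw k)):]" "?\<phi> [0] = [:0, 1:]"
     "\<And>k l. hr 1 ?\<phi> k l = ?\<phi> k * ?\<phi> l"
    using word_hom_Z_harmonic by (simp_all only: word_hom_harmonic)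
  have d: "pderiv (?\<phi> u) = (if u \<noteq> [] \<and> last u = 0 then ?\<phi> (butlast u) else 0)" for u
    by (rule pderiv_regularized[where P = "\<lambda>_. True" and c = 1 and g = "\<lambda>a b. Suc (a + b)"])
       (simp_all add: h(1) h(3) h(2)[simplified])
  have dj: "(pderiv ^^ j) (?\<phi> u) = (if j \<le> trail 0 u then ?\<phi> (take (length u - j) u) else 0)" for j u
  proof (induction j arbitrary: u)
    case (Suc j)
    show ?case
    proof (cases u rule: rev_cases)
      case (snoc v b)
      have "(pderiv ^^ j) 0 = (0 :: real poly)"
        by (induction j) simp_all
      then show ?thesis
        unfolding funpow_Suc_right o_def d by (simp add: snoc Suc)
    next
      case Nil
      have "(pderiv ^^ j) 0 = (0 :: real poly)"
        by (induction j) simp_all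
      then show ?thesis
        unfolding funpow_Suc_right o_def d by (simp add: Nil)
    qed
  qed simp
  \<comment> \<open>Bounds the degree, as \<open>rho_eq_pderiv\<close> requires, and the number of
    trailing entries that differentiation can remove.\<close>
  define N where "N = max (degree (?\<phi> k)) (trail 0 k)"
  have "poly (rho Z (?\<phi> k)) t = (\<Sum>j\<le>N. fps_nth (A_series Z) j * poly ((pderiv ^^ j) (?\<phi> k)) t)"
    by (simp add: rho_eq_pderiv[of _ N] N_def poly_sum)
  also have "\<dots> = (\<Sum>j\<le>trail 0 k. reg_hr Z t (take (length k - j) k) * fps_nth (A_series Z) j)"
    by (rule sum.mono_neutral_cong_right) (auto simp: N_def dj reg_hr_def)
  finally show ?thesis
    by (simp only: conv_ones)
qed

lemma Z_eq_ev: "x \<in> H0 \<Longrightarrow> Z x = ev (\<lambda>w. Z (word w)) x"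
  by (rule linear_on_H0_eq_ev[OF lin])

end

section \<open>The star map and the circled asterisk product on indices\<close>

lemma merges_snoc2:
  "(\<Sum>ms\<leftarrow>merges (l @ [b, a]). F ms) =
   (\<Sum>ms\<leftarrow>merges (l @ [b]). F (ms @ [a])) + (\<Sum>ms\<leftarrow>merges (l @ [b + a]). F ms)"
  for F :: "nat list \<Rightarrow> real"
proof (induction l arbitrary: F rule: merges.induct)
  case (2 k)
  then show ?case by (simp add: add.assoc)
next
  case (3 k l ks)
  show ?case
    using 3(1)[of "\<lambda>ms. F (k # ms)"] 3(2)[of F] by (simp add: o_def)
qed simp

text \<open>\<open>merges\<close> recurses at the first entry, \<open>star_sum\<close> at the last
  one, where the circled asterisk product joins its factors; hence the reversal.\<close>

lemma merges_rev:
  "(\<Sum>ms\<leftarrow>merges (map Suc (rev (a # L))). F ms) = star_sum (\<lambda>ms. F (map Suc ms)) a L"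
  for F :: "nat list \<Rightarrow> real"
proof (induction L arbitrary: a F)
  case (Cons b L)
  show ?case
    using Cons[of "\<lambda>ms. F (ms @ [Suc a])" b] Cons[of F "Suc (a + b)"]
    by (simp add: merges_snoc2 add.commute)
qed simp

lemma ev_star: "ev f (star (word (iw (rev (a # L))))) = star_sum (\<lambda>ms. f (iw ms)) a L"
proof -
  have "ev f (star (word (iw (rev (a # L))))) = (\<Sum>ms\<leftarrow>merges (map Suc (rev (a # L))). f (index_word ms))"
    unfolding star_def ev_linear_ext ev_word index_of_iw by (simp add: ev_sum_list idx_def o_def)
  then show ?thesis
    by (simp only: merges_rev index_word_Suc)
qed

lemma ev_circ_star:
  "ev f (circ_ast (word (iw (c @ [b]))) (star (word (iw (rev (a # L)))))) =
   circ_star (\<lambda>x. f (iw x)) c (Suc (b + a)) L"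
proof -
  have "ev f (circ_ast (word (iw (c @ [b]))) (star (word (iw (rev (a # L)))))) =
      star_sum (\<lambda>ms. ev f (circ_indices (map Suc (c @ [b])) (map Suc ms))) a L"
    by (simp only: circ_ast_def ev_bilinear_ext ev_word ev_star index_of_iw)
  also have "\<dots> = star_sum (\<lambda>ms. hr 1 (\<lambda>x. f (iw (x @ [Suc (b + last ms)]))) c (butlast ms)) a L"
  proof (rule star_sum_cong)
    fix ms :: "nat list" assume "ms \<noteq> []"
    then have "circ_indices (map Suc (c @ [b])) (map Suc ms) =
        harmonic_indices (map Suc c) (map Suc (butlast ms)) * word (iw [Suc (b + last ms)])"
      by (simp add: circ_indices_def map_butlast last_map idx_def index_word_def)
    then show "ev f (circ_indices (map Suc (c @ [b])) (map Suc ms)) =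
        hr 1 (\<lambda>x. f (iw (x @ [Suc (b + last ms)]))) c (butlast ms)"
      by (simp only: ev_mult_word ev_harmonic_indices iw_simps(3))
  qed
  finally show ?thesis
    unfolding circ_star_def
    by (simp only: star_sum_shift[of "\<lambda>y e. hr 1 (\<lambda>x. f (iw (x @ [e]))) c y"])
qed

text \<open>The last entry of every merged index is at least \<open>Suc a\<close>, so only
  admissible indices are evaluated.\<close>

lemma circ_star_cong:
  assumes "\<And>k. trail 0 k = 0 \<Longrightarrow> f k = h k"
  shows "circ_star f c (Suc a) L = circ_star h c (Suc a) L"
  unfolding circ_star_def by (rule star_sum_cong) (use assms in simp)

lemma circ_star_H0: "circ_ast (word (iw (c @ [b]))) (star (word (iw (rev (a # L))))) \<in> H0"
  unfolding H0_iff keys_subset_iff_ev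
proof (intro allI impI)
  fix f :: "letter list \<Rightarrow> real" assume f: "\<forall>w\<in>Collect admissible_word. f w = 0"
  have "circ_star (\<lambda>x. f (iw x)) c (Suc (b + a)) L = circ_star (\<lambda>x. 0) c (Suc (b + a)) L"
    by (rule circ_star_cong) (use f in simp)
  then show "ev f (circ_ast (word (iw (c @ [b]))) (star (word (iw (rev (a # L)))))) = 0"
    unfolding ev_circ_star using star_sum_mult[of 0 "\<lambda>_. 0" "Suc (b + a)" L]
    by (simp add: circ_star_def)
qed

section \<open>The Hoffman dual\<close>

lemma length_index_word: "is_index ks \<Longrightarrow> length (index_word ks) = sum_list ks"
  by (induction ks) (auto simp: index_word_def is_index_def)

lemma index_word_nth:
  assumes "is_index ks" "i < sum_list ks"
  shows "index_word ks ! i = E1 \<longleftrightarrow> (\<exists>j<length ks. i = sum_list (take j ks))"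
  using assms
proof (induction ks arbitrary: i)
  case (Cons k ks)
  have k: "1 \<le> k" "is_index ks"
    using Cons.prems by (auto simp: is_index_def)
  have ex: "(\<exists>j<length (k # ks). i = sum_list (take j (k # ks))) \<longleftrightarrow>
      i = 0 \<or> (\<exists>j<length ks. i = k + sum_list (take j ks))"
    by (auto simp: less_Suc_eq_0_disj)
  have w: "index_word (k # ks) = (E1 # replicate (k - 1) E0) @ index_word ks"
    by (simp add: index_word_def)
  show ?case
  proof (cases "i < k")
    case True
    then show ?thesis
      unfolding ex w using k by (cases i) (auto simp: nth_append)
  next
    case False
    then have "index_word (k # ks) ! i = index_word ks ! (i - k)"
      unfolding w by (subst nth_append) (use k in simp)
    moreover have "(i = 0 \<or> (\<exists>j<length ks. i = k + sum_list (take j ks))) \<longleftrightarrow> (\<exists>j<length ks. i - k = sum_list (take j ks))"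
      using False k by auto
    ultimately show ?thesis
      unfolding ex using Cons.IH[of "i - k"] Cons.prems False k by auto
  qed
qed simp

lemma partial_sums_iff:
  assumes "is_index ks" "1 \<le> i" "i < sum_list ks"
  shows "i \<in> partial_sums ks \<longleftrightarrow> index_word ks ! i = E1"
proof -
  have "i \<in> partial_sums ks \<longleftrightarrow> (\<exists>j<length ks. i = sum_list (take j ks))"
    unfolding partial_sums_def using assms(2) by (auto simp: not_less_eq_eq) (metis One_nat_def Suc_leI bot_nat_0.not_eq_extremum sum_list.Nil take0)
  then show ?thesis
    using index_word_nth assms by simp
qed

lemma partial_sums_subset:
  assumes "is_index ks"
  shows "partial_sums ks \<subseteq> {1..<sum_list ks}"
proof
  fix i assume "i \<in> partial_sums ks"
  then obtain j where j: "1 \<le> j" "j < length ks" "i = sum_list (take j ks)"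
    by (auto simp: partial_sums_def)
  have pos: "0 < k" if "k \<in> set ks" for k
    using assms that by (auto simp: is_index_def)
  have "ks ! 0 \<in> set (take j ks)"
    using j by (auto simp: in_set_conv_nth intro!: exI[of _ 0])
  then have "1 \<le> i"
    using j pos[of "ks ! 0"] member_le_sum_list[of "ks ! 0" "take j ks"] by (auto dest: in_set_takeD)
  moreover have "sum_list ks = i + sum_list (drop j ks)"
    using j by (metis append_take_drop_id sum_list_append)
  moreover have "ks ! j \<in> set (drop j ks)"
    using j by (auto simp: in_set_conv_nth intro!: exI[of _ 0])
  then have "0 < sum_list (drop j ks)"
    using j pos[of "ks ! j"] member_le_sum_list[of "ks ! j" "drop j ks"] by (auto dest: in_set_dropD)
  ultimately show "i \<in> {1..<sum_list ks}"
    by simp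
qed

text \<open>At positions i \<ge> 1 the letters \<open>E1\<close> mark the partial sums, so
  complementary sets of partial sums mean opposite letters everywhere except at position 0, which
  always carries \<open>E1\<close>.\<close>

lemma hoffman_condition_iff:
  assumes ks: "is_index ks" "ks \<noteq> []" and ls: "is_index ls" "sum_list ls = sum_list ks"
  shows "partial_sums ks \<union> partial_sums ls = {1..<sum_list ks} \<and> partial_sums ks \<inter> partial_sums ls = {}
    \<longleftrightarrow> index_word ls = E1 # map swap_letter (tl (index_word ks))"
proof -
  have pos: "0 < sum_list ks"
    using ks by (cases ks) (auto simp: is_index_def)
  have "partial_sums ks \<union> partial_sums ls = {1..<sum_list ks} \<and> partial_sums ks \<inter> partial_sums ls = {} \<longleftrightarrow>
      (\<forall>i\<in>{1..<sum_list ks}. i \<in> partial_sums ls \<longleftrightarrow> i \<notin> partial_sums ks)"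
    using partial_sums_subset[OF ks(1)] partial_sums_subset[OF ls(1)] ls(2) by auto
  also have "\<dots> \<longleftrightarrow> (\<forall>i\<in>{1..<sum_list ks}. index_word ls ! i = swap_letter (index_word ks ! i))"
  proof (rule ball_cong)
    fix i assume "i \<in> {1..<sum_list ks}"
    then have "i \<in> partial_sums ks \<longleftrightarrow> index_word ks ! i = E1" "i \<in> partial_sums ls \<longleftrightarrow> index_word ls ! i = E1"
      using partial_sums_iff[OF ks(1)] partial_sums_iff[OF ls(1)] ls(2) by auto
    then show "(i \<in> partial_sums ls \<longleftrightarrow> i \<notin> partial_sums ks) \<longleftrightarrow> index_word ls ! i = swap_letter (index_word ks ! i)"
      by (cases "index_word ks ! i"; cases "index_word ls ! i") simp_all
  qed simp
  also have "\<dots> \<longleftrightarrow> index_word ls = E1 # map swap_letter (tl (index_word ks))"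
  proof
    assume *: "\<forall>i\<in>{1..<sum_list ks}. index_word ls ! i = swap_letter (index_word ks ! i)"
    show "index_word ls = E1 # map swap_letter (tl (index_word ks))"
    proof (rule nth_equalityI)
      show "length (index_word ls) = length (E1 # map swap_letter (tl (index_word ks)))"
        using pos by (simp add: length_index_word ks ls)
      fix i assume i: "i < length (index_word ls)"
      have "index_word ls \<noteq> []"
        using pos length_index_word[OF ls(1)] ls(2) by (metis less_numeral_extra(3) list.size(3))
      then have "index_word ls ! 0 = E1"
        using index_word_hd[of ls] hd_conv_nth[of "index_word ls"] by metis
      then show "index_word ls ! i = (E1 # map swap_letter (tl (index_word ks))) ! i"
        using * i by (cases i) (auto simp: length_index_word ks ls nth_tl)
    qed
  next
    assume *: "index_word ls = E1 # map swap_letter (tl (index_word ks))"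
    show "\<forall>i\<in>{1..<sum_list ks}. index_word ls ! i = swap_letter (index_word ks ! i)"
      unfolding * by (auto simp: nth_Cons nth_tl length_index_word ks split: nat.splits)
  qed
  finally show ?thesis .
qed

lemma index_word_hoffman_dual:
  assumes "ks \<noteq> []"
  shows "index_word (hoffman_dual_index (map Suc ks)) = E1 # map swap_letter (tl (iw ks))"
proof -
  let ?ks = "map Suc ks" and ?w = "E1 # map swap_letter (tl (iw ks))"
  have ks: "is_index ?ks" "?ks \<noteq> []"
    using assms by (auto simp: is_index_def)
  have w: "index_word (index_of ?w) = ?w" "is_index (index_of ?w)"
    using index_word_index_of[of ?w] by auto
  have len: "sum_list (index_of ?w) = sum_list ?ks"
  proof -
    have "sum_list (index_of ?w) = length ?w"
      using length_index_word[OF w(2)] by (simp only: w(1))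
    also have "\<dots> = length (iw ks)"
      using assms by (cases ks) simp_all
    also have "\<dots> = sum_list ?ks"
      using length_index_word[OF ks(1)] by (simp only: index_word_Suc)
    finally show ?thesis .
  qed
  have "hoffman_dual_index ?ks = index_of ?w"
    unfolding hoffman_dual_index_def
  proof (rule the_equality)
    show "is_index (index_of ?w) \<and> sum_list (index_of ?w) = sum_list ?ks
      \<and> partial_sums ?ks \<union> partial_sums (index_of ?w) = {1..<sum_list ?ks}
      \<and> partial_sums ?ks \<inter> partial_sums (index_of ?w) = {}"
      using hoffman_condition_iff[OF ks w(2) len] w len by (simp add: index_word_Suc)
  next
    fix ls assume ls: "is_index ls \<and> sum_list ls = sum_list ?ks
      \<and> partial_sums ?ks \<union> partial_sums ls = {1..<sum_list ?ks} \<and> partial_sums ?ks \<inter> partial_sums ls = {}"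
    then have "index_word ls = ?w"
      using hoffman_condition_iff[OF ks, of ls] by (simp add: index_word_Suc)
    then show "ls = index_of ?w"
      using index_of_index_word[of ls] ls by simp
  qed
  then show ?thesis
    using w by simp
qed

section \<open>The zigzag poset of the integral-series identity\<close>

fun bef :: "'a list \<Rightarrow> 'a \<Rightarrow> 'a \<Rightarrow> bool" where
  "bef [] u v = False"
| "bef (y # ys) u v \<longleftrightarrow> y = u \<and> v \<in> set ys \<or> bef ys u v"

lemma bef_append: "bef (xs @ ys) u v \<longleftrightarrow> bef xs u v \<or> bef ys u v \<or> u \<in> set xs \<and> v \<in> set ys"
  by (induction xs) auto

lemma bef_filter: "P u \<Longrightarrow> P v \<Longrightarrow> bef (filter P xs) u v \<longleftrightarrow> bef xs u v"
  by (induction xs) auto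

lemma bef_in_set: "bef xs u v \<Longrightarrow> u \<in> set xs \<and> v \<in> set xs"
  by (induction xs) auto

lemma bef_iff_nth: "bef xs u v \<longleftrightarrow> (\<exists>i j. i < j \<and> j < length xs \<and> xs ! i = u \<and> xs ! j = v)"
proof (induction xs)
  case (Cons y ys)
  have "(\<exists>i j. i < j \<and> j < length (y # ys) \<and> (y # ys) ! i = u \<and> (y # ys) ! j = v) \<longleftrightarrow>
     (\<exists>j. j < length ys \<and> y = u \<and> ys ! j = v) \<or> (\<exists>i j. i < j \<and> j < length ys \<and> ys ! i = u \<and> ys ! j = v)"
    (is "?l \<longleftrightarrow> ?r")
  proof
    assume ?l
    then obtain i j where "i < j" "j < length (y # ys)" "(y # ys) ! i = u" "(y # ys) ! j = v"
      by blast
    then show ?r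
      by (cases i; cases j) auto
  next
    assume ?r
    then show ?l
    proof
      assume "\<exists>j. j < length ys \<and> y = u \<and> ys ! j = v"
      then obtain j where "j < length ys" "y = u" "ys ! j = v"
        by blast
      then show ?l
        by (intro exI[of _ 0] exI[of _ "Suc j"]) auto
    next
      assume "\<exists>i j. i < j \<and> j < length ys \<and> ys ! i = u \<and> ys ! j = v"
      then obtain i j where "i < j" "j < length ys" "ys ! i = u" "ys ! j = v"
        by blast
      then show ?l
        by (intro exI[of _ "Suc i"] exI[of _ "Suc j"]) auto
    qed
  qed
  then show ?case
    using Cons by (auto simp: in_set_conv_nth)
qed simp

text \<open>Positions increase strictly along generators, hence weakly along their closure by
  induction; conversely a generator relates two distinct nodes, so the weak inequality of positions
  is strict.\<close>

lemma linear_extensions_rtrancl: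
  assumes R: "\<And>u v. (u, v) \<in> R \<Longrightarrow> u \<in> X \<and> v \<in> X \<and> u \<noteq> v"
  shows "linear_extensions X (R\<^sup>*) = {xs. distinct xs \<and> set xs = X \<and> (\<forall>(u, v)\<in>R. bef xs u v)}"
proof -
  have "(\<forall>i j. i < length xs \<and> j < length xs \<and> (xs ! i, xs ! j) \<in> R\<^sup>* \<longrightarrow> i \<le> j) \<longleftrightarrow>
      (\<forall>(u, v)\<in>R. bef xs u v)" if xs: "distinct xs" "set xs = X" for xs
  proof
    assume *: "\<forall>i j. i < length xs \<and> j < length xs \<and> (xs ! i, xs ! j) \<in> R\<^sup>* \<longrightarrow> i \<le> j"
    show "\<forall>(u, v)\<in>R. bef xs u v"
    proof safe
      fix u v assume uv: "(u, v) \<in> R"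
      then obtain i j where ij: "i < length xs" "xs ! i = u" "j < length xs" "xs ! j = v"
        using R xs(2) by (metis in_set_conv_nth)
      then have "i \<le> j" "i \<noteq> j"
        using * uv R by auto
      then show "bef xs u v"
        unfolding bef_iff_nth using ij by (intro exI[of _ i] exI[of _ j]) simp
    qed
  next
    assume *: "\<forall>(u, v)\<in>R. bef xs u v"
    have "i \<le> j" if "(a, b) \<in> R\<^sup>*" "xs ! i = a" "xs ! j = b" "i < length xs" "j < length xs" for a b i j
      using that
    proof (induction arbitrary: j rule: rtrancl_induct)
      case base
      then show ?case using nth_eq_iff_index_eq[OF xs(1), of i j] by simp
    next
      case (step y z)
      obtain i' j' where "i' < j'" "j' < length xs" "xs ! i' = y" "xs ! j' = z"
        using * step.hyps by (auto simp: bef_iff_nth)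
      then show ?case
        using step.IH[of i'] step.prems xs(1) by (auto simp: nth_eq_iff_index_eq)
    qed
    then show "\<forall>i j. i < length xs \<and> j < length xs \<and> (xs ! i, xs ! j) \<in> R\<^sup>* \<longrightarrow> i \<le> j"
      by blast
  qed
  then show ?thesis
    unfolding linear_extensions_def by auto
qed

text \<open>A path is a start node followed by steps; a step to \<open>y\<close> goes up if its flag is set.\<close>

fun rels :: "'a \<Rightarrow> (bool \<times> 'a) list \<Rightarrow> 'a rel" where
  "rels x [] = {}"
| "rels x ((up, y) # st) = insert (if up then (x, y) else (y, x)) (rels y st)"

text \<open>Linear extensions of a path that induce the prescribed order \<open>p @ x # s\<close> on
  the nodes already placed, in accordance with the states of \<open>zig\<close>.\<close>

definition LE :: "'a list \<Rightarrow> 'a \<Rightarrow> 'a list \<Rightarrow> (bool \<times> 'a) list \<Rightarrow> 'a list set" where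
  "LE p x s st = {xs. distinct xs \<and> set xs = set (p @ x # s) \<union> snd ` set st \<and>
     filter (\<lambda>y. y \<in> set (p @ x # s)) xs = p @ x # s \<and> (\<forall>(u, v)\<in>rels x st. bef xs u v)}"

lemma finite_LE: "finite (LE p x s st)"
  by (rule finite_subset[OF _ finite_subset_distinct[of "set (p @ x # s) \<union> snd ` set st"]])
     (auto simp: LE_def)

lemma LE_Nil: "distinct (p @ x # s) \<Longrightarrow> LE p x s [] = {p @ x # s}"
proof -
  assume "distinct (p @ x # s)"
  moreover have "xs = p @ x # s" if "set xs = set (p @ x # s)" "filter (\<lambda>y. y \<in> set (p @ x # s)) xs = p @ x # s" for xs
    using that by (metis filter_True)
  ultimately show ?thesis
    unfolding LE_def by auto
qed

lemma filter_insert_obtain: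
  assumes "distinct xs" "a \<in> set xs" "a \<notin> A" "filter (\<lambda>y. y \<in> A) xs = ys"
  obtains u v where "filter (\<lambda>y. y \<in> insert a A) xs = u @ a # v" "ys = u @ v"
proof -
  obtain b c where xs: "xs = b @ a # c"
    using assms(2) by (meson split_list)
  have "a \<notin> set b" "a \<notin> set c"
    using assms(1) xs by auto
  then have "filter (\<lambda>y. y \<in> insert a A) b = filter (\<lambda>y. y \<in> A) b"
    "filter (\<lambda>y. y \<in> insert a A) c = filter (\<lambda>y. y \<in> A) c"
    by (auto intro: filter_cong)
  then show ?thesis
    using that[of "filter (\<lambda>y. y \<in> A) b" "filter (\<lambda>y. y \<in> A) c"] assms xs by auto
qed

lemma filter_filter_insert:
  assumes "a \<notin> A" "filter (\<lambda>y. y \<in> insert a A) xs = u @ a # v" "a \<notin> set u" "a \<notin> set v"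
    "set u \<subseteq> A" "set v \<subseteq> A"
  shows "filter (\<lambda>y. y \<in> A) xs = u @ v"
proof -
  have "filter (\<lambda>y. y \<in> A) xs = filter (\<lambda>y. y \<in> A) (filter (\<lambda>y. y \<in> insert a A) xs)"
    by (auto simp: filter_filter intro: filter_cong)
  also have "\<dots> = u @ v"
    unfolding assms(2) using assms(1) filter_True[of u "\<lambda>y. y \<in> A"] filter_True[of v "\<lambda>y. y \<in> A"] assms(5,6)
    by (auto simp: subset_iff)
  finally show ?thesis .
qed

lemma distinct_append_unique:
  assumes "u @ v = p @ x # s" "distinct (p @ x # s)"
  shows "x \<in> set u \<Longrightarrow> \<exists>s1 s2. s = s1 @ s2 \<and> u = p @ x # s1 \<and> v = s2"
    and "x \<in> set v \<Longrightarrow> \<exists>p1 p2. p = p1 @ p2 \<and> u = p1 \<and> v = p2 @ x # s"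
  using assms by (auto simp: append_eq_append_conv2 Cons_eq_append_conv append_eq_Cons_conv)

lemma bef_middle:
  assumes "distinct (u @ a # v)" "x \<in> set (u @ v)"
  shows "bef (u @ a # v) x a \<longleftrightarrow> x \<in> set u" "bef (u @ a # v) a x \<longleftrightarrow> x \<in> set v"
  using assms by (auto simp: bef_append dest: bef_in_set)

text \<open>Restricted to the placed nodes and \<open>a\<close>, a linear extension inserts
  \<open>a\<close> between some \<open>u\<close> and \<open>v\<close>; the relation of the step says
  on which side of \<open>a\<close> the node \<open>x\<close> lies.\<close>

lemma LE_step:
  assumes d: "distinct (p @ x # s @ map snd ((up, a) # st))"
  shows "xs \<in> LE p x s ((up, a) # st) \<longleftrightarrow>
    (\<exists>u v. u @ v = p @ x # s \<and> (x \<in> set u \<longleftrightarrow> up) \<and> xs \<in> LE u a v st)"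
proof
  let ?A = "set (p @ x # s)"
  have a: "a \<notin> ?A"
    using d by auto
  have x: "x \<in> ?A"
    by simp
  {
    assume "xs \<in> LE p x s ((up, a) # st)"
    then have f: "filter (\<lambda>y. y \<in> ?A) xs = p @ x # s" and b: "if up then bef xs x a else bef xs a x"
      and dx: "distinct xs" and sx: "set xs = ?A \<union> insert a (snd ` set st)" and r: "\<forall>(u, v)\<in>rels a st. bef xs u v"
      unfolding LE_def by (simp_all split: if_splits)
    have ax: "a \<in> set xs"
      using sx by simp
    obtain u v where uv: "filter (\<lambda>y. y \<in> insert a ?A) xs = u @ a # v" "p @ x # s = u @ v"
      using filter_insert_obtain[OF dx ax a f] by metis
    have ins: "set (u @ a # v) = insert a ?A"
      unfolding uv(2) by auto
    have duv: "distinct (u @ a # v)"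
      unfolding uv(1)[symmetric] using dx by (rule distinct_filter)
    have xuv: "x \<in> set (u @ v)"
      using x uv(2) by metis
    have "if up then bef (u @ a # v) x a else bef (u @ a # v) a x"
      using b x bef_filter[of "\<lambda>y. y \<in> insert a ?A"] unfolding uv(1)[symmetric] by simp
    then have "x \<in> set u \<longleftrightarrow> up"
      using bef_middle[OF duv xuv] duv xuv by (auto split: if_splits)
    moreover have "xs \<in> LE u a v st"
      unfolding LE_def ins using uv(1) dx sx r by auto
    ultimately show "\<exists>u v. u @ v = p @ x # s \<and> (x \<in> set u \<longleftrightarrow> up) \<and> xs \<in> LE u a v st"
      using uv(2) by metis
  }
  {
    assume "\<exists>u v. u @ v = p @ x # s \<and> (x \<in> set u \<longleftrightarrow> up) \<and> xs \<in> LE u a v st"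
    then obtain u v where uv: "u @ v = p @ x # s" "x \<in> set u \<longleftrightarrow> up" and xs: "xs \<in> LE u a v st"
      by blast
    have ins: "set (u @ a # v) = insert a ?A"
      unfolding uv(1)[symmetric] by auto
    have xuv: "x \<in> set (u @ v)"
      using x uv(1) by metis
    have f: "filter (\<lambda>y. y \<in> insert a ?A) xs = u @ a # v" and dx: "distinct xs"
      and sx: "set xs = insert a ?A \<union> snd ` set st" and r: "\<forall>(u, v)\<in>rels a st. bef xs u v"
      using xs unfolding LE_def ins by auto
    have auv: "a \<notin> set u" "a \<notin> set v" "set u \<subseteq> ?A" "set v \<subseteq> ?A"
      using a unfolding uv(1)[symmetric] by auto
    have f2: "filter (\<lambda>y. y \<in> ?A) xs = p @ x # s"
      using filter_filter_insert[OF a f auv] uv(1) by simp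
    have duv: "distinct (u @ a # v)"
      unfolding f[symmetric] using dx by (rule distinct_filter)
    have "if up then bef (u @ a # v) x a else bef (u @ a # v) a x"
      using bef_middle[OF duv xuv] uv(2) xuv by auto
    moreover have "bef (u @ a # v) x a \<longleftrightarrow> bef xs x a" "bef (u @ a # v) a x \<longleftrightarrow> bef xs a x"
      unfolding f[symmetric] by (rule bef_filter; simp)+
    ultimately have "if up then bef xs x a else bef xs a x"
      by (cases up) simp_all
    then show "xs \<in> LE p x s ((up, a) # st)"
      unfolding LE_def using f2 dx sx r by (auto split: if_splits)
  }
qed

lemma dec_eq_sum: "dec H w = (\<Sum>i\<le>length w. H (take i w) (drop i w))"
  by (induction w arbitrary: H) (simp_all add: sum.atMost_Suc_shift del: sum.atMost_Suc)

lemma LE_up: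
  assumes d: "distinct (p @ x # s @ map snd ((True, a) # st))"
  shows "LE p x s ((True, a) # st) = (\<Union>i\<in>{..length s}. LE (p @ x # take i s) a (drop i s) st)"
proof -
  have d': "distinct (p @ x # s)"
    using d by auto
  have "(\<exists>u v. u @ v = p @ x # s \<and> (x \<in> set u \<longleftrightarrow> True) \<and> Q u v) \<longleftrightarrow>
      (\<exists>i\<in>{..length s}. Q (p @ x # take i s) (drop i s))" for Q
  proof
    assume "\<exists>u v. u @ v = p @ x # s \<and> (x \<in> set u \<longleftrightarrow> True) \<and> Q u v"
    then obtain u v where uv: "u @ v = p @ x # s" "x \<in> set u" "Q u v"
      by blast
    obtain s1 s2 where "s = s1 @ s2" "u = p @ x # s1" "v = s2"
      using distinct_append_unique(1)[OF uv(1) d' uv(2)] by blast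
    then show "\<exists>i\<in>{..length s}. Q (p @ x # take i s) (drop i s)"
      using uv(3) by (intro bexI[of _ "length s1"]) auto
  next
    assume "\<exists>i\<in>{..length s}. Q (p @ x # take i s) (drop i s)"
    then obtain i where "Q (p @ x # take i s) (drop i s)" by blast
    then show "\<exists>u v. u @ v = p @ x # s \<and> (x \<in> set u \<longleftrightarrow> True) \<and> Q u v"
      by (intro exI[of _ "p @ x # take i s"] exI[of _ "drop i s"]) simp
  qed
  then show ?thesis
    by (intro set_eqI) (simp only: LE_step[OF d] UN_iff)
qed

lemma LE_down:
  assumes d: "distinct (p @ x # s @ map snd ((False, a) # st))"
  shows "LE p x s ((False, a) # st) = (\<Union>i\<in>{..length p}. LE (take i p) a (drop i p @ x # s) st)"
proof -
  have d': "distinct (p @ x # s)"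
    using d by auto
  have "(\<exists>u v. u @ v = p @ x # s \<and> (x \<in> set u \<longleftrightarrow> False) \<and> Q u v) \<longleftrightarrow>
      (\<exists>i\<in>{..length p}. Q (take i p) (drop i p @ x # s))" for Q
  proof
    assume "\<exists>u v. u @ v = p @ x # s \<and> (x \<in> set u \<longleftrightarrow> False) \<and> Q u v"
    then obtain u v where uv: "u @ v = p @ x # s" "x \<notin> set u" "Q u v"
      by blast
    have "x \<in> set (u @ v)"
      unfolding uv(1) by simp
    then have "x \<in> set v"
      using uv(2) by simp
    then obtain p1 p2 where "p = p1 @ p2" "u = p1" "v = p2 @ x # s"
      using distinct_append_unique(2)[OF uv(1) d'] by blast
    then show "\<exists>i\<in>{..length p}. Q (take i p) (drop i p @ x # s)"
      using uv(3) by (intro bexI[of _ "length p1"]) auto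
  next
    assume "\<exists>i\<in>{..length p}. Q (take i p) (drop i p @ x # s)"
    then obtain i where "Q (take i p) (drop i p @ x # s)" by blast
    then show "\<exists>u v. u @ v = p @ x # s \<and> (x \<in> set u \<longleftrightarrow> False) \<and> Q u v"
      using d' by (intro exI[of _ "take i p"] exI[of _ "drop i p @ x # s"]) (auto dest: in_set_takeD)
  qed
  then show ?thesis
    by (intro set_eqI) (simp only: LE_step[OF d] UN_iff)
qed

lemma LE_disjoint:
  assumes "u @ v = u' @ v'" "xs \<in> LE u a v st" "xs \<in> LE u' a v' st" "a \<notin> set (u @ v)"
  shows "u = u'"
proof -
  have "set (u' @ v') = set (u @ v)"
    by (simp only: assms(1))
  then have "set (u @ a # v) = insert a (set (u @ v))" "set (u' @ a # v') = insert a (set (u @ v))"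
    by auto
  then have "u @ a # v = u' @ a # v'"
    using assms(2,3) unfolding LE_def by simp
  then show ?thesis
    using assms(1,4) by (metis append_Cons_eq_iff in_set_conv_decomp set_append Un_iff)
qed

text \<open>In \<open>zig\<close> the label of a node decides whether the step to it goes up or
  down, whence the second assumption. Different places of insertion give disjoint sets by
  \<open>LE_disjoint\<close>.\<close>

lemma sum_LE_eq_zig:
  assumes "distinct (p @ x # s @ map snd st)" "\<forall>(up, y)\<in>set st. up \<longleftrightarrow> \<delta> y = E0"
  shows "(\<Sum>xs\<in>LE p x s st. f (map \<delta> xs)) = zig f (map \<delta> p) (\<delta> x) (map \<delta> s) (map (\<lambda>(_, y). \<delta> y) st)"
  using assms
proof (induction st arbitrary: p x s)
  case Nil
  then show ?case by (simp add: LE_Nil)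
next
  case (Cons y st)
  obtain up a where y: "y = (up, a)"
    by (cases y)
  have as: "a \<notin> set (p @ x # s)"
    using Cons.prems(1) y by auto
  show ?case
  proof (cases up)
    case True
    have "\<delta> a = E0"
      using Cons.prems(2) y True by simp
    have d: "distinct (p @ x # s @ map snd ((True, a) # st))"
      using Cons.prems(1) y True by simp
    have "(\<Sum>xs\<in>LE p x s ((True, a) # st). f (map \<delta> xs)) =
        (\<Sum>i\<le>length s. \<Sum>xs\<in>LE (p @ x # take i s) a (drop i s) st. f (map \<delta> xs))"
      unfolding LE_up[OF d]
    proof (rule sum.UNION_disjoint)
      show "\<forall>i\<in>{..length s}. \<forall>j\<in>{..length s}. i \<noteq> j \<longrightarrow>
          LE (p @ x # take i s) a (drop i s) st \<inter> LE (p @ x # take j s) a (drop j s) st = {}"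
      proof (intro ballI impI)
        fix i j assume ij: "i \<in> {..length s}" "j \<in> {..length s}" "i \<noteq> j"
        have "p @ x # take i s = p @ x # take j s" if "xs \<in> LE (p @ x # take i s) a (drop i s) st"
          "xs \<in> LE (p @ x # take j s) a (drop j s) st" for xs
          by (rule LE_disjoint[OF _ that]) (use as in simp_all)
        moreover have "take i s \<noteq> take j s"
          using ij by (metis atMost_iff length_take min.absorb2)
        ultimately show "LE (p @ x # take i s) a (drop i s) st \<inter> LE (p @ x # take j s) a (drop j s) st = {}"
          by auto
      qed
    qed (auto simp: finite_LE)
    also have "\<dots> = dec (\<lambda>s1 s2. \<Sum>xs\<in>LE (p @ x # s1) a s2 st. f (map \<delta> xs)) s"
      by (simp add: dec_eq_sum)
    also have "\<dots> = dec (\<lambda>s1 s2. zig f (map \<delta> (p @ x # s1)) E0 (map \<delta> s2) (map (\<lambda>(_, y). \<delta> y) st)) s"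
      by (rule dec_cong) (use Cons.IH[of "p @ x # _" a] Cons.prems \<open>\<delta> a = E0\<close> y in auto)
    finally show ?thesis
      using \<open>\<delta> a = E0\<close> True by (simp add: y dec_map)
  next
    case False
    have "\<delta> a = E1"
      using Cons.prems(2) y False by (cases "\<delta> a") auto
    have d: "distinct (p @ x # s @ map snd ((False, a) # st))"
      using Cons.prems(1) y False by simp
      have "(\<Sum>xs\<in>LE p x s ((False, a) # st). f (map \<delta> xs)) =
        (\<Sum>i\<le>length p. \<Sum>xs\<in>LE (take i p) a (drop i p @ x # s) st. f (map \<delta> xs))"
        unfolding LE_down[OF d]
      proof (rule sum.UNION_disjoint)
        show "\<forall>i\<in>{..length p}. \<forall>j\<in>{..length p}. i \<noteq> j \<longrightarrow>
            LE (take i p) a (drop i p @ x # s) st \<inter> LE (take j p) a (drop j p @ x # s) st = {}"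
        proof (intro ballI impI)
          fix i j assume ij: "i \<in> {..length p}" "j \<in> {..length p}" "i \<noteq> j"
          have "take i p = take j p" if "xs \<in> LE (take i p) a (drop i p @ x # s) st"
            "xs \<in> LE (take j p) a (drop j p @ x # s) st" for xs
            by (rule LE_disjoint[OF _ that]) (use as in \<open>simp_all flip: append_assoc\<close>)
          moreover have "take i p \<noteq> take j p"
            using ij by (metis atMost_iff length_take min.absorb2)
          ultimately show "LE (take i p) a (drop i p @ x # s) st \<inter> LE (take j p) a (drop j p @ x # s) st = {}"
            by auto
        qed
      qed (auto simp: finite_LE)
    also have "\<dots> = dec (\<lambda>p1 p2. \<Sum>xs\<in>LE p1 a (p2 @ x # s) st. f (map \<delta> xs)) p"
      by (simp add: dec_eq_sum)
    also have "\<dots> = dec (\<lambda>p1 p2. zig f (map \<delta> p1) E1 (map \<delta> (p2 @ x # s)) (map (\<lambda>(_, y). \<delta> y) st)) p"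
      by (rule dec_cong) (use Cons.IH[of _ a "_ @ x # s"] Cons.prems \<open>\<delta> a = E1\<close> y in auto)
    finally show ?thesis
      using \<open>\<delta> a = E1\<close> False by (simp add: y dec_map)
  qed
qed


lemma rels_append: "rels x (st1 @ st2) = rels x st1 \<union> rels (last (x # map snd st1)) st2"
  by (induction st1 arbitrary: x) auto

lemma rels_upt:
  "rels (F m) (map (\<lambda>t. (True, F t)) [Suc m..<n]) = {(F t, F (Suc t)) | t. m \<le> t \<and> Suc t < n}"
proof (induction n)
  case (Suc n)
  show ?case
  proof (cases "Suc m \<le> n")
    case True
    have last: "last (F m # map (snd \<circ> (\<lambda>t. (True, F t))) [Suc m..<n]) = F (n - 1)"
      using True by (cases "Suc m = n") (auto simp: last_map o_def)
    have "rels (F m) (map (\<lambda>t. (True, F t)) [Suc m..<Suc n]) =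
        {(F t, F (Suc t)) | t. m \<le> t \<and> Suc t < n} \<union> {(F (n - 1), F n)}"
      using True Suc last by (simp add: rels_append)
    also have "\<dots> = {(F t, F (Suc t)) | t. m \<le> t \<and> Suc t < Suc n}"
    proof (intro equalityI subsetI)
      fix z assume "z \<in> {(F t, F (Suc t)) | t. m \<le> t \<and> Suc t < n} \<union> {(F (n - 1), F n)}"
      moreover have "(F (n - 1), F n) \<in> {(F t, F (Suc t)) | t. m \<le> t \<and> Suc t < Suc n}"
        using True by (auto intro!: exI[of _ "n - 1"])
      ultimately show "z \<in> {(F t, F (Suc t)) | t. m \<le> t \<and> Suc t < Suc n}"
        by auto
    next
      fix z assume "z \<in> {(F t, F (Suc t)) | t. m \<le> t \<and> Suc t < Suc n}"
      then obtain t where t: "z = (F t, F (Suc t))" "m \<le> t" "Suc t < Suc n"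
        by auto
      then show "z \<in> {(F t, F (Suc t)) | t. m \<le> t \<and> Suc t < n} \<union> {(F (n - 1), F n)}"
        by (cases "Suc t = n") auto
    qed
    finally show ?thesis .
  next
    case False
    then show ?thesis by auto
  qed
qed simp

text \<open>The path through the nodes b, starting at the bottom of the last row: up the row, then
  down to the first node of the preceding row. Rows are listed from the last one, so that
  \<open>Suc (length R)\<close> numbers the current row; the lowered entry \<open>a\<close> means a
  + 1 nodes.\<close>

fun b_steps :: "nat list \<Rightarrow> (bool \<times> node) list" where
  "b_steps [] = []"
| "b_steps (a # R) = map (\<lambda>i. (True, NodeB (Suc (length R)) i)) [Suc 1..<a + 2] @
     (if R = [] then [] else (False, NodeB (length R) 1) # b_steps R)"

lemma b_steps_map_snd:
  "map snd (b_steps (a # R)) = map (NodeB (Suc (length R))) [Suc 1..<a + 2] @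
     (if R = [] then [] else NodeB (length R) 1 # map snd (b_steps R))"
  by (simp add: o_def del: upt_Suc)

lemma ex_nth_rev_Cons:
  "(\<exists>j. 1 \<le> j \<and> j \<le> length (a # R) \<and> Q j (rev (a # R) ! (j - 1))) \<longleftrightarrow>
   Q (Suc (length R)) a \<or> (\<exists>j. 1 \<le> j \<and> j \<le> length R \<and> Q j (rev R ! (j - 1)))"
proof -
  have "rev (a # R) ! (j - 1) = rev R ! (j - 1)" if "1 \<le> j" "j \<le> length R" for j
  proof -
    have "j - 1 < length R"
      using that by simp
    then show ?thesis by (simp add: nth_append)
  qed
  moreover have "rev (a # R) ! (Suc (length R) - 1) = a"
    by (simp add: nth_append)
  ultimately show ?thesis
    by (metis le_Suc_eq length_Cons le_add1 plus_1_eq_Suc)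
qed

lemma b_steps_nodes:
  assumes "R \<noteq> []"
  shows "insert (NodeB (length R) 1) (snd ` set (b_steps R)) =
    {NodeB j i | j i. 1 \<le> j \<and> j \<le> length R \<and> 1 \<le> i \<and> i \<le> Suc (rev R ! (j - 1))}"
  using assms
proof (induction R)
  case (Cons a R)
  have "insert (NodeB (length (a # R)) 1) (snd ` set (b_steps (a # R))) =
     {NodeB (Suc (length R)) i | i. 1 \<le> i \<and> i \<le> Suc a} \<union>
     (if R = [] then {} else insert (NodeB (length R) 1) (snd ` set (b_steps R)))"
  proof -
    have "insert (NodeB m 1) (NodeB m ` {Suc 1..<a + 2}) = {NodeB m i | i. 1 \<le> i \<and> i \<le> Suc a}" for m
      by (auto simp: image_iff)
    then show ?thesis
      unfolding set_map[symmetric] b_steps_map_snd by auto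
  qed
  also have "\<dots> = {NodeB (Suc (length R)) i | i. 1 \<le> i \<and> i \<le> Suc a} \<union>
     {NodeB j i | j i. 1 \<le> j \<and> j \<le> length R \<and> 1 \<le> i \<and> i \<le> Suc (rev R ! (j - 1))}"
    using Cons.IH by auto
  also have "\<dots> = {NodeB j i | j i. 1 \<le> j \<and> j \<le> length (a # R) \<and> 1 \<le> i \<and> i \<le> Suc (rev (a # R) ! (j - 1))}"
  proof (rule set_eqI)
    fix z
    have "z \<in> {NodeB j i | j i. 1 \<le> j \<and> j \<le> length (a # R) \<and> 1 \<le> i \<and> i \<le> Suc (rev (a # R) ! (j - 1))} \<longleftrightarrow>
      (\<exists>j. 1 \<le> j \<and> j \<le> length (a # R) \<and> (\<exists>i. z = NodeB j i \<and> 1 \<le> i \<and> i \<le> Suc (rev (a # R) ! (j - 1))))"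
      by blast
    then show "z \<in> {NodeB (Suc (length R)) i | i. 1 \<le> i \<and> i \<le> Suc a} \<union>
       {NodeB j i | j i. 1 \<le> j \<and> j \<le> length R \<and> 1 \<le> i \<and> i \<le> Suc (rev R ! (j - 1))} \<longleftrightarrow>
      z \<in> {NodeB j i | j i. 1 \<le> j \<and> j \<le> length (a # R) \<and> 1 \<le> i \<and> i \<le> Suc (rev (a # R) ! (j - 1))}"
      unfolding ex_nth_rev_Cons[of a R "\<lambda>j m. \<exists>i. z = NodeB j i \<and> 1 \<le> i \<and> i \<le> Suc m"] by blast
  qed
  finally show ?case .
qed simp

lemma b_steps_distinct: "R \<noteq> [] \<Longrightarrow> distinct (NodeB (length R) 1 # map snd (b_steps R))"
proof (induction R)
  case (Cons a R)
  have "j \<le> length R" if "NodeB j i \<in> insert (NodeB (length R) 1) (snd ` set (b_steps R))" "R \<noteq> []" for i j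
    using that(1) unfolding b_steps_nodes[OF that(2)] by auto
  then have "NodeB (Suc (length R)) i \<notin> snd ` set (b_steps R)" if "R \<noteq> []" for i
    using that by (meson insertI2 not_less_eq_eq order_refl)
  then have "(b, NodeB (Suc (length R)) i) \<notin> set (b_steps R)" if "R \<noteq> []" for b i
    using that by force
  then show ?case
    unfolding b_steps_map_snd using Cons.IH by (auto simp: distinct_map inj_on_def simp del: upt_Suc)
qed simp

lemma b_steps_rels:
  assumes "R \<noteq> []"
  shows "rels (NodeB (length R) 1) (b_steps R) =
    {(NodeB j i, NodeB j (i + 1)) | j i. 1 \<le> j \<and> j \<le> length R \<and> 1 \<le> i \<and> i < Suc (rev R ! (j - 1))} \<union>
    {(NodeB (j - 1) 1, NodeB j (Suc (rev R ! (j - 1)))) | j. 2 \<le> j \<and> j \<le> length R}"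
  using assms
proof (induction R)
  case (Cons a R)
  let ?n = "Suc (length R)"
  let ?B = "\<lambda>R. {(NodeB j i, NodeB j (i + 1)) | j i. 1 \<le> j \<and> j \<le> length R \<and> 1 \<le> i \<and> i < Suc (rev R ! (j - 1))}"
  let ?D = "\<lambda>R. {(NodeB (j - 1) 1, NodeB j (Suc (rev R ! (j - 1)))) | j. 2 \<le> j \<and> j \<le> length R}"
  have last: "last (NodeB ?n 1 # map (snd \<circ> (\<lambda>i. (True, NodeB ?n i))) [Suc 1..<a + 2]) = NodeB ?n (Suc a)"
    by (cases a) (auto simp: o_def last_map)
  have B: "?B (a # R) = {(NodeB ?n i, NodeB ?n (Suc i)) | i. 1 \<le> i \<and> Suc i < a + 2} \<union> ?B R"
  proof (rule set_eqI)
    fix z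
    have "z \<in> ?B (a # R) \<longleftrightarrow> (\<exists>j. 1 \<le> j \<and> j \<le> length (a # R) \<and>
        (\<exists>i. z = (NodeB j i, NodeB j (i + 1)) \<and> 1 \<le> i \<and> i < Suc (rev (a # R) ! (j - 1))))"
      by blast
    then show "z \<in> ?B (a # R) \<longleftrightarrow> z \<in> {(NodeB ?n i, NodeB ?n (Suc i)) | i. 1 \<le> i \<and> Suc i < a + 2} \<union> ?B R"
      unfolding ex_nth_rev_Cons[of a R "\<lambda>j m. \<exists>i. z = (NodeB j i, NodeB j (i + 1)) \<and> 1 \<le> i \<and> i < Suc m"]
      by (simp del: rev.simps) blast
  qed
  have D: "?D (a # R) = (if R = [] then {} else {(NodeB (length R) 1, NodeB ?n (Suc a))}) \<union> ?D R"
  proof (rule set_eqI)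
    fix z
    have two: "2 \<le> j \<longleftrightarrow> 1 \<le> j \<and> 2 \<le> j" for j :: nat
      by auto
    have "z \<in> ?D (a # R) \<longleftrightarrow> (\<exists>j. 1 \<le> j \<and> j \<le> length (a # R) \<and>
        (z = (NodeB (j - 1) 1, NodeB j (Suc (rev (a # R) ! (j - 1)))) \<and> 2 \<le> j))"
      unfolding mem_Collect_eq by (subst two) blast
    moreover have "z \<in> ?D R \<longleftrightarrow> (\<exists>j. 1 \<le> j \<and> j \<le> length R \<and>
        (z = (NodeB (j - 1) 1, NodeB j (Suc (rev R ! (j - 1)))) \<and> 2 \<le> j))"
      unfolding mem_Collect_eq by (subst two) blast
    moreover have "2 \<le> Suc (length R) \<longleftrightarrow> R \<noteq> []"
      by (cases R) auto
    ultimately show "z \<in> ?D (a # R) \<longleftrightarrow> z \<in> (if R = [] then {} else {(NodeB (length R) 1, NodeB ?n (Suc a))}) \<union> ?D R"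
      unfolding ex_nth_rev_Cons[of a R "\<lambda>j m. z = (NodeB (j - 1) 1, NodeB j (Suc m)) \<and> 2 \<le> j"]
      by (simp only: Un_iff diff_Suc_1) (cases "R = []"; simp)
  qed
  have "rels (NodeB ?n 1) (b_steps (a # R)) = {(NodeB ?n i, NodeB ?n (Suc i)) | i. 1 \<le> i \<and> Suc i < a + 2} \<union>
     (if R = [] then {} else insert (NodeB (length R) 1, NodeB ?n (Suc a)) (rels (NodeB (length R) 1) (b_steps R)))"
    unfolding b_steps.simps rels_append rels_upt[of "NodeB ?n" 1 "a + 2"] map_map last by simp
  then show ?case
    unfolding B D using Cons.IH by (cases "R = []") (auto simp del: b_steps.simps)
qed simp

text \<open>An upward step from the topmost node leaves only one position, so a chain at the
  beginning of a path merely becomes part of the initial state.\<close>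

lemma LE_chain:
  assumes "distinct (p @ x # ys @ map snd st)"
  shows "LE p x [] (map (Pair True) ys @ st) = LE (butlast (p @ x # ys)) (last (x # ys)) [] st"
  using assms
proof (induction ys arbitrary: p x)
  case (Cons y ys)
  have "LE p x [] ((True, y) # (map (Pair True) ys @ st)) =
      (\<Union>i\<in>{..length ([] :: 'a list)}. LE (p @ x # take i []) y (drop i []) (map (Pair True) ys @ st))"
    by (rule LE_up) (use Cons.prems in \<open>simp add: o_def\<close>)
  also have "\<dots> = LE (p @ [x]) y [] (map (Pair True) ys @ st)"
    by simp
  also have "\<dots> = LE (butlast ((p @ [x]) @ y # ys)) (last (y # ys)) [] st"
    by (rule Cons.IH) (use Cons.prems in auto)
  finally show ?case
    by simp
qed (simp add: butlast_append)

lemma filter_eq_singleton: "distinct xs \<Longrightarrow> x \<in> set xs \<Longrightarrow> filter (\<lambda>y. y = x) xs = [x]"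
  by (induction xs) (auto simp: filter_empty_conv)

text \<open>The poset is a single path: the chain of the nodes a, the bottom node of the last row
  with its label \<open>E0\<close>, and \<open>b_steps\<close>. The chain up to that node serves as
  the initial state.\<close>

lemma ev_mu:
  assumes k: "k \<noteq> []"
  shows "ev f (mu (map Suc k) (map Suc (rev (a # L)))) = zig f (iw k) E0 [] (replicate a E0 @ iw L)"
proof -
  let ?ks = "map Suc k" and ?R = "a # L" and ?ls = "map Suc (rev (a # L))"
  let ?n = "Suc (length L)" and ?K = "sum_list (map Suc k)"
  define \<delta> where "\<delta> = mu_label ?ks ?ls"
  have K: "length (iw k) = ?K"
    using length_index_word[of ?ks] by (simp add: is_index_def index_word_Suc)
  have "1 \<le> ?K"
    using k by (cases k) auto
  define ys where "ys = map NodeA [Suc 1..<Suc ?K] @ [NodeB ?n 1]"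
  have A: "NodeA 1 # map NodeA [Suc 1..<Suc ?K] = map NodeA [1..<Suc ?K]"
    using \<open>1 \<le> ?K\<close> by (simp add: upt_conv_Cons)
  have st_split: "map (Pair True) ys @ b_steps ?R =
      map (\<lambda>t. (True, NodeA t)) [Suc 1..<Suc ?K] @ (True, NodeB ?n 1) # b_steps ?R"
    by (simp add: ys_def)
  have len: "length ?ls = ?n"
    by simp
  have nth: "?ls ! (j - 1) = Suc (rev ?R ! (j - 1))" if "1 \<le> j" "j \<le> ?n" for j
    using that by (subst nth_map) auto
  have carrier: "mu_carrier ?ks ?ls = insert (NodeA 1) (snd ` set (map (Pair True) ys @ b_steps ?R))"
  proof -
    have "insert (NodeA 1) (snd ` set (map (Pair True) ys @ b_steps ?R)) =
       set (NodeA 1 # map NodeA [Suc 1..<Suc ?K]) \<union> insert (NodeB (length ?R) 1) (snd ` set (b_steps ?R))"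
      unfolding set_map[symmetric] map_append map_map o_def snd_conv map_ident ys_def
      by (simp add: insert_commute Un_assoc del: b_steps.simps upt_Suc)
    also have "\<dots> = {NodeA t | t. 1 \<le> t \<and> t \<le> ?K} \<union>
       {NodeB j i | j i. 1 \<le> j \<and> j \<le> length ?R \<and> 1 \<le> i \<and> i \<le> Suc (rev ?R ! (j - 1))}"
      unfolding A b_steps_nodes[of ?R, OF list.distinct(2)] by auto
    also have "\<dots> = mu_carrier ?ks ?ls"
      unfolding mu_carrier_def len using nth by (intro arg_cong2[of _ _ _ _ "(\<union>)"]) (auto; metis)+
    finally show ?thesis ..
  qed
  have gens: "mu_generators ?ks ?ls = rels (NodeA 1) (map (Pair True) ys @ b_steps ?R)"
  proof -
    have last: "last (NodeA 1 # map (snd \<circ> (\<lambda>t. (True, NodeA t))) [Suc 1..<Suc ?K]) = NodeA ?K"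
      using \<open>1 \<le> ?K\<close> A by (simp add: o_def del: upt_Suc) (metis Zero_not_Suc diff_Suc_1 last_map last_upt le_imp_less_Suc list.map_disc_iff list.simps(3) upt_eq_Nil_conv)
    have "rels (NodeA 1) (map (Pair True) ys @ b_steps ?R) =
       {(NodeA t, NodeA (Suc t)) | t. 1 \<le> t \<and> Suc t < Suc ?K} \<union> insert (NodeA ?K, NodeB ?n 1) (rels (NodeB (length ?R) 1) (b_steps ?R))"
      unfolding st_split rels_append rels_upt[of NodeA 1] map_map last by simp
    moreover have "{(NodeB j i, NodeB j (i + 1)) | j i. 1 \<le> j \<and> j \<le> ?n \<and> 1 \<le> i \<and> i < ?ls ! (j - 1)} =
       {(NodeB j i, NodeB j (i + 1)) | j i. 1 \<le> j \<and> j \<le> ?n \<and> 1 \<le> i \<and> i < Suc (rev ?R ! (j - 1))}"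
      by (intro Collect_cong ex_cong1 conj_cong refl) (simp only: nth)
    moreover have "{(NodeB (j - 1) 1, NodeB j (?ls ! (j - 1))) | j. 2 \<le> j \<and> j \<le> ?n} =
       {(NodeB (j - 1) 1, NodeB j (Suc (rev ?R ! (j - 1)))) | j. 2 \<le> j \<and> j \<le> ?n}"
      using nth by (intro Collect_cong ex_cong1) (metis le_trans one_le_numeral)
    moreover have "{(NodeA t, NodeA (t + 1)) | t. 1 \<le> t \<and> t < ?K} = {(NodeA t, NodeA (Suc t)) | t. 1 \<le> t \<and> Suc t < Suc ?K}"
      by simp
    ultimately show ?thesis
      unfolding b_steps_rels[of ?R, OF list.distinct(2)] mu_generators_def len
      by (simp only: length_Cons) blast
  qed
  have d: "distinct (NodeA 1 # ys @ map snd (b_steps ?R))"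
  proof -
    have "NodeA t \<notin> insert (NodeB (length ?R) 1) (snd ` set (b_steps ?R))" for t
      unfolding b_steps_nodes[of ?R, OF list.distinct(2)] by auto
    moreover have "NodeA 1 # ys @ map snd (b_steps ?R) = map NodeA [1..<Suc ?K] @ NodeB ?n 1 # map snd (b_steps ?R)"
      unfolding A[symmetric] ys_def by simp
    ultimately have "(b, NodeA t) \<notin> set (b_steps ?R)" for b t
      by force
    then show ?thesis
      unfolding \<open>NodeA 1 # ys @ map snd (b_steps ?R) = _\<close>
      using b_steps_distinct[of ?R] by (auto simp: distinct_map inj_on_def simp del: b_steps.simps upt_Suc)
  qed
  have rel_nodes: "u \<in> insert x (snd ` set st) \<and> v \<in> insert x (snd ` set st) \<and> u \<noteq> v"
    if "(u, v) \<in> rels x st" "distinct (x # map snd st)" for u v x and st :: "(bool \<times> node) list"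
    using that by (induction st arbitrary: x) (force split: if_splits)+
  have "linear_extensions (mu_carrier ?ks ?ls) ((mu_generators ?ks ?ls)\<^sup>*) =
      LE [] (NodeA 1) [] (map (Pair True) ys @ b_steps ?R)"
    unfolding carrier gens
    by (subst linear_extensions_rtrancl)
       (use rel_nodes[of _ _ "NodeA 1" "map (Pair True) ys @ b_steps ?R"] d in
         \<open>auto simp: LE_def filter_eq_singleton o_def simp del: b_steps.simps\<close>)
  also have "\<dots> = LE (butlast ([] @ NodeA 1 # ys)) (last (NodeA 1 # ys)) [] (b_steps ?R)"
    by (rule LE_chain) (use d in simp)
  also have "\<dots> = LE (map NodeA [1..<Suc ?K]) (NodeB ?n 1) [] (b_steps ?R)"
    unfolding A[symmetric] by (simp add: ys_def butlast_append)
  finally have le: "linear_extensions (mu_carrier ?ks ?ls) ((mu_generators ?ks ?ls)\<^sup>*) =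
      LE (map NodeA [1..<Suc ?K]) (NodeB ?n 1) [] (b_steps ?R)" .
  have block: "map (\<lambda>x. if x = Suc 0 \<and> P then E1 else E0) [Suc (Suc 0)..<Suc (Suc b)] = replicate b E0" for P b
    by (rule replicate_eqI) auto
  have block': "map (\<lambda>x. if x = Suc 0 then E1 else E0) [Suc (Suc 0)..<Suc (Suc b)] = replicate b E0" for b
    by (rule replicate_eqI) auto
  \<comment> \<open>Downward steps lead exactly to the bottom nodes of the rows other than the last,
    the ones labelled \<open>E1\<close>. The start of the path is not reached by a step, hence
    \<open>tl\<close>.\<close>
  have labels: "(\<forall>(up, y)\<in>set (b_steps R). up \<longleftrightarrow> \<delta> y = E0) \<and>
      map (\<lambda>(_, y). \<delta> y) (b_steps R) = tl (iw R)" if "length R \<le> ?n" for R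
    using that
  proof (induction R)
    case (Cons b R)
    then show ?case
      by (cases R) (auto simp: \<delta>_def o_def block block' simp del: upt_Suc)
  qed simp
  have "map \<delta> (map NodeA [1..<Suc ?K]) = iw k"
  proof (rule nth_equalityI)
    fix i assume "i < length (map \<delta> (map NodeA [1..<Suc ?K]))"
    then have i: "i < ?K"
      by (simp del: upt_Suc)
    have "map \<delta> (map NodeA [1..<Suc ?K]) ! i = E1 \<longleftrightarrow> iw k ! i = E1"
      using index_word_nth[of ?ks i] i
      by (auto simp: \<delta>_def is_index_def index_word_Suc simp del: upt_Suc)
    then show "map \<delta> (map NodeA [1..<Suc ?K]) ! i = iw k ! i"
      by (metis letter.exhaust)
  qed (simp add: K del: upt_Suc)
  moreover have "\<delta> (NodeB ?n 1) = E0"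
    by (simp add: \<delta>_def)
  moreover have "(\<Sum>xs\<in>LE (map NodeA [1..<Suc ?K]) (NodeB ?n 1) [] (b_steps ?R). f (map \<delta> xs)) =
      zig f (map \<delta> (map NodeA [1..<Suc ?K])) (\<delta> (NodeB ?n 1)) (map \<delta> []) (map (\<lambda>(_, y). \<delta> y) (b_steps ?R))"
  proof (rule sum_LE_eq_zig)
    show "distinct (map NodeA [1..<Suc ?K] @ NodeB ?n 1 # [] @ map snd (b_steps ?R))"
      using d unfolding A[symmetric] ys_def by simp
    show "\<forall>(up, y)\<in>set (b_steps ?R). up \<longleftrightarrow> \<delta> y = E0"
      using labels[of ?R] by simp
  qed
  moreover have "map (\<lambda>(_, y). \<delta> y) (b_steps ?R) = replicate a E0 @ iw L"
    using labels[of ?R] by simp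
  ultimately show ?thesis
    by (simp only: mu_def W_def le ev_sum ev_word \<delta>_def[symmetric] list.map)
qed

section \<open>Regularization and the integral-series identity\<close>

lemma zig_cong_admissible:
  assumes "\<And>v. admissible_word v \<Longrightarrow> f v = h v" "hd (p @ x # s) = E1" "last (p @ x # s) = E0"
  shows "zig f p x s w = zig h p x s w"
proof (rule zig_cong[where P = "\<lambda>v. v \<noteq> [] \<and> hd v = E1 \<and> last v = E0"])
  show "p1 @ E1 # p2 @ x # s \<noteq> [] \<and> hd (p1 @ E1 # p2 @ x # s) = E1 \<and> last (p1 @ E1 # p2 @ x # s) = E0"
    if "p1 @ p2 @ x # s \<noteq> [] \<and> hd (p1 @ p2 @ x # s) = E1 \<and> last (p1 @ p2 @ x # s) = E0" for p1 p2 x s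
    using that by (cases p1) auto
  show "p @ x # s1 @ E0 # s2 \<noteq> [] \<and> hd (p @ x # s1 @ E0 # s2) = E1 \<and> last (p @ x # s1 @ E0 # s2) = E0"
    if "p @ x # s1 @ s2 \<noteq> [] \<and> hd (p @ x # s1 @ s2) = E1 \<and> last (p @ x # s1 @ s2) = E0" for p x s1 s2
    using that by (cases p; cases "s2 = []") auto
qed (use assms in \<open>auto simp: admissible_word_def\<close>)

lemma hd_iw: "k \<noteq> [] \<Longrightarrow> hd (iw k @ w) = E1"
  by (cases k) auto

lemma mu_H0: "k \<noteq> [] \<Longrightarrow> mu (map Suc k) (map Suc (rev (a # L))) \<in> H0"
  unfolding H0_iff keys_subset_iff_ev
proof (intro allI impI)
  fix f :: "letter list \<Rightarrow> real" assume k: "k \<noteq> []" and f: "\<forall>w\<in>Collect admissible_word. f w = 0"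
  have "zig f (iw k) E0 [] w = zig (\<lambda>_. 0) (iw k) E0 [] w" for w
    by (rule zig_cong_admissible) (use f k hd_iw in auto)
  then show "ev f (mu (map Suc k) (map Suc (rev (a # L)))) = 0"
    unfolding ev_mu[OF k] using zig_mult[of 0 "\<lambda>_. 0"] by simp
qed

lemma sided_zig_mu:
  assumes hom: "\<And>u v. H1_word u \<Longrightarrow> H1_word v \<Longrightarrow> sh f u v = f u * f v" and unit: "f [] = 1"
  shows "zig f (iw (c @ [b])) E0 [] (replicate a E0 @ iw L) =
    conv (alt (\<lambda>p. f (iw (c @ Suc (b + a) # p)))) (zig_star f) L"
proof -
  have ne: "iw (c @ [b]) = E1 # tl (iw (c @ [b]))"
    by (cases c) auto
  \<comment> \<open>The letter \<open>E0\<close> of the bottom node of the last row joins the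
    \<open>b\<close> letters \<open>E0\<close> before it and the \<open>a\<close> letters behind it
    to a single entry \<open>Suc (b + a)\<close>.\<close>
  have w: "E1 # (tl (iw (c @ [b])) @ [E0]) @ replicate a E0 @ iw p = iw (c @ Suc (b + a) # p)" for p
  proof -
    have "E1 # (tl (iw (c @ [b])) @ [E0]) @ replicate a E0 @ iw p = iw (c @ [b]) @ [E0] @ replicate a E0 @ iw p"
      by (subst ne) simp
    then show ?thesis
      by (simp add: replicate_add replicate_app_Cons_same)
  qed
  have "zig f (iw (c @ [b])) E0 [] (replicate a E0 @ iw L) =
      sided_zig f (tl (iw (c @ [b])) @ [E0]) [] (replicate a E0 @ iw L)"
    by (simp only: sided_zig_snoc dec.simps qsh_Nil2 ne[symmetric])
  also have "\<dots> = conv (alt (\<lambda>p. f (iw (c @ Suc (b + a) # p)))) (zig_star f) L"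
    using sided_zig_iw[OF assms, of "tl (iw (c @ [b])) @ [E0]" "[]" a L] by (simp only: alt_def qsh_Nil2 w)
  finally show ?thesis .
qed

lemma conv_ones_append:
  "conv f (ones a) (c @ Suc b # p) = conv (\<lambda>x. f (c @ Suc b # x)) (ones a) p"
  by (simp add: dec_append_Cons)

text \<open>As \<open>alt\<close> respects convolution, \<open>alt \<phi>\<close> convolved with the
  left side is \<open>alt \<psi>\<close> convolved with \<open>\<sigma>'\<close>, which is the unit;
  so the left side and \<open>\<sigma>\<close> are inverse to the same functional. In the converse
  implication \<open>P\<close> singles out the indices (1, ..., 1), where alone \<open>reg\<close>
  is known beforehand.\<close>

lemma star_regularized:
  assumes sub: "\<And>x y. P (x @ y) \<Longrightarrow> P x \<and> P y"
    and unit: "\<phi> [] = 1"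
    and inv: "\<And>w. P w \<Longrightarrow> conv (alt \<phi>) \<sigma> w = (if w = [] then 1 else 0)"
    and inv': "\<And>w. P w \<Longrightarrow> conv (alt \<psi>) \<sigma>' w = (if w = [] then 1 else 0)"
    and reg: "\<And>w. P w \<Longrightarrow> \<psi> w = conv \<phi> \<kappa> w"
    and "P w"
  shows "conv (alt \<kappa>) \<sigma>' w = \<sigma> w"
proof (rule conv_left_cancel[where P = P and f = "alt \<phi>", OF _ _ _ \<open>P w\<close>])
  show "P y" if "P (x @ y)" for x y
    using sub[OF that] ..
  show "alt \<phi> [] = 1"
    by (simp add: unit)
  show "conv (alt \<phi>) (conv (alt \<kappa>) \<sigma>') w = conv (alt \<phi>) \<sigma> w" if "P w" for w
  proof -
    have "conv (alt \<phi>) (conv (alt \<kappa>) \<sigma>') w = conv (conv (alt \<phi>) (alt \<kappa>)) \<sigma>' w"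
      by (rule conv_assoc[symmetric])
    also have "\<dots> = conv (alt \<psi>) \<sigma>' w"
    proof (rule dec_cong)
      fix x y assume "w = x @ y"
      then have "P x"
        using sub that by blast
      then have "alt \<psi> x = alt (conv \<phi> \<kappa>) x"
        by (simp add: alt_def reg)
      then show "conv (alt \<phi>) (alt \<kappa>) x * \<sigma>' y = alt \<psi> x * \<sigma>' y"
        by (simp only: alt_conv)
    qed
    finally show ?thesis
      by (simp only: inv[OF that] inv'[OF that])
  qed
qed

lemma deriv_A_series:
  "fps_deriv (A_series Z) = A_series Z * fps_deriv (Abs_fps (\<lambda>n. if 2 \<le> n then (-1) ^ n / of_nat n * Z (idx [n]) else 0))"
  unfolding A_series_def by (subst fps_compose_deriv) simp_all

lemma A_series_0: "fps_nth (A_series Z) 0 = 1"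
  by (simp add: A_series_def)

context double_shuffle_map
begin

text \<open>Only admissible indices occur on the left, so \<open>Z\<close> may be replaced by its
  regularization at any \<open>t\<close>; the cut then produces factors that depend on
  \<open>t\<close> individually. The same holds for \<open>Z_mu\<close>.\<close>

lemma Z_circ:
  "Z (circ_ast (word (iw (c @ [b]))) (star (word (iw (rev (a # L)))))) =
   conv (alt (\<lambda>p. reg_hr Z t (c @ Suc (b + a) # p))) (star_val (reg_hr Z t)) L"
proof -
  have "Z (circ_ast (word (iw (c @ [b]))) (star (word (iw (rev (a # L)))))) =
      circ_star (\<lambda>k. Z (word (iw k))) c (Suc (b + a)) L"
    by (simp only: Z_eq_ev[OF circ_star_H0] ev_circ_star)
  also have "\<dots> = circ_star (reg_hr Z t) c (Suc (b + a)) L"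
    by (rule circ_star_cong) (simp add: reg_hr_admissible)
  finally show ?thesis
    by (simp only: circ_star_hom[OF reg_hr_hom reg_hr_Nil] alt_def)
qed

lemma Z_mu:
  "Z (mu (map Suc (c @ [b])) (map Suc (rev (a # L)))) =
   conv (alt (\<lambda>p. reg_sh Z t (iw (c @ Suc (b + a) # p)))) (zig_star (reg_sh Z t)) L"
proof -
  have ne: "c @ [b] \<noteq> []"
    by simp
  have "Z (mu (map Suc (c @ [b])) (map Suc (rev (a # L)))) =
      zig (\<lambda>w. Z (word w)) (iw (c @ [b])) E0 [] (replicate a E0 @ iw L)"
    by (simp only: Z_eq_ev[OF mu_H0[OF ne]] ev_mu[OF ne])
  also have "\<dots> = zig (reg_sh Z t) (iw (c @ [b])) E0 [] (replicate a E0 @ iw L)"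
    by (rule zig_cong_admissible) (rule reg_sh_admissible[symmetric], assumption, rule hd_iw[OF ne], simp)
  finally show ?thesis
    by (simp only: sided_zig_mu[OF reg_sh_hom reg_sh_Nil])
qed

lemma regularization_iff:
  "regularization Z \<longleftrightarrow> (\<forall>t k. reg_sh Z t (iw k) = conv (reg_hr Z t) (ones (fps_nth (A_series Z))) k)"
proof
  assume r: "regularization Z"
  show "\<forall>t k. reg_sh Z t (iw k) = conv (reg_hr Z t) (ones (fps_nth (A_series Z))) k"
  proof (intro allI)
    fix t k
    have "Z_shuffle Z (word (iw k)) = rho Z (Z_harmonic Z (word (iw k)))"
      using r[unfolded regularization_def, rule_format, of "map Suc k"] by (simp add: is_index_def idx_Suc)
    then show "reg_sh Z t (iw k) = conv (reg_hr Z t) (ones (fps_nth (A_series Z))) k"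
      by (simp only: reg_sh_def poly_rho_Z_harmonic)
  qed
next
  assume *: "\<forall>t k. reg_sh Z t (iw k) = conv (reg_hr Z t) (ones (fps_nth (A_series Z))) k"
  show "regularization Z"
    unfolding regularization_def
  proof (intro allI impI)
    fix ks assume "is_index ks"
    then obtain k where "ks = map Suc k"
      by (rule is_index_obtain)
    then show "Z_shuffle Z (idx ks) = rho Z (Z_harmonic Z (idx ks))"
      using * by (intro poly_eqI2) (simp add: idx_Suc poly_rho_Z_harmonic reg_sh_def)
  qed
qed

lemma integral_series_iff:
  "integral_series_identity Z \<longleftrightarrow> (\<forall>c b a L. Z (mu (map Suc (c @ [b])) (map Suc (rev (a # L)))) =
     Z (circ_ast (word (iw (c @ [b]))) (star (word (iw (rev (a # L)))))))"
proof
  assume i: "integral_series_identity Z"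
  show "\<forall>c b a L. Z (mu (map Suc (c @ [b])) (map Suc (rev (a # L)))) =
     Z (circ_ast (word (iw (c @ [b]))) (star (word (iw (rev (a # L))))))"
  proof (intro allI)
    fix c b a L
    have "is_index (map Suc (c @ [b])) \<and> map Suc (c @ [b]) \<noteq> [] \<and> is_index (map Suc (rev (a # L))) \<and> map Suc (rev (a # L)) \<noteq> []"
      by (auto simp: is_index_def)
    then show "Z (mu (map Suc (c @ [b])) (map Suc (rev (a # L)))) =
      Z (circ_ast (word (iw (c @ [b]))) (star (word (iw (rev (a # L))))))"
      using i unfolding integral_series_identity_def by (metis idx_Suc)
  qed
next
  assume *: "\<forall>c b a L. Z (mu (map Suc (c @ [b])) (map Suc (rev (a # L)))) =
     Z (circ_ast (word (iw (c @ [b]))) (star (word (iw (rev (a # L))))))"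
  show "integral_series_identity Z"
    unfolding integral_series_identity_def
  proof (intro allI impI)
    fix ks ls assume kl: "is_index ks \<and> ks \<noteq> [] \<and> is_index ls \<and> ls \<noteq> []"
    obtain k l where k: "ks = map Suc k" and l: "ls = map Suc l"
      using kl by (meson is_index_obtain)
    obtain c b where "k = c @ [b]"
      using kl k by (cases k rule: rev_cases) auto
    moreover obtain a L where "l = rev (a # L)"
      using kl l by (cases l rule: rev_cases) (auto intro: that[of _ "rev _"])
    ultimately show "Z (mu ks ls) = Z (circ_ast (idx ks) (star (idx ls)))"
      using * k l by (simp only: idx_Suc)
  qed
qed

lemma reg_imp_star:
  assumes "regularization Z"
  shows "conv (alt (ones (fps_nth (A_series Z)))) (zig_star (reg_sh Z t)) w = star_val (reg_hr Z t) w"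
  by (rule star_regularized[where P = "\<lambda>_. True" and \<phi> = "reg_hr Z t" and \<psi> = "\<lambda>k. reg_sh Z t (iw k)"])
     (simp, simp, simp add: conv_star_val reg_hr_hom, simp add: conv_zig_star reg_sh_hom,
      use assms in \<open>simp_all only: regularization_iff\<close>)

lemma regularization_imp_integral_series:
  assumes r: "regularization Z"
  shows "integral_series_identity Z"
  unfolding integral_series_iff
proof (intro allI)
  fix c b a L
  let ?\<phi> = "reg_hr Z 0" and ?\<kappa> = "ones (fps_nth (A_series Z))"
  \<comment> \<open>The entry \<open>Suc (b + a)\<close> represents a number greater than 1, so
    \<open>\<kappa>\<close> can only take entries behind it.\<close>
  have "(\<lambda>p. reg_sh Z 0 (iw (c @ Suc (b + a) # p))) = conv (\<lambda>p. ?\<phi> (c @ Suc (b + a) # p)) ?\<kappa>"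
    using r by (intro ext) (simp only: regularization_iff conv_ones_append)
  then have "Z (mu (map Suc (c @ [b])) (map Suc (rev (a # L)))) =
      conv (conv (alt (\<lambda>p. ?\<phi> (c @ Suc (b + a) # p))) (alt ?\<kappa>)) (zig_star (reg_sh Z 0)) L"
    by (simp only: Z_mu[where t = 0] alt_conv)
  also have "\<dots> = conv (alt (\<lambda>p. ?\<phi> (c @ Suc (b + a) # p))) (star_val ?\<phi>) L"
    by (simp only: conv_assoc reg_imp_star[OF r])
  finally show "Z (mu (map Suc (c @ [b])) (map Suc (rev (a # L)))) =
      Z (circ_ast (word (iw (c @ [b]))) (star (word (iw (rev (a # L))))))"
    by (simp only: Z_circ[where t = 0])
qed

text \<open>Newton's identity between power sums \<open>[i]\<close> and elementary symmetric
  functions \<open>replicate n 0\<close>. The product of \<open>[i]\<close> with (1, ..., 1) either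
  inserts the entry or enlarges a 1 to the next larger entry, so the alternating sum telescopes to
  its first insertion term.\<close>

lemma newton_sum:
  "(\<Sum>i\<le>n. (-1) ^ i * reg_hr Z t [i] * reg_hr Z t (replicate (n - i) 0)) =
   of_nat (Suc n) * reg_hr Z t (replicate (Suc n) 0)"
proof -
  define X where "X = (\<lambda>f i m. dec (\<lambda>a b. f (a @ i # b)) (replicate m (0::nat)) :: real)"
  have X0: "X f 0 m = of_nat (Suc m) * f (replicate (Suc m) 0)" for f m
    unfolding X_def by (induction m arbitrary: f) (simp_all add: algebra_simps)
  have hr: "hr 1 f [i] (replicate m 0) = X f i m + (if m = 0 then 0 else X f (Suc i) (m - 1))" for f i m
  proof (induction m arbitrary: f)
    case (Suc m)
    have "X f i (Suc m) = f (i # replicate (Suc m) 0) + X (\<lambda>x. f (0 # x)) i m"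
      by (simp add: X_def)
    moreover have "X f (Suc i) m = f (Suc i # replicate m 0) + (if m = 0 then 0 else X (\<lambda>x. f (0 # x)) (Suc i) (m - 1))"
      by (cases m) (simp_all add: X_def)
    ultimately show ?case
      using Suc[of "\<lambda>x. f (0 # x)"] by simp
  qed (simp add: X_def)
  let ?f = "reg_hr Z t"
  have "(\<Sum>i\<le>j. (-1) ^ i * ?f [i] * ?f (replicate (n - i) 0)) =
      X ?f 0 n + (if j < n then (-1) ^ j * X ?f (Suc j) (n - j - 1) else 0)" if "j \<le> n" for j
    using that
  proof (induction j)
    case 0
    show ?case
      using hr[of ?f 0 n] by (simp add: reg_hr_hom)
  next
    case (Suc j)
    have "?f [Suc j] * ?f (replicate (n - Suc j) 0) =
        X ?f (Suc j) (n - Suc j) + (if n - Suc j = 0 then 0 else X ?f (Suc (Suc j)) (n - Suc j - 1))"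
      using hr[of ?f "Suc j" "n - Suc j"] by (simp add: reg_hr_hom)
    then have "(-1) ^ Suc j * ?f [Suc j] * ?f (replicate (n - Suc j) 0) = (-1) ^ Suc j *
        (X ?f (Suc j) (n - Suc j) + (if n - Suc j = 0 then 0 else X ?f (Suc (Suc j)) (n - Suc j - 1)))"
      by (simp only: mult.assoc)
    then show ?case
      using Suc by (auto simp: algebra_simps)
  qed
  from this[of n] show ?thesis
    by (simp add: X0)
qed

text \<open>Newton's identities give the generating series \<open>E\<close> of the harmonic values
  the logarithmic derivative \<open>P\<close>. Its constant term is \<open>t\<close>, and the
  exponent \<open>B\<close> of \<open>A_series\<close> is made such that \<open>B'\<close> cancels
  the other terms. So the product with \<open>A_series\<close> is the exponential series of
  \<open>t\<close>, and so is the series of shuffle values, as the n-th shuffle power of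
  \<open>E1\<close> is n! times \<open>replicate n E1\<close>.\<close>

lemma regularization_ones:
  "reg_sh Z t (iw (replicate n 0)) = conv (reg_hr Z t) (ones (fps_nth (A_series Z))) (replicate n 0)"
proof -
  let ?\<phi> = "reg_hr Z t"
  define E where "E = Abs_fps (\<lambda>n. ?\<phi> (replicate n 0))"
  define P where "P = Abs_fps (\<lambda>i. (-1) ^ i * ?\<phi> [i])"
  define B where "B = Abs_fps (\<lambda>n. if 2 \<le> n then (-1) ^ n / of_nat n * Z (idx [n]) else 0)"
  define A where "A = A_series Z"
  have E': "fps_deriv E = P * E"
    by (rule fps_ext) (simp add: E_def P_def fps_mult_nth newton_sum[simplified] atLeast0AtMost)
  have A': "fps_deriv A = A * fps_deriv B"
    by (simp only: A_def B_def deriv_A_series)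
  have PB: "P + fps_deriv B = fps_const t"
  proof (rule fps_ext)
    fix n
    show "fps_nth (P + fps_deriv B) n = fps_nth (fps_const t) n"
    proof (cases n)
      case (Suc m)
      have "idx [Suc n] = word (iw [n])"
        using idx_Suc[of "[n]"] by simp
      moreover have "?\<phi> [n] = Z (word (iw [n]))"
        using trail_simps(2)[of 0 "[]" n] Suc by (intro reg_hr_admissible) simp
      ultimately show ?thesis
        using Suc by (simp add: P_def B_def del: iw_simps of_nat_Suc)
    qed (simp add: P_def B_def reg_hr_0)
  qed
  have "fps_deriv (A * E) = fps_const t * (A * E)"
  proof -
    have "fps_deriv (A * E) = A * E * (P + fps_deriv B)"
      by (simp add: E' A' algebra_simps)
    then show ?thesis
      by (simp only: PB mult.commute)
  qed
  then have rec: "of_nat (Suc n) * fps_nth (A * E) (Suc n) = t * fps_nth (A * E) n" for n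
    by (metis fps_deriv_nth fps_mult_left_const_nth Suc_eq_plus1)
  have AE: "fact n * fps_nth (A * E) n = t ^ n" for n
  proof (induction n)
    case (Suc n)
    have "fact (Suc n) * fps_nth (A * E) (Suc n) = fact n * (of_nat (Suc n) * fps_nth (A * E) (Suc n))"
      by simp
    also have "\<dots> = t ^ Suc n"
      unfolding rec using Suc by (simp add: mult.left_commute)
    finally show ?case .
  qed (simp add: A_def E_def A_series_0)
  have "fact n * reg_sh Z t (replicate n E1) = t ^ n"
  proof (induction n)
    case (Suc n)
    have "sh f [E1] (replicate n E1) = of_nat (Suc n) * f (replicate (Suc n) E1)" for f :: "letter list \<Rightarrow> real"
      by (induction n arbitrary: f) (simp_all add: algebra_simps)
    then have "of_nat (Suc n) * reg_sh Z t (replicate (Suc n) E1) = sh (reg_sh Z t) [E1] (replicate n E1)"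
      by simp
    also have "\<dots> = t * reg_sh Z t (replicate n E1)"
      by (subst reg_sh_hom) (cases n; simp add: H1_word_def reg_sh_E1)+
    finally have "fact (Suc n) * reg_sh Z t (replicate (Suc n) E1) = fact n * (t * reg_sh Z t (replicate n E1))"
      by (simp add: mult.left_commute mult.assoc)
    then show ?case
      using Suc by (simp add: mult.left_commute)
  qed simp
  moreover have "conv ?\<phi> (ones (fps_nth (A_series Z))) (replicate n 0) = fps_nth (A * E) n"
  proof -
    have "trail 0 (replicate n (0::nat)) = n"
      by (simp add: trail_def)
    then have "conv ?\<phi> (ones (fps_nth (A_series Z))) (replicate n 0) =
        (\<Sum>j\<le>n. fps_nth A j * ?\<phi> (replicate (n - j) 0))"
      unfolding conv_ones by (simp add: A_def min_def mult.commute)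
    then show ?thesis
      by (simp add: E_def fps_mult_nth atLeast0AtMost)
  qed
  ultimately show ?thesis
    using AE[of n] by (metis fact_nonzero iw_ones mult_left_cancel)
qed

lemma integral_series_imp_regularization:
  assumes i: "integral_series_identity Z"
  shows "regularization Z"
  unfolding regularization_iff
proof (intro allI)
  fix t k
  let ?\<phi> = "reg_hr Z t" and ?\<kappa> = "ones (fps_nth (A_series Z))" and ?P = "\<lambda>w. w = replicate (length w) (0::nat)"
  have P: "?P x \<and> ?P y" if "?P (x @ y)" for x y
    using that by (simp add: replicate_add append_eq_append_conv)
  have ones: "reg_sh Z t (iw w) = conv ?\<phi> ?\<kappa> w" if "?P w" for w
    using regularization_ones[of t "length w"] that by simp
  have star: "conv (alt ?\<kappa>) (zig_star (reg_sh Z t)) w = star_val ?\<phi> w" if "?P w" for w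
    by (rule star_regularized[where P = ?P and \<phi> = ?\<phi> and \<psi> = "\<lambda>k. reg_sh Z t (iw k)"])
       (rule P, assumption, simp, simp add: conv_star_val reg_hr_hom, simp add: conv_zig_star reg_sh_hom,
        rule ones, assumption, rule that)
  have "\<exists>n c. k = replicate n 0 \<or> (\<exists>b. k = c @ Suc b # replicate n 0)"
  proof (induction k rule: rev_induct)
    case (snoc e k)
    then obtain n c where *: "k = replicate n 0 \<or> (\<exists>b. k = c @ Suc b # replicate n 0)"
      by blast
    show ?case
    proof (cases e)
      case 0
      then show ?thesis
        using * by (intro exI[of _ "Suc n"] exI[of _ c]) (auto simp: replicate_append_same)
    next
      case (Suc b)
      then show ?thesis
        by (intro exI[of _ 0] exI[of _ k]) auto
    qed
  qed simp
  then obtain n c where "k = replicate n 0 \<or> (\<exists>b. k = c @ Suc b # replicate n 0)"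
    by blast
  then show "reg_sh Z t (iw k) = conv ?\<phi> ?\<kappa> k"
  proof
    assume "k = replicate n 0"
    then show ?thesis
      using ones[of k] by simp
  next
    assume "\<exists>b. k = c @ Suc b # replicate n 0"
    then obtain b where k: "k = c @ Suc b # replicate n 0"
      by blast
    let ?\<alpha> = "\<lambda>p. ?\<phi> (c @ Suc b # p)" and ?\<beta> = "\<lambda>p. reg_sh Z t (iw (c @ Suc b # p))"
    \<comment> \<open>With the entry 0 in place of \<open>a\<close>, the joined entry
      \<open>Suc (b + 0)\<close> is the last entry of \<open>k\<close> that differs from 1.\<close>
    have eq: "conv (alt ?\<beta>) (zig_star (reg_sh Z t)) L = conv (alt ?\<alpha>) (star_val ?\<phi>) L" for L
      using i[unfolded integral_series_iff, rule_format, of c b 0 L]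
      by (simp only: Z_mu[where t = t] Z_circ[where t = t] add_0_right)
    have "alt ?\<beta> (replicate n 0) = conv (alt ?\<alpha>) (alt ?\<kappa>) (replicate n 0)"
    \<comment> \<open>All pieces of an index (1, ..., 1) have the same form, and on these
      \<open>star\<close> already relates the two inverses; \<open>zig_star\<close> has value 1 at
      the empty index and can be cancelled.\<close>
    proof (rule conv_right_cancel[where P = ?P and f = "zig_star (reg_sh Z t)"])
      show "?P x" if "?P (x @ y)" for x y
        using P[OF that] ..
      show "conv (alt ?\<beta>) (zig_star (reg_sh Z t)) w = conv (conv (alt ?\<alpha>) (alt ?\<kappa>)) (zig_star (reg_sh Z t)) w"
        if "?P w" for w
      proof -
        have "conv (conv (alt ?\<alpha>) (alt ?\<kappa>)) (zig_star (reg_sh Z t)) w = conv (alt ?\<alpha>) (star_val ?\<phi>) w"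
          unfolding conv_assoc
        proof (rule dec_cong)
          fix x y assume "w = x @ y"
          then have "?P y"
            using P that by blast
          then show "alt ?\<alpha> x * conv (alt ?\<kappa>) (zig_star (reg_sh Z t)) y = alt ?\<alpha> x * star_val ?\<phi> y"
            by (simp only: star)
        qed
        then show ?thesis
          by (simp only: eq)
      qed
    qed simp_all
    also have "\<dots> = alt (conv ?\<alpha> ?\<kappa>) (replicate n 0)"
      by (simp only: alt_conv)
    finally have "?\<beta> (replicate n 0) = conv ?\<alpha> ?\<kappa> (replicate n 0)"
      by (simp add: alt_def)
    then show ?thesis
      by (simp only: k conv_ones_append)
  qed
qed

end

section \<open>Kawashima's relation\<close>

text \<open>Closed by a further \<open>E1\<close>, a word has its entries as the distances between
  consecutive letters \<open>E1\<close>, and reading backwards reverses their order.\<close>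

lemma iw_rev: "k \<noteq> [] \<Longrightarrow> tl (iw (rev k)) = rev (tl (iw k))"
proof -
  assume k: "k \<noteq> []"
  have r: "rev (iw k @ [E1]) = iw (rev k) @ [E1]" for k
    by (induction k) simp_all
  have "iw k = E1 # tl (iw k)" "iw (rev k) = E1 # tl (iw (rev k))"
    using k by (cases k; simp) (cases "rev k"; simp add: k)
  then have "E1 # rev (tl (iw k)) @ [E1] = E1 # tl (iw (rev k)) @ [E1]"
    using r[of k] by (metis append_Cons rev.simps(2) rev_append rev_singleton_conv singleton_rev_conv append_Nil append.assoc)
  then show ?thesis by simp
qed

lemma hoffman_dual_word:
  "k \<noteq> [] \<Longrightarrow> hoffman_dual (word (iw k)) = word (E1 # map swap_letter (tl (iw k)))"
  using index_word_hoffman_dual[of k]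
  by (simp add: hoffman_dual_def linear_ext_def word_def idx_def)

text \<open>A zigzag is traversed from the last entry of its index, that is, along the reversed
  index; there Hoffman duality exchanges up and down steps.\<close>

lemma hoffman_dual_obtain:
  assumes "k \<noteq> []"
  obtains a L where "hoffman_dual (word (iw k)) = word (iw (rev (a # L)))"
    "replicate a E0 @ iw L = map swap_letter (tl (iw (rev k)))"
proof -
  obtain k2 where k2: "E1 # map swap_letter (tl (iw k)) = iw k2"
    using H1_word_obtain[of "E1 # map swap_letter (tl (iw k))"] by (auto simp: H1_word_def)
  then have "k2 \<noteq> []"
    by auto
  then obtain a L where aL: "rev k2 = a # L"
    by (metis list.exhaust rev_is_Nil_conv)
  then have k2': "k2 = rev (a # L)"
    by (metis rev_rev_ident)
  have "replicate a E0 @ iw L = tl (iw (rev k2))"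
    by (simp add: aL)
  also have "\<dots> = rev (tl (iw k2))"
    by (rule iw_rev[OF \<open>k2 \<noteq> []\<close>])
  also have "\<dots> = map swap_letter (rev (tl (iw k)))"
    by (simp flip: k2 add: rev_map)
  also have "\<dots> = map swap_letter (tl (iw (rev k)))"
    by (simp add: iw_rev assms)
  finally show ?thesis
    using that[of a L] k2 k2' hoffman_dual_word[OF assms] by simp
qed

lemma dec_fps_const: "dec (\<lambda>x y. fps_const (H x y)) w = fps_const (dec H w)"
  by (induction w arbitrary: H) (simp_all add: fps_const_add)

lemma dec_fps_nth: "fps_nth (dec H w) m = dec (\<lambda>x y. fps_nth (H x y) m) w"
  by (induction w arbitrary: H) simp_all

lemma alt_fps_nth: "fps_nth (alt F p) m = (-1) ^ length p * fps_nth (F p) m" for F :: "'a list \<Rightarrow> real fps"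
  by (cases "even (length p)") (simp_all add: alt_def)

lemma hr_fps_const: "hr (-1) (\<lambda>q. fps_const (f q)) u v = fps_const (hr (-1) f u v)" for f :: "nat list \<Rightarrow> real"
proof (induction "length u + length v" arbitrary: u v f rule: less_induct)
  case less
  show ?case
  proof (cases "u = [] \<or> v = []")
    case True
    then show ?thesis by auto
  next
    case False
    then obtain a u' b v' where uv: "u = a # u'" "v = b # v'"
      by (meson list.exhaust)
    show ?thesis
      using less[of u' v "\<lambda>x. f (a # x)"] less[of u v' "\<lambda>x. f (b # x)"]
        less[of u' v' "\<lambda>x. f (Suc (a + b) # x)"]
      by (simp add: uv fps_const_add fps_const_neg flip: fps_const_sub)
  qed
qed

lemma qsh_conv_hom:
  assumes "\<And>u v. qsh c g f u v = f u * f v" "\<And>u v. qsh c g h u v = h u * h v"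
  shows "qsh c g (conv f h) u v = conv f h u * conv f h v"
proof -
  have "qsh c g (conv f h) u v = dec (\<lambda>u1 u2. dec (\<lambda>v1 v2. f u1 * h u2 * (f v1 * h v2)) v) u"
    unfolding qsh_conv assms by (simp add: ac_simps)
  then show ?thesis
    by (simp only: dec_mult dec_mult_right)
qed

lemma shift_conv:
  assumes "\<And>x k y. \<kappa> (x @ Suc k # y) = 0"
  shows "shift (conv f \<kappa>) p = conv (shift f) (\<lambda>q. fps_const (\<kappa> q)) p"
proof (rule fps_ext)
  fix m
  have "fps_nth (shift (conv f \<kappa>) p) m = conv ((dl ^^ m) f) \<kappa> p * (1 / fact m)"
    by (simp add: shift_def dl_funpow_conv[of \<kappa>, OF assms])
  also have "\<dots> = dec (\<lambda>x y. (dl ^^ m) f x * \<kappa> y * (1 / fact m)) p"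
    by (rule dec_mult_right[symmetric])
  finally show "fps_nth (shift (conv f \<kappa>) p) m = fps_nth (conv (shift f) (\<lambda>q. fps_const (\<kappa> q)) p) m"
    by (simp add: dec_fps_nth shift_def)
qed

lemma ev_circ_hoffman:
  "ev f (circ_ast (word u) (star (hoffman_dual y))) =
   ev (\<lambda>w. ev f (circ_ast (word u) (star (hoffman_dual (word w))))) y"
  by (simp add: circ_ast_def star_def hoffman_dual_def ev_bilinear_ext ev_linear_ext)

lemma ev_star_harmonic:
  "ev f (star_harmonic (word (iw k)) (word (iw l))) = hr (-1) (\<lambda>x. f (iw x)) k l"
  by (simp add: star_harmonic_def ev_star_harmonic_indices)

lemma circ_hoffman_H0:
  assumes "1 \<le> m" "k \<noteq> []"
  shows "circ_ast (word (iw (replicate m 0))) (star (hoffman_dual (word (iw k)))) \<in> H0"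
proof -
  obtain a L where h: "hoffman_dual (word (iw k)) = word (iw (rev (a # L)))"
    using hoffman_dual_obtain[OF assms(2)] by metis
  have "replicate m (0::nat) = replicate (m - 1) 0 @ [0]"
    using assms(1) by (cases m) (simp_all add: replicate_append_same)
  then show ?thesis
    using circ_star_H0[of "replicate (m - 1) 0" 0 a L] h by metis
qed

lemma circ_hoffman_star_harmonic_H0:
  assumes m: "1 \<le> m" and kl: "k \<noteq> []"
  shows "circ_ast (word (iw (replicate m 0))) (star (hoffman_dual (star_harmonic (word (iw k)) (word (iw l))))) \<in> H0"
  unfolding H0_iff keys_subset_iff_ev
proof (intro allI impI)
  fix f :: "letter list \<Rightarrow> real" assume f: "\<forall>w\<in>Collect admissible_word. f w = 0"
  have "hr (-1) (\<lambda>x. ev f (circ_ast (word (iw (replicate m 0))) (star (hoffman_dual (word (iw x)))))) k l = hr (-1) (\<lambda>_. 0) k l"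
  proof (rule qsh_cong)
    fix x assume "x \<in> qsh_words (- 1 :: real) (\<lambda>a b. Suc (a + b)) k l"
    then have "x \<noteq> []"
      using qsh_words_nonempty kl by blast
    then show "ev f (circ_ast (word (iw (replicate m 0))) (star (hoffman_dual (word (iw x))))) = 0"
      using circ_hoffman_H0[OF m] f unfolding H0_iff keys_subset_iff_ev by blast
  qed
  then show "ev f (circ_ast (word (iw (replicate m 0))) (star (hoffman_dual (star_harmonic (word (iw k)) (word (iw l)))))) = 0"
    by (subst ev_circ_hoffman) (simp add: ev_star_harmonic)
qed

context double_shuffle_map
begin

text \<open>The generating function of Kawashima's relation. By \<open>kawashima_fun_eq\<close> below it is also the
  convolution of the shifted harmonic regularization with the inverse of the unshifted one, which makes
  it a character for the star-harmonic product.\<close>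

definition kawashima_fun :: "nat list \<Rightarrow> real fps" where
  "kawashima_fun = conv (alt (shift (\<lambda>k. reg_sh Z 0 (iw k)))) (\<lambda>q. fps_const (zig_star (reg_sh Z 0) q))"

lemma kawashima_fun_0:
  assumes "L \<noteq> []"
  shows "fps_nth (kawashima_fun L) 0 = 0"
proof -
  have "fps_nth (alt (shift f) p) 0 = alt f p" for f p
    by (simp add: alt_fps_nth) (simp add: alt_def shift_def)
  then show ?thesis
    using assms conv_zig_star[OF reg_sh_hom reg_sh_Nil, of 0 L] by (simp add: kawashima_fun_def dec_fps_nth)
qed

text \<open>Hoffman duality exchanges the letters of the steps and the duality relation exchanges
  them back, so the zigzag of \<open>k\<close> itself remains, while the chain of letters
  \<open>E1\<close> becomes the chain of letters \<open>E0\<close>.\<close>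

lemma Z_circ_hoffman:
  assumes dual: "duality Z" and reg: "regularization Z" and m: "1 \<le> m" and k: "k \<noteq> []"
  shows "Z (circ_ast (word (iw (replicate m 0))) (star (hoffman_dual (word (iw k))))) =
    - fps_nth (kawashima_fun (rev k)) m"
proof -
  let ?z = "\<lambda>w. Z (word w)" and ?\<psi> = "reg_sh Z 0"
  obtain a L where h: "hoffman_dual (word (iw k)) = word (iw (rev (a # L)))"
    and steps: "replicate a E0 @ iw L = map swap_letter (tl (iw (rev k)))"
    using hoffman_dual_obtain[OF k] by metis
  obtain l L' where kl: "rev k = l # L'"
    using k by (metis list.exhaust rev_is_Nil_conv)
  have ones: "replicate m (0::nat) = replicate (m - 1) 0 @ [0]"
    using m by (cases m) (simp_all add: replicate_append_same)
  have ne: "replicate m (0::nat) \<noteq> []"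
    using m by auto
  let ?mu = "mu (map Suc (replicate m 0)) (map Suc (rev (a # L)))"
  have mu: "?mu \<in> H0"
    by (rule mu_H0[OF ne])
  have dmu: "dagger ?mu \<in> H0"
    unfolding H0_iff keys_subset_iff_ev
  proof (intro allI impI)
    fix f :: "letter list \<Rightarrow> real" assume f: "\<forall>w\<in>Collect admissible_word. f w = 0"
    have "admissible_word (dagger_word w)" if "admissible_word w" for w
      using that by (auto simp: admissible_word_def hd_rev last_rev last_map hd_map)
    then have "ev (\<lambda>w. f (dagger_word w)) ?mu = 0"
      using f mu unfolding H0_iff keys_subset_iff_ev by simp
    then show "ev f (dagger ?mu) = 0"
      by (simp only: dagger_def ev_linear_ext ev_word)
  qed
  have "Z (circ_ast (word (iw (replicate m 0))) (star (hoffman_dual (word (iw k))))) = Z ?mu"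
    unfolding h ones
    using regularization_imp_integral_series[OF reg, unfolded integral_series_iff, rule_format,
      of "replicate (m - 1) 0" 0 a L]
    by (rule sym)
  also have "\<dots> = Z (dagger ?mu)"
    using dual mu by (simp only: duality_def)
  also have "\<dots> = ev (\<lambda>w. ?z (dagger_word w)) ?mu"
    by (simp only: Z_eq_ev[OF dmu]) (simp only: dagger_def ev_linear_ext ev_word)
  also have "\<dots> = zig (\<lambda>w. ?z (dagger_word w)) (replicate m E1) E0 [] (map swap_letter (tl (iw (rev k))))"
    by (simp only: ev_mu[OF ne] steps iw_ones)
  also have "\<dots> = zig ?z [] E1 (replicate m E0) (tl (iw (rev k)))"
    using zig_dagger[of ?z "[]" E0 "replicate m E1" "map swap_letter (tl (iw (rev k)))"]
    by (simp add: o_def)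
  also have "\<dots> = zig ?\<psi> [] E1 (replicate m E0) (tl (iw (rev k)))"
    by (rule zig_cong_admissible) (use m in \<open>simp_all add: reg_sh_admissible\<close>)
  also have "\<dots> = sided_zig ?\<psi> [] (replicate m E0) (replicate l E0 @ iw L')"
    by (simp add: kl sided_zig_def)
  also have "\<dots> = dec (\<lambda>p q. (-1) ^ length p * fps_nth (shift (\<lambda>q. ?\<psi> (iw q)) (l # p)) m * zig_star ?\<psi> q) L'"
    using sided_zig_iw[OF reg_sh_hom reg_sh_Nil, of 0 "[]" "replicate m E0" l L']
    by (simp only: append_Nil shuffle_replicate_E0)
  also have "\<dots> = - fps_nth (kawashima_fun (rev k)) m"
  proof -
    \<comment> \<open>In the convolution over \<open>l # L'\<close> the term with empty first part
      vanishes because \<open>m\<close> is positive; in the others \<open>alt\<close> also counts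
      the entry \<open>l\<close>, whence the minus sign.\<close>
    have "fps_nth (shift f []) m = 0" for f
      using m by (cases m) (simp_all add: shift_def)
    then show ?thesis
      unfolding kl kawashima_fun_def
      by (simp add: dec_fps_nth alt_fps_nth dec_minus)
  qed
  finally show ?thesis .
qed

text \<open>The shuffle regularization is the harmonic one convolved with \<open>\<kappa>\<close>.
  By \<open>shift_conv\<close> the shift leaves \<open>\<kappa>\<close> alone, and
  \<open>reg_imp_star\<close> absorbs it into \<open>zig_star\<close>, giving
  \<open>star_val\<close>.\<close>

lemma kawashima_fun_eq:
  assumes reg: "regularization Z"
  shows "kawashima_fun = conv (alt (shift (reg_hr Z 0))) (\<lambda>q. fps_const (star_val (reg_hr Z 0) q))"
proof
  fix L
  let ?\<phi> = "reg_hr Z 0" and ?\<kappa> = "ones (fps_nth (A_series Z))"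
  have \<psi>: "(\<lambda>k. reg_sh Z 0 (iw k)) = conv ?\<phi> ?\<kappa>"
    using reg by (intro ext) (simp only: regularization_iff)
  have "alt (shift (\<lambda>k. reg_sh Z 0 (iw k))) = alt (conv (shift ?\<phi>) (\<lambda>q. fps_const (?\<kappa> q)))"
    unfolding \<psi> by (simp add: alt_def[abs_def] shift_conv)
  then have "kawashima_fun L =
      conv (conv (alt (shift ?\<phi>)) (alt (\<lambda>q. fps_const (?\<kappa> q)))) (\<lambda>q. fps_const (zig_star (reg_sh Z 0) q)) L"
    by (simp only: kawashima_fun_def alt_conv)
  also have "\<dots> = conv (alt (shift ?\<phi>)) (conv (alt (\<lambda>q. fps_const (?\<kappa> q))) (\<lambda>q. fps_const (zig_star (reg_sh Z 0) q))) L"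
    by (rule conv_assoc)
  also have "conv (alt (\<lambda>q. fps_const (?\<kappa> q))) (\<lambda>q. fps_const (zig_star (reg_sh Z 0) q)) =
      (\<lambda>q. fps_const (star_val ?\<phi> q))"
  proof
    fix w
    have "alt (\<lambda>q. fps_const (?\<kappa> q)) x = fps_const (alt ?\<kappa> x)" for x
      by (cases "even (length x)") (simp_all add: alt_def)
    then have "conv (alt (\<lambda>q. fps_const (?\<kappa> q))) (\<lambda>q. fps_const (zig_star (reg_sh Z 0) q)) w =
        fps_const (conv (alt ?\<kappa>) (zig_star (reg_sh Z 0)) w)"
      by (simp add: dec_fps_const)
    then show "conv (alt (\<lambda>q. fps_const (?\<kappa> q))) (\<lambda>q. fps_const (zig_star (reg_sh Z 0) q)) w = fps_const (star_val ?\<phi> w)"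
      by (simp only: reg_imp_star[OF reg])
  qed
  finally show "kawashima_fun L = conv (alt (shift ?\<phi>)) (\<lambda>q. fps_const (star_val ?\<phi> q)) L" .
qed

text \<open>The shift of the harmonic regularization is again a harmonic character, and
  \<open>alt\<close> makes it a star-harmonic one; \<open>star_val\<close> is the inverse of such a
  character.\<close>

lemma kawashima_fun_hom:
  assumes reg: "regularization Z"
  shows "hr (-1) kawashima_fun u v = kawashima_fun u * kawashima_fun v"
  unfolding kawashima_fun_eq[OF reg]
proof (rule qsh_conv_hom)
  show "hr (-1) (alt (shift (reg_hr Z 0))) u v = alt (shift (reg_hr Z 0)) u * alt (shift (reg_hr Z 0)) v" for u v
    by (rule hr_alt_hom) (rule shift_hom, rule reg_hr_hom)
  have "hr (-1) (star_val (reg_hr Z 0)) u v = star_val (reg_hr Z 0) u * star_val (reg_hr Z 0) v" for u v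
    by (rule qsh_conv_inverse[of _ _ "alt (reg_hr Z 0)"])
       (simp_all add: hr_alt_hom reg_hr_hom conv_star_val)
  then show "hr (-1) (\<lambda>q. fps_const (star_val (reg_hr Z 0) q)) u v =
      fps_const (star_val (reg_hr Z 0) u) * fps_const (star_val (reg_hr Z 0) v)" for u v
    by (simp add: hr_fps_const)
qed

lemma kawashima:
  assumes dual: "duality Z" and reg: "regularization Z" and m: "1 \<le> m" and kl: "k \<noteq> []" "l \<noteq> []"
  shows "(\<Sum>(p, q) \<in> {(p, q). 1 \<le> p \<and> 1 \<le> q \<and> p + q = m}.
       Z (circ_ast (word (iw (replicate p 0))) (star (hoffman_dual (word (iw k))))) *
       Z (circ_ast (word (iw (replicate q 0))) (star (hoffman_dual (word (iw l)))))) =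
    - Z (circ_ast (word (iw (replicate m 0))) (star (hoffman_dual (star_harmonic (word (iw k)) (word (iw l))))))"
proof -
  let ?F = kawashima_fun
  let ?S = "{(p, q). 1 \<le> p \<and> 1 \<le> q \<and> p + q = m}"
  have rk: "rev k \<noteq> []" "rev l \<noteq> []"
    using kl by auto
  have "Z (circ_ast (word (iw (replicate m 0))) (star (hoffman_dual (star_harmonic (word (iw k)) (word (iw l)))))) =
      hr (-1) (\<lambda>x. ev (\<lambda>w. Z (word w)) (circ_ast (word (iw (replicate m 0))) (star (hoffman_dual (word (iw x)))))) k l"
    by (simp only: Z_eq_ev[OF circ_hoffman_star_harmonic_H0[OF m kl(1)]]) (subst ev_circ_hoffman, simp only: ev_star_harmonic)
  also have "\<dots> = hr (-1) (\<lambda>x. - fps_nth (?F (rev x)) m) k l"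
  proof (rule qsh_cong)
    fix x assume "x \<in> qsh_words (- 1 :: real) (\<lambda>a b. Suc (a + b)) k l"
    then have x: "x \<noteq> []"
      using qsh_words_nonempty kl by blast
    show "ev (\<lambda>w. Z (word w)) (circ_ast (word (iw (replicate m 0))) (star (hoffman_dual (word (iw x))))) = - fps_nth (?F (rev x)) m"
      by (simp only: Z_eq_ev[OF circ_hoffman_H0[OF m x], symmetric] Z_circ_hoffman[OF dual reg m x])
  qed
  \<comment> \<open>The star-harmonic product commutes with the reversal of indices, so the reversal
    in \<open>Z_circ_hoffman\<close> can be moved to the factors.\<close>
  also have "\<dots> = - hr (-1) (\<lambda>x. fps_nth (?F x) m) (rev k) (rev l)"
    by (simp only: qsh_minus qsh_rev[of _ _ "\<lambda>x. fps_nth (?F x) m"])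
  also have "hr (-1) (\<lambda>x. fps_nth (?F x) m) (rev k) (rev l) = fps_nth (?F (rev k) * ?F (rev l)) m"
    using qsh_fps_nth[of "-1" ?F "rev k" "rev l" m] by (simp add: kawashima_fun_hom[OF reg] flip: fps_const_neg)
  also have "\<dots> = (\<Sum>i\<le>m. fps_nth (?F (rev k)) i * fps_nth (?F (rev l)) (m - i))"
    by (simp add: fps_mult_nth atLeast0AtMost)
  also have "\<dots> = (\<Sum>i\<in>{1..<m}. fps_nth (?F (rev k)) i * fps_nth (?F (rev l)) (m - i))"
  proof (rule sum.mono_neutral_right)
    show "\<forall>i\<in>{..m} - {1..<m}. fps_nth (?F (rev k)) i * fps_nth (?F (rev l)) (m - i) = 0"
    proof
      fix i assume "i \<in> {..m} - {1..<m}"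
      then have "i = 0 \<or> i = m"
        by auto
      then show "fps_nth (?F (rev k)) i * fps_nth (?F (rev l)) (m - i) = 0"
        using kawashima_fun_0 rk by auto
    qed
  qed auto
  also have "\<dots> = (\<Sum>(p, q)\<in>?S. fps_nth (?F (rev k)) p * fps_nth (?F (rev l)) q)"
    by (rule sum.reindex_bij_witness[of _ fst "\<lambda>i. (i, m - i)"]) auto
  also have "\<dots> = (\<Sum>(p, q)\<in>?S. Z (circ_ast (word (iw (replicate p 0))) (star (hoffman_dual (word (iw k))))) *
       Z (circ_ast (word (iw (replicate q 0))) (star (hoffman_dual (word (iw l))))))"
    by (rule sum.cong) (auto simp: Z_circ_hoffman[OF dual reg] kl)
  finally show ?thesis by simp
qed

end

section \<open>The degenerate case and the theorem\<close>

lemma ncpoly_eqI_ev: "(\<And>f. ev f x = ev f y) \<Longrightarrow> x = y"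
proof (rule poly_mapping_eqI)
  fix w assume "\<And>f. ev f x = ev f y"
  then have "(of_rat (Poly_Mapping.lookup x w) :: real) = of_rat (Poly_Mapping.lookup y w)"
    by (simp only: lookup_eq_ev)
  then show "Poly_Mapping.lookup x w = Poly_Mapping.lookup y w"
    by simp
qed

text \<open>If \<open>Z 1 \<noteq> 1\<close> then \<open>Z\<close> vanishes on \<open>H0\<close> and neither regularization exists; both are then the
  same unspecified function and \<open>rho Z\<close> is the identity.\<close>

lemma double_shuffle_degenerate:
  assumes "double_shuffle Z" "Z 1 \<noteq> 1" "x \<in> H0"
  shows "Z x = 0"
proof -
  have one: "1 \<in> H0"
    by (simp add: one_eq_word admissible_word_def)
  have *: "Z v = Z v * Z 1" if "v \<in> H0" for v
  proof -
    have "shuffle v 1 = v"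
      by (rule ncpoly_eqI_ev) (simp add: shuffle_def ev_bilinear_ext one_eq_word ev_shuffle_words)
    then show ?thesis
      using assms(1) that one unfolding double_shuffle_def by metis
  qed
  have "Z 1 = 0"
    using *[OF one] assms(2) by simp
  then show ?thesis
    using *[OF assms(3)] by simp
qed

lemma rho_degenerate:
  assumes "\<And>x. x \<in> H0 \<Longrightarrow> Z x = 0"
  shows "rho Z p = p"
proof -
  have "Z (idx [n]) = 0" if "2 \<le> n" for n
  proof (rule assms)
    have "trail 0 [n - 1] = 0"
      using trail_simps(2)[of 0 "[]" "n - 1"] that by simp
    then show "idx [n] \<in> H0"
      using idx_Suc[of "[n - 1]"] that by (simp del: iw_simps)
  qed
  then have "Abs_fps (\<lambda>n. if 2 \<le> n then (-1) ^ n / of_nat n * Z (idx [n]) else 0) = 0"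
    by (auto simp: fps_eq_iff)
  then have "A_series Z = 1"
    by (simp add: A_series_def fps_compose_0_right)
  then have "rho Z p = (\<Sum>j\<le>degree p. if j = 0 then p else 0)"
    unfolding rho_eq_pderiv[OF order_refl] by (intro sum.cong) auto
  then show ?thesis
    by simp
qed

lemma regularization_degenerate:
  assumes "double_shuffle Z" "Z 1 \<noteq> 1"
  shows "regularization Z"
proof -
  have "\<not> is_regularized_hom P Z \<phi>" for P \<phi>
  proof
    assume h: "is_regularized_hom P Z \<phi>"
    have "1 \<in> H0"
      by (simp add: one_eq_word admissible_word_def)
    then have "\<phi> 1 = [:Z 1:]" "\<phi> 1 = 1"
      using h unfolding is_regularized_hom_def by blast+
    then show False
      using assms(2) by (simp add: one_pCons)
  qed
  then have "Z_shuffle Z = Z_harmonic Z"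
    by (simp add: Z_shuffle_def Z_harmonic_def)
  then show ?thesis
    using rho_degenerate[of Z] double_shuffle_degenerate[OF assms] by (simp add: regularization_def)
qed

lemma integral_series_degenerate:
  assumes "double_shuffle Z" "Z 1 \<noteq> 1"
  shows "integral_series_identity Z"
  unfolding integral_series_identity_def
proof (intro allI impI)
  fix ks ls assume kl: "is_index ks \<and> ks \<noteq> [] \<and> is_index ls \<and> ls \<noteq> []"
  obtain k l where k: "ks = map Suc k" and l: "ls = map Suc l"
    using kl by (meson is_index_obtain)
  obtain c b where cb: "k = c @ [b]"
    using kl k by (cases k rule: rev_cases) auto
  obtain a L where aL: "l = rev (a # L)"
    using kl l by (cases l rule: rev_cases) (auto intro: that[of _ "rev _"])
  have "mu ks ls \<in> H0"
    using mu_H0[of k a L] cb aL k l by simp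
  moreover have "circ_ast (idx ks) (star (idx ls)) \<in> H0"
    using circ_star_H0[of c b a L] unfolding k l cb aL idx_Suc .
  ultimately show "Z (mu ks ls) = Z (circ_ast (idx ks) (star (idx ls)))"
    by (simp add: double_shuffle_degenerate[OF assms])
qed

theorem theorem6p7:
  fixes Z :: "ncpoly \<Rightarrow> real"
  assumes "linear_on_H0 Z"
    and "double_shuffle Z"
  shows "(regularization Z \<longleftrightarrow> integral_series_identity Z) \<and>
    (duality Z \<and> regularization Z \<longrightarrow>
      (\<forall>ks ls m. is_index ks \<and> ks \<noteq> [] \<and> is_index ls \<and> ls \<noteq> [] \<and> 1 \<le> m \<longrightarrow>
        (\<Sum>(p, q) \<in> {(p, q). 1 \<le> p \<and> 1 \<le> q \<and> p + q = m}.
           Z (circ_ast (idx (replicate p 1)) (star (hoffman_dual (idx ks)))) *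
           Z (circ_ast (idx (replicate q 1)) (star (hoffman_dual (idx ls)))))
        = - Z (circ_ast (idx (replicate m 1))
                 (star (hoffman_dual (star_harmonic (idx ks) (idx ls)))))))"
proof (intro conjI impI allI)
  show "regularization Z \<longleftrightarrow> integral_series_identity Z"
  proof (cases "Z 1 = 1")
    case True
    then interpret double_shuffle_map Z
      using assms by unfold_locales
    show ?thesis
      using regularization_imp_integral_series integral_series_imp_regularization by blast
  next
    case False
    then show ?thesis
      using regularization_degenerate integral_series_degenerate assms(2) by blast
  qed
next
  fix ks ls :: "nat list" and m :: nat
  assume dr: "duality Z \<and> regularization Z"
    and h: "is_index ks \<and> ks \<noteq> [] \<and> is_index ls \<and> ls \<noteq> [] \<and> 1 \<le> m"
  obtain k l where k: "ks = map Suc k" and l: "ls = map Suc l"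
    using h by (meson is_index_obtain)
  have kl: "k \<noteq> []" "l \<noteq> []"
    using h k l by auto
  have m: "1 \<le> m"
    using h by blast
  have ones: "idx (replicate p 1) = word (iw (replicate p 0))" for p
    using idx_Suc[of "replicate p 0"] by simp
  show "(\<Sum>(p, q) \<in> {(p, q). 1 \<le> p \<and> 1 \<le> q \<and> p + q = m}.
       Z (circ_ast (idx (replicate p 1)) (star (hoffman_dual (idx ks)))) *
       Z (circ_ast (idx (replicate q 1)) (star (hoffman_dual (idx ls))))) =
    - Z (circ_ast (idx (replicate m 1)) (star (hoffman_dual (star_harmonic (idx ks) (idx ls)))))"
    (is ?goal)
  proof (cases "Z 1 = 1")
    case True
    then interpret double_shuffle_map Z
      using assms by unfold_locales
    show ?goal
      unfolding k l idx_Suc ones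
      using kawashima dr m kl by blast
  next
    case False
    note zero = double_shuffle_degenerate[OF assms(2) False]
    show ?goal
      unfolding k l idx_Suc ones
      by (auto simp: zero[OF circ_hoffman_star_harmonic_H0[OF m kl(1)]] zero[OF circ_hoffman_H0[OF _ kl(1)]]
          intro!: sum.neutral)
  qed
qed

end
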